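(* Let $\rho$ be an admissible kernel on $\mathbb{R}^d$ with $\int_{\mathbb{R}^d}\rho\,dz=d$ and $\operatorname{supp}\rho=\overline{B_1(0)}$, and for $\varepsilon>0$ let $\rho_\varepsilon(z):=\varepsilon^{-d}\rho(z/\varepsilon)$ and $\operatorname{P}_\varepsilon(E):=\sup\{\int_E\operatorname{div}_{\rho_\varepsilon}p\,dx: p\in C_c^\infty(\mathbb{R}^d;\mathbb{R}^d),\ \|p\|_{L^\infty}\le1\}$ for $E\in\mathcal{M}_d$. Let $\Omega\subset\mathbb{R}^d$ be open and bounded, $m\in(0,|\Omega|)$, and define $\mathcal{F}_\varepsilon,\mathcal{F}:\mathcal{M}_d\to[0,\infty]$ by $$\mathcal{F}_\varepsilon(E)=\begin{cases}\operatorname{P}_\varepsilon(E)&\text{if }E\subset\Omega\text{ and }|E|=m,\\ \infty&\text{else,}\end{cases}\qquad \mathcal{F}(E)=\begin{cases}\operatorname{P}(E)&\text{if }E\subset\Omega\text{ and }|E|=m,\\ \infty&\text{else,}\end{cases}$$ where $\operatorname{P}$ is the classical perimeter. Then: (i) $(\operatorname{P}_\varepsilon)_\varepsilon$ $\Gamma$-converges as $\varepsilon\to0$ to $\operatorname{P}$ with respect to the local convergence of sets. (ii) $(\mathcal{F}_\varepsilon)_\varepsilon$ $\Gamma$-converges as $\varepsilon\to0$ to $\mathcal{F}$ with respect to the convergence of sets. Moreover, $(\mathcal{F}_\varepsilon)_\varepsilon$ is also equi-coercive in this topology.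
   Context: $\mathcal{M}_d$ is the collection of Lebesgue measurable subsets of $\mathbb{R}^d$ (up to null sets). Convergence of sets $E_n\to E$: $|E_n\Delta E|\to0$; local convergence: $\mathbf{1}_{E_n}\to\mathbf{1}_E$ in $L^1_{\rm loc}(\mathbb{R}^d)$. Equi-coercive means: for every $\varepsilon_n\to0$ and sets $E_n$ with $\sup_n\mathcal{F}_{\varepsilon_n}(E_n)<\infty$, a subsequence of $(E_n)$ converges. Admissible kernel: a radial function $\rho:\mathbb{R}^d\setminus\{0\}\to[0,\infty)$, $\rho(z)=\overline\rho(|z|)$, such that for some $\eta>0$, $\nu>0$, $0<\sigma\le\gamma<1$: $\inf_{\overline{B_\eta(0)}\setminus\{0\}}\rho>0$; $\rho(\cdot)\min\{1,|\cdot|^{-1}\}\in L^1(\mathbb{R}^d)$; and (H1) $f_\rho(r):=r^{d-2}\overline\rho(r)$ is nonincreasing on $(0,\infty)$ and $r\mapsto r^\nu f_\rho(r)$ is nonincreasing on $(0,\eta)$; (H2) $f_\rho$ is smooth on $(0,\infty)$ and for every $k\in\mathbb{N}$ there is $C_k>0$ with $|f_\rho^{(k)}(r)|\le C_kf_\rho(r)/r^k$ for $r\in(0,\eta)$; (H3) $r\mapsto r^{d+\sigma-1}\overline\rho(r)$ is almost nonincreasing on $(0,\eta)$; (H4) $r\mapsto r^{d+\gamma-1}\overline\rho(r)$ is almost nondecreasing on $(0,\eta)$. Here $h$ is almost nonincreasing (almost nondecreasing) if there is $C\geq 1$ with $h(s)\le Ch(r)$ (resp. $h(r)\le Ch(s)$)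 for all $r\le s$ in the interval. For $p\in C_c^\infty(\mathbb{R}^d;\mathbb{R}^d)$, $\operatorname{div}_{\rho_\varepsilon}p(x):=\int_{\mathbb{R}^d}\frac{p(y)-p(x)}{|y-x|}\cdot\frac{y-x}{|y-x|}\rho_\varepsilon(y-x)\,dy$. *)

theory Defs
  imports "HOL-Analysis.Analysis"
begin

section \<open>Smooth compactly supported fields\<close>

primrec Ck :: "nat \<Rightarrow> ('a::real_normed_vector \<Rightarrow> 'b::real_normed_vector) \<Rightarrow> bool" where
  "Ck 0 f \<longleftrightarrow> continuous_on UNIV f"
| "Ck (Suc k) f \<longleftrightarrow>
     (\<forall>x. f differentiable (at x)) \<and> (\<forall>v. Ck k (\<lambda>x. frechet_derivative f (at x) v))"

definition smooth :: "('a::real_normed_vector \<Rightarrow> 'b::real_normed_vector) \<Rightarrow> bool" where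
  "smooth f \<longleftrightarrow> (\<forall>k. Ck k f)"

text \<open>The fields are continuous, so the bound on the \<open>L\<^sup>\<infinity>\<close> norm is a pointwise bound.\<close>

definition test_fields :: "('a::euclidean_space \<Rightarrow> 'a) set" where
  "test_fields = {p. smooth p \<and> compact (closure {x. p x \<noteq> 0}) \<and> (\<forall>x. norm (p x) \<le> 1)}"

section \<open>Admissible kernels\<close>

definition almost_nonincreasing_on :: "real set \<Rightarrow> (real \<Rightarrow> real) \<Rightarrow> bool" where
  "almost_nonincreasing_on I h \<longleftrightarrow> (\<exists>C\<ge>1. \<forall>r\<in>I. \<forall>s\<in>I. r \<le> s \<longrightarrow> h s \<le> C * h r)"

definition almost_nondecreasing_on :: "real set \<Rightarrow> (real \<Rightarrow> real) \<Rightarrow> bool" where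
  "almost_nondecreasing_on I h \<longleftrightarrow> (\<exists>C\<ge>1. \<forall>r\<in>I. \<forall>s\<in>I. r \<le> s \<longrightarrow> h r \<le> C * h s)"

text \<open>
  A kernel lives on \<open>\<real>\<^sup>d\<close> without the origin: its value at \<open>0\<close> is arbitrary, as are the values
  of the radial profile \<open>\<rho>b\<close> outside \<open>(0, \<infinity>)\<close>. The functions of \<open>r\<close> below only enter through
  their values on \<open>(0, \<infinity>)\<close>; as this set is open, so do their derivatives there.
\<close>

definition admissible_kernel :: "('a::euclidean_space \<Rightarrow> real) \<Rightarrow> bool" where
  "admissible_kernel \<rho> \<longleftrightarrow>
    (\<exists>\<rho>b \<eta> \<nu> \<sigma> \<gamma>. let d = real DIM('a); f = (\<lambda>r. r powr (d - 2) * \<rho>b r) in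
       (\<forall>z. z \<noteq> 0 \<longrightarrow> \<rho> z = \<rho>b (norm z) \<and> 0 \<le> \<rho> z)
     \<and> 0 < \<eta> \<and> 0 < \<nu> \<and> 0 < \<sigma> \<and> \<sigma> \<le> \<gamma> \<and> \<gamma> < 1
     \<and> 0 < (INF z\<in>cball 0 \<eta> - {0}. \<rho> z)
     \<and> integrable lebesgue (\<lambda>z. \<rho> z * min 1 (inverse (norm z)))
     \<and> antimono_on {0<..} f
     \<and> antimono_on {0<..<\<eta>} (\<lambda>r. r powr \<nu> * f r)
     \<and> (\<forall>k. \<forall>r>0. (deriv ^^ k) f field_differentiable (at r))
     \<and> (\<forall>k. \<exists>C>0. \<forall>r\<in>{0<..<\<eta>}. \<bar>(deriv ^^ k) f r\<bar> \<le> C * f r / r ^ k)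
     \<and> almost_nonincreasing_on {0<..<\<eta>} (\<lambda>r. r powr (d + \<sigma> - 1) * \<rho>b r)
     \<and> almost_nondecreasing_on {0<..<\<eta>} (\<lambda>r. r powr (d + \<gamma> - 1) * \<rho>b r))"

definition kernel_support :: "('a::euclidean_space \<Rightarrow> real) \<Rightarrow> 'a set" where
  "kernel_support \<rho> = closure {z. z \<noteq> 0 \<and> \<rho> z \<noteq> 0}"

definition rescale :: "('a::euclidean_space \<Rightarrow> real) \<Rightarrow> real \<Rightarrow> 'a \<Rightarrow> real" where
  "rescale \<rho> \<epsilon> z = \<rho> (z /\<^sub>R \<epsilon>) / \<epsilon> ^ DIM('a)"

section \<open>Perimeters\<close>

definition nonlocal_div :: "('a::euclidean_space \<Rightarrow> real) \<Rightarrow> ('a \<Rightarrow> 'a) \<Rightarrow> 'a \<Rightarrow> real" where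
  "nonlocal_div \<rho> p x =
    (LINT y|lebesgue. ((p y - p x) /\<^sub>R norm (y - x)) \<bullet> ((y - x) /\<^sub>R norm (y - x)) * \<rho> (y - x))"

definition nonlocal_perimeter :: "('a::euclidean_space \<Rightarrow> real) \<Rightarrow> 'a set \<Rightarrow> ereal" where
  "nonlocal_perimeter \<rho> E = (SUP p\<in>test_fields. ereal (LINT x:E|lebesgue. nonlocal_div \<rho> p x))"

definition classical_div :: "('a::euclidean_space \<Rightarrow> 'a) \<Rightarrow> 'a \<Rightarrow> real" where
  "classical_div p x = (\<Sum>i\<in>Basis. frechet_derivative p (at x) i \<bullet> i)"

definition perimeter :: "'a::euclidean_space set \<Rightarrow> ereal" where
  "perimeter E = (SUP p\<in>test_fields. ereal (LINT x:E|lebesgue. classical_div p x))"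

text \<open>
  Measurable sets up to null sets are represented by arbitrary members of \<open>sets lebesgue\<close>. All
  functionals and convergences are insensitive to null sets; in particular, inclusion in
  \<open>\<Omega>\<close> is inclusion up to a null set.
\<close>

definition constrained :: "('a::euclidean_space set \<Rightarrow> ereal) \<Rightarrow> 'a set \<Rightarrow> real \<Rightarrow> 'a set \<Rightarrow> ereal" where
  "constrained P \<Omega> m E =
    (if E - \<Omega> \<in> null_sets lebesgue \<and> emeasure lebesgue E = ennreal m then P E else \<infinity>)"

section \<open>Convergence\<close>

definition set_conv :: "(nat \<Rightarrow> 'a::euclidean_space set) \<Rightarrow> 'a set \<Rightarrow> bool" where
  "set_conv X E \<longleftrightarrow> (\<lambda>n. emeasure lebesgue (sym_diff (X n) E)) \<longlonglongrightarrow> 0"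

definition local_set_conv :: "(nat \<Rightarrow> 'a::euclidean_space set) \<Rightarrow> 'a set \<Rightarrow> bool" where
  "local_set_conv X E \<longleftrightarrow>
    (\<forall>K. compact K \<longrightarrow>
      (\<lambda>n. LINT x:K|lebesgue. \<bar>indicator (X n) x - indicator E x :: real\<bar>) \<longlonglongrightarrow> 0)"

text \<open>
  Both convergences are metrizable on measurable sets up to null sets, so that \<open>\<Gamma>\<close>-convergence of
  a family as \<open>\<epsilon> \<rightarrow> 0\<close> is sequential \<open>\<Gamma>\<close>-convergence along every sequence of positive \<open>\<epsilon>\<close>
  tending to \<open>0\<close>. The set \<open>M\<close> is the domain of the functionals.
\<close>

definition gamma_converges ::
    "'s set \<Rightarrow> ((nat \<Rightarrow> 's) \<Rightarrow> 's \<Rightarrow> bool) \<Rightarrow> (real \<Rightarrow> 's \<Rightarrow> ereal) \<Rightarrow> ('s \<Rightarrow> ereal) \<Rightarrow> bool" where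
  "gamma_converges M conv F G \<longleftrightarrow>
    (\<forall>\<epsilon>. (\<forall>n. 0 < \<epsilon> n) \<and> \<epsilon> \<longlonglongrightarrow> 0 \<longrightarrow>
      (\<forall>x\<in>M.
        (\<forall>X. (\<forall>n. X n \<in> M) \<and> conv X x \<longrightarrow> G x \<le> liminf (\<lambda>n. F (\<epsilon> n) (X n))) \<and>
        (\<exists>X. (\<forall>n. X n \<in> M) \<and> conv X x \<and> limsup (\<lambda>n. F (\<epsilon> n) (X n)) \<le> G x)))"

definition equi_coercive ::
    "'s set \<Rightarrow> ((nat \<Rightarrow> 's) \<Rightarrow> 's \<Rightarrow> bool) \<Rightarrow> (real \<Rightarrow> 's \<Rightarrow> ereal) \<Rightarrow> bool" where
  "equi_coercive M conv F \<longleftrightarrow>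
    (\<forall>\<epsilon> X. (\<forall>n. 0 < \<epsilon> n) \<and> \<epsilon> \<longlonglongrightarrow> 0 \<and> (\<forall>n. X n \<in> M) \<and> (SUP n. F (\<epsilon> n) (X n)) < \<infinity> \<longrightarrow>
      (\<exists>r x. strict_mono r \<and> x \<in> M \<and> conv (X \<circ> r) x))"

end

theory Submission
  imports Defs "HOL-Complex_Analysis.Great_Picard"
begin

text \<open>
  With \<open>\<rho> z = \<bar>z\<bar>\<^sup>2 k (\<bar>z\<bar>\<^sup>2)\<close>, the radial function \<open>Q\<close> whose gradient is \<open>- \<rho> z z / \<bar>z\<bar>\<^sup>2\<close> is a
  probability density on the unit ball, and the nonlocal divergence of a field is the classical
  divergence of its convolution with \<open>Q\<close> at scale \<open>\<epsilon>\<close>. As this convolution maps test fields to test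
  fields, the nonlocal perimeters lie below the classical one, so that constant sequences are recovery
  sequences; the lower bound is the uniform convergence of the divergences.

  For equi-coercivity, let \<open>v\<close> be a mollification at scale \<open>r\<close> of the indicator of a set of
  nonlocal perimeter at most \<open>C\<close>. Testing with \<open>- \<nabla>v\<close>, and moving a dilation from the
  autocorrelation of \<open>v\<close> to the kernel, whose profile decreases at a definite rate, gives
  \<open>\<integral> k (\<bar>z\<bar>\<^sup>2) \<parallel>v (\<cdot> + \<epsilon> z) - v\<parallel>\<^sup>2 dz \<lesssim> \<epsilon>\<^sup>2 C / r\<close>. By the lower bound on \<open>k\<close> this is
  \<open>\<parallel>v (\<cdot> + a) - v\<parallel>\<^sup>2 \<lesssim> C \<bar>a\<bar> powr (1 + \<sigma>) / r\<close>, uniformly in \<open>\<epsilon> \<le> 1\<close>. Comparing the scales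
  \<open>\<bar>a\<bar>\<close> and \<open>r = \<bar>a\<bar> / M\<close> turns it into a translation modulus \<open>K \<bar>a\<bar> powr \<sigma>\<close> for the indicator
  itself, which makes the sets precompact.
\<close>

section \<open>Smooth maps\<close>

text \<open>Increments are measured in mean square because this is what the autocorrelation
  determines, and for an indicator it is the measure of the symmetric difference of the set and its
  translate. Testing with the gradient yields only the radial derivative of the autocorrelation; the
  extra factor \<open>l powr \<nu>\<close> gained by the kernel under dilations turns it into the
  increments themselves, near the origin. The energy estimate sees increments shorter than
  \<open>\<epsilon> * \<eta>\<close>. A longer one is cut into \<open>n\<close> such pieces, which
  costs \<open>n\<^sup>2\<close>; the factor \<open>\<epsilon>\<^sup>2\<close> of the estimate pays
  for it, whence the uniformity in \<open>\<epsilon>\<close>. The obstacle is a circle: the estimate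
  needs a slope, hence a mollification, but the error of mollifying is the very modulus sought. A
  contraction on Hoelder constants breaks it. It must start from a finite constant, which smooth
  functions have, so it is run on mollified indicators; the indicator follows since its translates
  are continuous in mean square, without any rate. The mollifier is built from the kernel profile,
  which is smooth away from \<open>0\<close>, positive below \<open>1\<close> and zero
  beyond.\<close>

abbreviation fd :: "('a::real_normed_vector \<Rightarrow> 'b::real_normed_vector) \<Rightarrow> 'a \<Rightarrow> 'a \<Rightarrow> 'b"
  where "fd f x \<equiv> frechet_derivative f (at x)"

lemma fd_eqI: "(f has_derivative f') (at x) \<Longrightarrow> fd f x = f'"
  by (metis frechet_derivative_at)

lemma smooth_has_derivative:
  assumes "smooth f"
  shows "(f has_derivative fd f x) (at x)"
  using assms[unfolded smooth_def, rule_format, of 1]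
  by (simp add: frechet_derivative_works)

lemma smooth_differentiable: "smooth f \<Longrightarrow> f differentiable (at x)"
  using smooth_has_derivative differentiable_def by blast

lemma smooth_linear_fd: "smooth f \<Longrightarrow> bounded_linear (fd f x)"
  using smooth_has_derivative has_derivative_bounded_linear by blast

lemma smooth_fd: "smooth f \<Longrightarrow> smooth (\<lambda>x. fd f x v)"
  unfolding smooth_def by (metis Ck.simps(2))

lemma smooth_continuous_on: "smooth f \<Longrightarrow> continuous_on S f"
  unfolding smooth_def by (metis Ck.simps(1) continuous_on_subset subset_UNIV)

text \<open>A class of differentiable maps closed under directional derivatives has derivatives of
  all orders, by induction on the order for all members at once. Each use only has to guess the
  class; higher derivatives are never written out.\<close>

lemma smooth_coinduct:
  assumes "P f"
    and "\<And>f x. P f \<Longrightarrow> f differentiable (at x)"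
    and "\<And>f v. P f \<Longrightarrow> P (\<lambda>x. fd f x v)"
  shows "smooth f"
proof -
  have "Ck k f" if "P f" for k f
    using that
  proof (induction k arbitrary: f)
    case 0
    then show ?case
      using assms(2) by (simp add: continuous_at_imp_continuous_on differentiable_imp_continuous_within)
  qed (use assms in simp)
  then show ?thesis
    using \<open>P f\<close> by (simp add: smooth_def)
qed

lemma smoothI:
  assumes "\<And>x. (f has_derivative f' x) (at x)" and "\<And>v. smooth (\<lambda>x. f' x v)"
  shows "smooth f"
proof (rule smooth_coinduct[where P = "\<lambda>g. g = f \<or> smooth g"])
  have "fd f x = f' x" for x
    using assms(1) by (rule fd_eqI)
  then show "g = f \<or> smooth g \<Longrightarrow> (\<lambda>x. fd g x v) = f \<or> smooth (\<lambda>x. fd g x v)" for g v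
    using assms(2) smooth_fd by auto
qed (use assms smooth_differentiable differentiableI in blast)+

lemma smooth_const: "smooth (\<lambda>x. c)"
  by (rule smooth_coinduct[where P = "\<lambda>f. \<exists>c. f = (\<lambda>x. c)"]) auto

lemma smooth_linear: "bounded_linear L \<Longrightarrow> smooth L"
  by (rule smoothI[where f' = "\<lambda>x. L"]) (auto simp: smooth_const bounded_linear_imp_has_derivative)

lemma has_derivative_affine:
  assumes "smooth f"
  shows "((\<lambda>x. f (s *\<^sub>R x + a)) has_derivative (\<lambda>v. s *\<^sub>R fd f (s *\<^sub>R x + a) v)) (at x)"
proof -
  have "((\<lambda>x. s *\<^sub>R x + a) has_derivative (\<lambda>v. s *\<^sub>R v)) (at x)"
    by (auto intro!: derivative_eq_intros)
  from has_derivative_compose[OF this smooth_has_derivative[OF assms]]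
  show ?thesis
    by (simp add: linear_scale[OF bounded_linear.linear[OF smooth_linear_fd[OF assms]]])
qed

lemma smooth_affine:
  assumes "smooth f"
  shows "smooth (\<lambda>x. f (s *\<^sub>R x + a))"
proof -
  have d: "((\<lambda>x. c *\<^sub>R g (s *\<^sub>R x + a)) has_derivative (\<lambda>v. c *\<^sub>R s *\<^sub>R fd g (s *\<^sub>R x + a) v)) (at x)"
    if "smooth g" for c x and g :: "'a \<Rightarrow> 'b"
    by (rule has_derivative_scaleR_right[OF has_derivative_affine[OF that]])
  have "smooth (\<lambda>x. 1 *\<^sub>R f (s *\<^sub>R x + a))"
  \<comment> \<open>The free factor \<open>c\<close> absorbs the power of \<open>s\<close> that each
    differentiation produces, which closes the class.\<close>
  proof (rule smooth_coinduct[where P = "\<lambda>h. \<exists>g c. smooth g \<and> h = (\<lambda>x. c *\<^sub>R g (s *\<^sub>R x + a))"])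
    show "\<exists>g c. smooth g \<and> (\<lambda>x. 1 *\<^sub>R f (s *\<^sub>R x + a)) = (\<lambda>x. c *\<^sub>R g (s *\<^sub>R x + a))"
      using assms by blast
    fix h :: "'a \<Rightarrow> 'b" and x v
    assume "\<exists>g c. smooth g \<and> h = (\<lambda>x. c *\<^sub>R g (s *\<^sub>R x + a))"
    then obtain g c where g: "smooth g" "h = (\<lambda>x. c *\<^sub>R g (s *\<^sub>R x + a))"
      by blast
    show "h differentiable at x"
      using d[OF g(1)] g(2) differentiableI by blast
    have "(\<lambda>x. fd h x v) = (\<lambda>x. (c * s) *\<^sub>R fd g (s *\<^sub>R x + a) v)"
      using fd_eqI[OF d[OF g(1)]] g(2) by auto
    then show "\<exists>g c. smooth g \<and> (\<lambda>x. fd h x v) = (\<lambda>x. c *\<^sub>R g (s *\<^sub>R x + a))"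
      using smooth_fd[OF g(1)] by blast
  qed
  then show ?thesis by simp
qed

lemma smooth_bounded_linear_comp:
  assumes L: "bounded_linear L" and "smooth f"
  shows "smooth (\<lambda>x. L (f x))"
proof (rule smooth_coinduct[where P = "\<lambda>h. \<exists>g. smooth g \<and> h = (\<lambda>x. L (g x))"])
  show "\<exists>g. smooth g \<and> (\<lambda>x. L (f x)) = (\<lambda>x. L (g x))"
    using assms by blast
  fix h x v
  assume "\<exists>g. smooth g \<and> h = (\<lambda>x. L (g x))"
  then obtain g where g: "smooth g" "h = (\<lambda>x. L (g x))" by blast
  have d: "(h has_derivative (\<lambda>v. L (fd g x v))) (at x)" for x
    using bounded_linear.has_derivative[OF L smooth_has_derivative[OF g(1)]] g(2) by simp
  show "h differentiable at x" using d differentiableI by blast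
  show "\<exists>g. smooth g \<and> (\<lambda>x. fd h x v) = (\<lambda>x. L (g x))"
    using fd_eqI[OF d] smooth_fd[OF g(1)] by auto
qed

lemma Ck_add: "Ck k f \<Longrightarrow> Ck k g \<Longrightarrow> Ck k (\<lambda>x. f x + g x)"
proof (induction k arbitrary: f g)
  case (Suc k)
  have d: "((\<lambda>x. f x + g x) has_derivative (\<lambda>v. fd f x v + fd g x v)) (at x)" for x
    using Suc.prems by (intro has_derivative_add) (auto simp: frechet_derivative_works)
  then show ?case
    using fd_eqI[OF d] Suc by (auto intro: differentiableI)
qed (auto intro: continuous_intros)

lemma smooth_add: "smooth f \<Longrightarrow> smooth g \<Longrightarrow> smooth (\<lambda>x. f x + g x)"
  by (simp add: smooth_def Ck_add)

lemma smooth_sum: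
  assumes "finite I" "\<And>i. i \<in> I \<Longrightarrow> smooth (f i)"
  shows "smooth (\<lambda>x. \<Sum>i\<in>I. f i x)"
  using assms by (induction I) (auto simp: smooth_const smooth_add)

lemma Ck_Suc_imp: "Ck (Suc k) f \<Longrightarrow> Ck k f"
proof (induction k arbitrary: f)
  case 0
  then show ?case
    by (simp add: continuous_at_imp_continuous_on differentiable_imp_continuous_within)
qed simp

lemma Ck_mult:
  fixes f g :: "'a::real_normed_vector \<Rightarrow> real"
  shows "Ck k f \<Longrightarrow> Ck k g \<Longrightarrow> Ck k (\<lambda>x. f x * g x)"
proof (induction k arbitrary: f g)
  case (Suc k)
  have d: "((\<lambda>x. f x * g x) has_derivative (\<lambda>v. f x * fd g x v + fd f x v * g x)) (at x)" for x
    using Suc.prems by (intro has_derivative_mult) (auto simp: frechet_derivative_works)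
  have "Ck k (\<lambda>x. f x * fd g x v + fd f x v * g x)" for v
    using Suc.prems Ck_Suc_imp by (intro Ck_add Suc.IH) auto
  then show ?case
    using fd_eqI[OF d] by (auto intro: differentiableI[OF d])
qed (auto intro: continuous_intros)

lemma smooth_scaleR:
  assumes "smooth f"
  shows "smooth (\<lambda>x. c *\<^sub>R f x)"
  using smooth_bounded_linear_comp[OF bounded_linear_scaleR_right assms] .

text \<open>The shift \<open>c > 0\<close> keeps the argument in the half-line where
  \<open>f\<close> is differentiable. Each derivative raises the order of \<open>deriv\<close> and
  adds a linear factor, so the induction treats all iterated derivatives together. This provides the
  mollifier.\<close>

lemma smooth_radial:
  fixes f :: "real \<Rightarrow> real" and c :: real
  assumes f: "\<And>k r. r > 0 \<Longrightarrow> (deriv ^^ k) f field_differentiable (at r)" and "c > 0"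
  shows "smooth (\<lambda>x::'a::euclidean_space. f (c + x \<bullet> x))"
proof -
  have pos: "c + x \<bullet> x > 0" for x :: 'a
    using \<open>c > 0\<close> by (simp add: add_pos_nonneg)
  have d: "((\<lambda>x::'a. (deriv ^^ j) f (c + x \<bullet> x)) has_derivative
      (\<lambda>v. (deriv ^^ Suc j) f (c + x \<bullet> x) * (2 * (x \<bullet> v)))) (at x)" for j x
  proof -
    have 1: "((\<lambda>x. c + x \<bullet> x) has_derivative (\<lambda>v. 2 * (x \<bullet> v))) (at x)"
      by (auto intro!: derivative_eq_intros simp: inner_commute)
    have "((deriv ^^ j) f has_real_derivative deriv ((deriv ^^ j) f) (c + x \<bullet> x)) (at (c + x \<bullet> x))"
      using f[OF pos] DERIV_deriv_iff_field_differentiable by blast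
    from has_derivative_compose[OF 1 this[unfolded has_field_derivative_def]]
    show ?thesis by simp
  qed
  have "Ck k (\<lambda>x::'a. (deriv ^^ j) f (c + x \<bullet> x))" for k j
  proof (induction k arbitrary: j)
    case 0
    then show ?case
      using has_derivative_continuous_on[OF has_derivative_at_withinI[OF d[of j]]] by auto
  next
    case (Suc k)
    have "Ck k (\<lambda>x::'a. 2 * (x \<bullet> v))" for v
      using smooth_linear[OF bounded_linear_const_mult[OF bounded_linear_inner_left]]
      by (auto simp: smooth_def)
    then have "Ck k (\<lambda>x::'a. (deriv ^^ Suc j) f (c + x \<bullet> x) * (2 * (x \<bullet> v)))" for v
      by (rule Ck_mult[OF Suc.IH])
    then show ?case
      using fd_eqI[OF d] by (auto intro: differentiableI[OF d])
  qed
  from this[of _ 0] show ?thesis by (simp add: smooth_def)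
qed

section \<open>Compactly supported maps and weighted averages\<close>

definition bsupp :: "('a::real_normed_vector \<Rightarrow> 'b::zero) \<Rightarrow> bool"
  where "bsupp f \<longleftrightarrow> (\<exists>R. \<forall>x. f x \<noteq> 0 \<longrightarrow> norm x \<le> R)"

lemma compact_support_iff:
  "compact (closure {x::'a::euclidean_space. f x \<noteq> 0}) \<longleftrightarrow> bsupp f"
  by (simp add: compact_closure bsupp_def bounded_iff)

lemma bsuppE:
  assumes "bsupp f"
  obtains R where "R > 0" "\<And>x. norm x > R \<Longrightarrow> f x = 0"
proof -
  obtain R where R: "\<And>x. f x \<noteq> 0 \<Longrightarrow> norm x \<le> R"
    using assms unfolding bsupp_def by blast
  show thesis
  proof
    show "f x = 0" if "norm x > max R 1" for x
      using R[of x] that by (metis max_less_iff_conj not_le)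
  qed simp
qed

lemma fd_zero_outside:
  fixes f :: "'a::real_normed_vector \<Rightarrow> 'b::real_normed_vector"
  assumes "\<And>x. norm x > R \<Longrightarrow> f x = 0" and x: "norm x > R"
  shows "fd f x v = 0"
proof -
  have "open {x::'a. norm x > R}"
    by (intro open_Collect_less continuous_intros)
  then have "(f has_derivative (\<lambda>v. 0)) (at x)"
    using assms by (intro has_derivative_transform_within_open[OF has_derivative_const[of 0]]) auto
  then show ?thesis by (simp add: fd_eqI)
qed

lemma bsupp_fd:
  fixes f :: "'a::real_normed_vector \<Rightarrow> 'b::real_normed_vector"
  assumes "bsupp f"
  shows "bsupp (\<lambda>x. fd f x v)"
  unfolding bsupp_def using bsuppE[OF assms] fd_zero_outside by (metis not_le)

lemma continuous_bsupp_bounded: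
  fixes f :: "'a::euclidean_space \<Rightarrow> 'b::real_normed_vector"
  assumes "continuous_on UNIV f" "bsupp f"
  obtains B where "B > 0" "\<And>x. norm (f x) \<le> B"
proof -
  obtain R where R: "\<And>x. norm x > R \<Longrightarrow> f x = 0"
    using bsuppE[OF assms(2)] by blast
  have "compact (f ` cball 0 R)"
    using assms(1) by (intro compact_continuous_image) (auto intro: continuous_on_subset)
  then obtain B where B: "B > 0" "\<And>y. y \<in> f ` cball 0 R \<Longrightarrow> norm y \<le> B"
    by (metis bounded_pos compact_imp_bounded)
  have "norm (f x) \<le> B" for x
  proof (cases "norm x \<le> R")
    case False
    then show ?thesis using R B(1) by simp
  qed (use B(2) in auto)
  with B(1) show thesis using that by blast
qed

lemma integrable_bounded_bsupp:
  fixes f :: "'a::euclidean_space \<Rightarrow> 'b::{banach, second_countable_topology}"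
  assumes "f \<in> borel_measurable lborel" "bsupp f" "\<And>x. norm (f x) \<le> B"
  shows "integrable lborel f"
proof -
  obtain R where R: "\<And>x. norm x > R \<Longrightarrow> f x = 0"
    using bsuppE[OF assms(2)] by blast
  have "integrable lborel (\<lambda>x. indicator (cball (0::'a) R) x *\<^sub>R B)"
    by (rule borel_integrable_compact) auto
  then show ?thesis
  proof (rule Bochner_Integration.integrable_bound)
    show "AE x in lborel. norm (f x) \<le> norm (indicat_real (cball 0 R) x *\<^sub>R B)"
      using R assms(3) by (intro AE_I2) (auto simp: indicator_def intro: order.trans[OF _ abs_ge_self])
  qed (use assms in auto)
qed

lemma integrable_continuous_bsupp:
  fixes f :: "'a::euclidean_space \<Rightarrow> 'b::{banach, second_countable_topology}"
  assumes "continuous_on UNIV f" "bsupp f"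
  shows "integrable lborel f"
proof -
  obtain B where "\<And>x. norm (f x) \<le> B"
    using continuous_bsupp_bounded[OF assms] by blast
  with assms show ?thesis
    by (intro integrable_bounded_bsupp) (auto intro: borel_measurable_continuous_onI)
qed

lemma smooth_borel: "smooth f \<Longrightarrow> f \<in> borel_measurable borel"
  using smooth_continuous_on borel_measurable_continuous_onI by blast

lemma smooth_fd_bound:
  fixes f :: "'a::euclidean_space \<Rightarrow> 'b::real_normed_vector"
  assumes "smooth f" "bsupp f"
  obtains B where "B > 0" "\<And>x v. norm (fd f x v) \<le> B * norm v"
proof -
  have "\<exists>B>0. \<forall>x. norm (fd f x i) \<le> B" for i
    using continuous_bsupp_bounded[OF smooth_continuous_on[OF smooth_fd[OF assms(1)]] bsupp_fd[OF assms(2)]]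
    by metis
  then obtain b where b: "\<And>i. b i > 0" "\<And>i x. norm (fd f x i) \<le> b i"
    by metis
  have "norm (fd f x v) \<le> (\<Sum>i\<in>Basis. b i) * norm v" for x v
  proof -
    interpret bounded_linear "fd f x" by (rule smooth_linear_fd[OF assms(1)])
    have "fd f x v = (\<Sum>i\<in>Basis. (v \<bullet> i) *\<^sub>R fd f x i)"
      by (subst euclidean_representation[of v, symmetric]) (simp add: sum scaleR del: euclidean_representation)
    also have "norm \<dots> \<le> (\<Sum>i\<in>Basis. norm v * b i)"
      by (intro sum_norm_le) (use b Basis_le_norm in \<open>auto intro!: mult_mono\<close>)
    finally show ?thesis by (simp add: sum_distrib_left mult.commute)
  qed
  moreover have "(\<Sum>i\<in>(Basis::'a set). b i) > 0"
    using b(1) by (intro sum_pos) auto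
  ultimately show thesis using that by blast
qed

lemma fd_bound_imp_lipschitz:
  fixes f :: "'a::euclidean_space \<Rightarrow> 'b::real_normed_vector"
  assumes "smooth f" "\<And>x v. norm (fd f x v) \<le> B * norm v"
  shows "norm (f x - f y) \<le> B * norm (x - y)"
proof (rule differentiable_bound[of UNIV f "fd f"])
  show "onorm (fd f x) \<le> B" for x
    using assms(2) by (rule onorm_le)
qed (use smooth_has_derivative[OF assms(1)] in auto)

text \<open>The derivatives along the basis are Lipschitz, having bounded derivatives themselves;
  summing makes \<open>fd f\<close> Lipschitz. The remainder is uniform in \<open>x\<close>, so it
  can be integrated against any integrable weight.\<close>

lemma smooth_taylor:
  fixes f :: "'a::euclidean_space \<Rightarrow> 'b::real_normed_vector"
  assumes "smooth f" "bsupp f"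
  obtains L where "L > 0" "\<And>x v. norm (f (x + v) - f x - fd f x v) \<le> L * (norm v)\<^sup>2"
proof -
  have "\<exists>B>0. \<forall>x y. norm (fd f x i - fd f y i) \<le> B * norm (x - y)" for i
  proof -
    obtain B where "B > 0" "\<And>x v. norm (fd (\<lambda>x. fd f x i) x v) \<le> B * norm v"
      using smooth_fd_bound[OF smooth_fd[OF assms(1)] bsupp_fd[OF assms(2)]] by blast
    then show ?thesis
      using fd_bound_imp_lipschitz[OF smooth_fd[OF assms(1)], of i B] by blast
  qed
  then obtain b where b: "\<And>i. b i > 0" "\<And>i x y. norm (fd f x i - fd f y i) \<le> b i * norm (x - y)"
    by metis
  define L where "L = (\<Sum>i\<in>(Basis::'a set). b i)"
  have *: "norm (fd f x v - fd f y v) \<le> (L * norm (x - y)) * norm v" for x y v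
  proof -
    interpret f: bounded_linear "\<lambda>v. fd f x v - fd f y v"
      by (intro bounded_linear_sub smooth_linear_fd[OF assms(1)])
    have "fd f x v - fd f y v = (\<Sum>i\<in>Basis. (v \<bullet> i) *\<^sub>R (fd f x i - fd f y i))"
      using f.sum[of "\<lambda>i. (v \<bullet> i) *\<^sub>R i" Basis] f.scaleR
      by (simp add: euclidean_representation)
    also have "norm \<dots> \<le> (\<Sum>i\<in>Basis. norm v * (b i * norm (x - y)))"
      by (intro sum_norm_le) (use b Basis_le_norm in \<open>auto intro!: mult_mono\<close>)
    finally show ?thesis by (simp add: L_def sum_distrib_left sum_distrib_right mult_ac)
  qed
  have "L > 0"
    using b(1) unfolding L_def by (intro sum_pos) auto
  moreover have "norm (f (x + v) - f x - fd f x v) \<le> L * (norm v)\<^sup>2" for x v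
  proof -
    have "norm (f (x + v) - f x - fd f x ((x + v) - x)) \<le> norm ((x + v) - x) * (L * norm v)"
    \<comment> \<open>On this ball \<open>fd f\<close> differs from \<open>fd f x\<close> by at most
      \<open>L * norm v\<close>, the second factor of the quadratic bound.\<close>
    proof (rule differentiable_bound_linearization[where S = "cball x (norm v)"])
      show "onorm (fd f y - fd f x) \<le> L * norm v" if "y \<in> cball x (norm v)" for y
      proof (rule onorm_le)
        fix w :: 'a
        have "L * norm (y - x) * norm w \<le> L * norm v * norm w"
          using that \<open>L > 0\<close> by (intro mult_right_mono mult_left_mono) (auto simp: dist_norm norm_minus_commute)
        then show "norm ((fd f y - fd f x) w) \<le> L * norm v * norm w"
          using *[of y w x] by (simp only: fun_diff_def)
      qed
      show "x + t *\<^sub>R (x + v - x) \<in> cball x (norm v)" if "t \<in> {0..1}" for t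
        using that by (auto simp: dist_norm mult_left_le_one_le)
    qed (use smooth_has_derivative[OF assms(1)] in \<open>auto intro: has_derivative_at_withinI\<close>)
    then show ?thesis by (simp add: power2_eq_square mult_ac)
  qed
  ultimately show thesis using that by blast
qed

text \<open>Weighted averages of translates of a smooth function; this covers convolutions with
  integrable and with rescaled kernels alike.\<close>

definition avg :: "'z measure \<Rightarrow> ('z \<Rightarrow> real) \<Rightarrow> ('z \<Rightarrow> 'a::euclidean_space) \<Rightarrow> ('a \<Rightarrow> 'b) \<Rightarrow> 'a \<Rightarrow>
    'b::{banach, second_countable_topology}" where
  "avg M k \<phi> f = (\<lambda>x. LINT z|M. k z *\<^sub>R f (x + \<phi> z))"

lemma integrable_weighted:
  fixes g :: "'z \<Rightarrow> 'b::{banach, second_countable_topology}"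
  assumes "integrable M k" "g \<in> borel_measurable M" "\<And>z. norm (g z) \<le> B"
  shows "integrable M (\<lambda>z. k z *\<^sub>R g z)"
proof (rule Bochner_Integration.integrable_bound)
  show "integrable M (\<lambda>z. k z * B)" using assms(1) by simp
  show "AE z in M. norm (k z *\<^sub>R g z) \<le> norm (k z * B)"
    using assms(3) by (intro AE_I2) (simp add: abs_mult mult_left_mono order.trans[OF _ abs_ge_self])
qed (use assms in measurable)

lemma norm_weighted_le:
  fixes g :: "'z \<Rightarrow> 'b::{banach, second_countable_topology}"
  assumes "integrable M k" "\<And>z. norm (g z) \<le> B" "B \<ge> 0"
  shows "norm (LINT z|M. k z *\<^sub>R g z) \<le> (LINT z|M. \<bar>k z\<bar>) * B"
proof (cases "integrable M (\<lambda>z. k z *\<^sub>R g z)")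
  case True
  have "norm (LINT z|M. k z *\<^sub>R g z) \<le> (LINT z|M. \<bar>k z\<bar> * B)"
    using assms by (intro order.trans[OF integral_norm_bound] integral_mono integrable_norm True)
      (auto intro!: mult_left_mono)
  then show ?thesis by simp
qed (use assms in \<open>simp add: not_integrable_integral_eq\<close>)

context
  fixes M :: "'z measure" and k :: "'z \<Rightarrow> real" and \<phi> :: "'z \<Rightarrow> 'a::euclidean_space"
  assumes k: "integrable M k" and \<phi>: "\<phi> \<in> borel_measurable M"
begin

lemma integrable_avg:
  fixes f :: "'a \<Rightarrow> 'b::euclidean_space"
  assumes "smooth f" "bsupp f"
  shows "integrable M (\<lambda>z. k z *\<^sub>R f (x + \<phi> z))"
proof -
  obtain B where B: "\<And>x. norm (f x) \<le> B"
    using continuous_bsupp_bounded[OF smooth_continuous_on[OF assms(1)] assms(2)] by blast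
  have "(\<lambda>z. f (x + \<phi> z)) \<in> borel_measurable M"
    by (rule measurable_compose[OF _ smooth_borel[OF assms(1)]]) (use \<phi> in measurable)
  with B show ?thesis
    by (intro integrable_weighted[OF k])
qed

text \<open>Integrating the uniform remainder of \<open>smooth_taylor\<close> against
  \<open>k\<close> differentiates under the integral directly, over an arbitrary measure and without
  a limit theorem.\<close>

lemma avg_has_derivative:
  fixes f :: "'a \<Rightarrow> 'b::euclidean_space"
  assumes f: "smooth f" "bsupp f"
  shows "(avg M k \<phi> f has_derivative (\<lambda>v. avg M k \<phi> (\<lambda>x. fd f x v) x)) (at x)"
proof -
  obtain L where L: "L > 0" "\<And>x v. norm (f (x + v) - f x - fd f x v) \<le> L * (norm v)\<^sup>2"
    using smooth_taylor[OF f] by blast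
  obtain B where B: "B > 0" "\<And>x v. norm (fd f x v) \<le> B * norm v"
    using smooth_fd_bound[OF f] by blast
  let ?D = "\<lambda>v. avg M k \<phi> (\<lambda>x. fd f x v) x"
  note int = integrable_avg[OF f] and int' = integrable_avg[OF smooth_fd[OF f(1)] bsupp_fd[OF f(2)]]
  interpret D: bounded_linear "fd f y" for y by (rule smooth_linear_fd[OF f(1)])
  have "bounded_linear ?D"
  proof (rule bounded_linear_intro)
    show "?D (v + w) = ?D v + ?D w" for v w
      using int' by (simp add: avg_def D.add scaleR_add_right)
    show "?D (r *\<^sub>R v) = r *\<^sub>R ?D v" for r v
      by (simp add: avg_def D.scaleR scaleR_left_commute[of _ r] del: scaleR_scaleR)
    show "norm (?D v) \<le> norm v * ((LINT z|M. \<bar>k z\<bar>) * B)" for v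
    proof -
      have "norm (?D v) \<le> (LINT z|M. \<bar>k z\<bar>) * (B * norm v)"
        unfolding avg_def using B by (intro norm_weighted_le[OF k]) auto
      then show ?thesis by (simp only: mult_ac)
    qed
  qed
  moreover have "((\<lambda>v. norm (avg M k \<phi> f (x + v) - avg M k \<phi> f x - ?D v) / norm v) \<longlongrightarrow> 0) (at 0)"
  proof (rule Lim_null_comparison)
    have "norm (avg M k \<phi> f (x + v) - avg M k \<phi> f x - ?D v) \<le> (LINT z|M. \<bar>k z\<bar>) * (L * (norm v)\<^sup>2)" for v
    proof -
      have "avg M k \<phi> f (x + v) - avg M k \<phi> f x - ?D v
          = (LINT z|M. k z *\<^sub>R f (x + v + \<phi> z) - k z *\<^sub>R f (x + \<phi> z) - k z *\<^sub>R fd f (x + \<phi> z) v)"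
        unfolding avg_def
        by (simp only: Bochner_Integration.integral_diff[OF Bochner_Integration.integrable_diff[OF int int] int']
            Bochner_Integration.integral_diff[OF int int])
      also have "\<dots> = (LINT z|M. k z *\<^sub>R (f ((x + \<phi> z) + v) - f (x + \<phi> z) - fd f (x + \<phi> z) v))"
        by (simp only: scaleR_diff_right add_ac)
      also have "norm \<dots> \<le> (LINT z|M. \<bar>k z\<bar>) * (L * (norm v)\<^sup>2)"
        using L by (intro norm_weighted_le[OF k]) auto
      finally show ?thesis .
    qed
    then have "norm (avg M k \<phi> f (x + v) - avg M k \<phi> f x - ?D v) / norm v
        \<le> (LINT z|M. \<bar>k z\<bar>) * L * norm v" if "v \<noteq> 0" for v
      using that by (simp add: divide_le_eq power2_eq_square mult_ac)
    then show "\<forall>\<^sub>F v in at 0. norm (norm (avg M k \<phi> f (x + v) - avg M k \<phi> f x - ?D v) / norm v)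
        \<le> (LINT z|M. \<bar>k z\<bar>) * L * norm v"
      by (simp add: eventually_at_filter)
    show "((\<lambda>v. (LINT z|M. \<bar>k z\<bar>) * L * norm v) \<longlongrightarrow> 0) (at 0)"
      by (auto intro!: tendsto_eq_intros)
  qed
  ultimately show ?thesis by (simp add: has_derivative_at)
qed

lemma smooth_avg:
  fixes f :: "'a \<Rightarrow> 'b::euclidean_space"
  assumes "smooth f" "bsupp f"
  shows "smooth (avg M k \<phi> f)"
proof (rule smooth_coinduct[where P = "\<lambda>h. \<exists>g. smooth g \<and> bsupp g \<and> h = avg M k \<phi> g"])
  show "\<exists>g. smooth g \<and> bsupp g \<and> avg M k \<phi> f = avg M k \<phi> g"
    using assms by blast
  fix h :: "'a \<Rightarrow> 'b" and x v
  assume "\<exists>g. smooth g \<and> bsupp g \<and> h = avg M k \<phi> g"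
  then obtain g where g: "smooth g" "bsupp g" "h = avg M k \<phi> g" by blast
  note d = avg_has_derivative[OF g(1,2), folded g(3)]
  show "h differentiable at x" using d differentiableI by blast
  show "\<exists>g. smooth g \<and> bsupp g \<and> (\<lambda>x. fd h x v) = avg M k \<phi> g"
    using fd_eqI[OF d] smooth_fd[OF g(1)] bsupp_fd[OF g(2)] by auto
qed

lemma fd_avg:
  fixes f :: "'a \<Rightarrow> 'b::euclidean_space"
  assumes "smooth f" "bsupp f"
  shows "fd (avg M k \<phi> f) x v = avg M k \<phi> (\<lambda>x. fd f x v) x"
  using fd_eqI[OF avg_has_derivative[OF assms]] by simp

end

lemma bsupp_avg:
  assumes "bsupp f" "\<And>z. k z \<noteq> 0 \<Longrightarrow> norm (\<phi> z) \<le> R"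
  shows "bsupp (avg M k \<phi> f)"
proof -
  obtain S where S: "\<And>x. norm x > S \<Longrightarrow> f x = 0"
    using bsuppE[OF assms(1)] by metis
  have "avg M k \<phi> f x = 0" if "norm x > R + S" for x
  proof -
    have "k z *\<^sub>R f (x + \<phi> z) = 0" for z
    proof (cases "k z = 0")
      case False
      then have "norm (x + \<phi> z) > S"
        using assms(2)[of z] that norm_triangle_ineq4[of "x + \<phi> z" "\<phi> z"] by simp
      then show ?thesis using S by simp
    qed simp
    then show ?thesis by (simp add: avg_def del: scaleR_eq_0_iff)
  qed
  then show ?thesis
    unfolding bsupp_def by (metis not_le)
qed

section \<open>The potential of a radial kernel\<close>

lemma lborel_integral_affine:
  fixes g :: "'a::euclidean_space \<Rightarrow> 'b::{banach, second_countable_topology}"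
  assumes "g \<in> borel_measurable borel" "c \<noteq> 0"
  shows "(LBINT y. g y) = \<bar>c\<bar> ^ DIM('a) *\<^sub>R (LBINT z. g (t + c *\<^sub>R z))"
    and "integrable lborel g \<longleftrightarrow> integrable lborel (\<lambda>z. g (t + c *\<^sub>R z))"
proof -
  have m: "(\<lambda>z. t + c *\<^sub>R z) \<in> borel \<rightarrow>\<^sub>M borel" by simp
  note eq = lborel_affine[OF assms(2), of t]
  have "(LBINT y. g y) = (LINT y|distr lborel borel (\<lambda>z. t + c *\<^sub>R z). \<bar>c\<bar> ^ DIM('a) *\<^sub>R g y)"
    using assms(1) by (subst eq, subst integral_density) auto
  also have "\<dots> = (LBINT z. \<bar>c\<bar> ^ DIM('a) *\<^sub>R g (t + c *\<^sub>R z))"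
    using assms(1) by (subst integral_distr) auto
  finally show "(LBINT y. g y) = \<bar>c\<bar> ^ DIM('a) *\<^sub>R (LBINT z. g (t + c *\<^sub>R z))"
    by simp
  have "integrable lborel g \<longleftrightarrow>
      integrable (distr lborel borel (\<lambda>z. t + c *\<^sub>R z)) (\<lambda>y. \<bar>c\<bar> ^ DIM('a) *\<^sub>R g y)"
    using assms(1) by (subst eq, subst integrable_density) auto
  also have "\<dots> \<longleftrightarrow> integrable lborel (\<lambda>z. \<bar>c\<bar> ^ DIM('a) *\<^sub>R g (t + c *\<^sub>R z))"
    using assms(1) by (subst integrable_distr_eq) auto
  also have "\<dots> \<longleftrightarrow> integrable lborel (\<lambda>z. g (t + c *\<^sub>R z))"
  proof
    assume "integrable lborel (\<lambda>z. \<bar>c\<bar> ^ DIM('a) *\<^sub>R g (t + c *\<^sub>R z))"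
    from integrable_scaleR_right[OF this, of "inverse (\<bar>c\<bar> ^ DIM('a))"]
    show "integrable lborel (\<lambda>z. g (t + c *\<^sub>R z))"
      using assms(2) by simp
  qed simp
  finally show "integrable lborel g \<longleftrightarrow> integrable lborel (\<lambda>z. g (t + c *\<^sub>R z))" .
qed

lemma lborel_integral_translate:
  fixes g :: "'a::euclidean_space \<Rightarrow> 'b::{banach, second_countable_topology}"
  assumes "g \<in> borel_measurable borel"
  shows "(LBINT x. g (x + t)) = (LBINT x. g x)"
    and "integrable lborel (\<lambda>x. g (x + t)) \<longleftrightarrow> integrable lborel g"
  using lborel_integral_affine[OF assms, of 1 t] by (simp_all add: add.commute)

text \<open>Difference quotients in direction \<open>i\<close> have integral zero by translation
  invariance, and they converge boundedly on a fixed ball. This is the source of every integration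
  by parts below.\<close>

lemma integral_directional_derivative_zero:
  fixes f :: "'a::euclidean_space \<Rightarrow> real"
  assumes f: "\<And>x. (f has_derivative f' x) (at x)" and cont: "continuous_on UNIV (\<lambda>x. f' x i)"
    and bs: "bsupp f"
  shows "(LBINT x. f' x i) = 0" "integrable lborel (\<lambda>x. f' x i)"
proof -
  have contf: "continuous_on UNIV f"
    using f has_derivative_continuous_on has_derivative_at_withinI by blast
  have "f' x i = fd f x i" for x
    using fd_eqI[OF f] by simp
  then have bs': "bsupp (\<lambda>x. f' x i)"
    using bsupp_fd[OF bs, of i] by simp
  show "integrable lborel (\<lambda>x. f' x i)"
    by (rule integrable_continuous_bsupp[OF cont bs'])
  obtain B where B: "B > 0" "\<And>x. norm (f' x i) \<le> B"
    using continuous_bsupp_bounded[OF cont bs'] by blast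
  obtain R where R: "R > 0" "\<And>x. norm x > R \<Longrightarrow> f x = 0"
    using bsuppE[OF bs] by blast
  define t where "t n = inverse (real (Suc n))" for n
  have t: "0 < t n" "t n \<le> 1" for n
    by (auto simp: t_def inverse_le_1_iff)
  have t0: "t \<longlonglongrightarrow> 0"
    unfolding t_def by (rule LIMSEQ_inverse_real_of_nat)
  define g where "g n x = (f (x + t n *\<^sub>R i) - f x) / t n" for n x
  have der: "((\<lambda>s. f (x + s *\<^sub>R i)) has_real_derivative f' (x + s *\<^sub>R i) i) (at s)" for x s
  proof -
    interpret bounded_linear "f' (x + s *\<^sub>R i)" using f has_derivative_bounded_linear by blast
    have "((\<lambda>s. x + s *\<^sub>R i) has_derivative (\<lambda>s. s *\<^sub>R i)) (at s)"
      by (auto intro!: derivative_eq_intros)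
    from has_derivative_compose[OF this f] show ?thesis
      by (simp add: has_field_derivative_def scaleR mult_commute_abs)
  qed
  have intf: "integrable lborel f"
    by (rule integrable_continuous_bsupp[OF contf bs])
  have fb: "f \<in> borel_measurable borel"
    by (rule borel_measurable_continuous_onI[OF contf])
  have "(LBINT x. g n x) = 0" for n
    using lborel_integral_translate[OF fb, of "t n *\<^sub>R i"] intf
    by (simp add: g_def)
  moreover have "(\<lambda>n. LBINT x. g n x) \<longlonglongrightarrow> (LBINT x. f' x i)"
  \<comment> \<open>The mean value theorem bounds the quotients by \<open>B\<close>; as all steps
    \<open>t n\<close> are at most \<open>1\<close>, they vanish beyond radius
    \<open>R + norm i\<close>.\<close>
  proof (rule integral_dominated_convergence[where w = "\<lambda>x. indicator (cball 0 (R + norm i)) x *\<^sub>R B"])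
    show "integrable lborel (\<lambda>x. indicator (cball (0::'a) (R + norm i)) x *\<^sub>R B)"
      by (rule borel_integrable_compact) auto
    show "AE x in lborel. (\<lambda>n. g n x) \<longlonglongrightarrow> f' x i"
    proof (rule AE_I2)
      fix x
      have "((\<lambda>s. (f (x + s *\<^sub>R i) - f x) / s) \<longlongrightarrow> f' x i) (at 0)"
        using der[of x 0] by (simp add: has_field_derivative_iff)
      then have "(\<lambda>n. (f (x + t n *\<^sub>R i) - f x) / t n) \<longlonglongrightarrow> f' x i"
        by (rule filterlim_compose) (use t0 t(1) in \<open>auto simp: filterlim_at less_imp_neq[symmetric]\<close>)
      then show "(\<lambda>n. g n x) \<longlonglongrightarrow> f' x i"
        by (simp add: g_def)
    qed
    show "AE x in lborel. norm (g n x) \<le> indicator (cball 0 (R + norm i)) x *\<^sub>R B" for n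
    proof (rule AE_I2)
      fix x
      obtain s where s: "f (x + t n *\<^sub>R i) - f (x + 0 *\<^sub>R i) = (t n - 0) * f' (x + s *\<^sub>R i) i"
        using MVT2[OF t(1)[of n], of "\<lambda>s. f (x + s *\<^sub>R i)" "\<lambda>s. f' (x + s *\<^sub>R i) i"] der by blast
      then have "norm (g n x) \<le> B"
        using B(2)[of "x + s *\<^sub>R i"] t(1)[of n] by (simp add: g_def)
      moreover have "g n x = 0" if "norm x > R + norm i"
      proof -
        have "norm (t n *\<^sub>R i) \<le> norm i"
          using t[of n] by (simp add: mult_left_le_one_le)
        then have "norm (x + t n *\<^sub>R i) > R"
          using that norm_triangle_ineq4[of "x + t n *\<^sub>R i" "t n *\<^sub>R i"] by simp
        moreover have "norm x > R"
          using that norm_ge_zero[of i] by linarith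
        ultimately show ?thesis using R(2) by (simp add: g_def)
      qed
      ultimately show "norm (g n x) \<le> indicator (cball 0 (R + norm i)) x *\<^sub>R B"
        by (cases "norm x \<le> R + norm i") (auto simp: indicator_def)
    qed
  qed (use fb borel_measurable_continuous_onI[OF cont] in \<open>auto simp: g_def\<close>)
  ultimately show "(LBINT x. f' x i) = 0"
    by (simp add: LIMSEQ_const_iff)
qed

text \<open>The kernel is \<open>\<rho> z = \<bar>z\<bar>\<^sup>2 k (\<bar>z\<bar>\<^sup>2)\<close>; squared radii keep the profiles smooth at the origin.\<close>

locale radial_kernel =
  fixes \<rho> :: "'a::euclidean_space \<Rightarrow> real" and k :: "real \<Rightarrow> real"
  assumes rho_eq: "\<And>z. z \<noteq> 0 \<Longrightarrow> \<rho> z = (z \<bullet> z) * k (z \<bullet> z)"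
    and k_cont: "continuous_on {0<..} k"
    and k_nonneg: "\<And>s. 0 \<le> k s"
    and k_nonpos_arg: "\<And>s. s \<le> 0 \<Longrightarrow> k s = 0"
    and k_antimono: "\<And>s t. 0 < s \<Longrightarrow> s \<le> t \<Longrightarrow> k t \<le> k s"
    and k_ge1: "\<And>s. 1 \<le> s \<Longrightarrow> k s = 0"
    and rho_integrable: "integrable lborel (\<lambda>z::'a. (z \<bullet> z) * k (z \<bullet> z))"
    and rho_mass: "(LBINT z. ((z::'a) \<bullet> z) * k (z \<bullet> z)) = real DIM('a)"
begin

lemma k_borel [measurable]: "k \<in> borel_measurable borel"
proof -
  have "(\<lambda>s. indicator {0<..} s *\<^sub>R k s) \<in> borel_measurable borel"
    by (rule borel_measurable_continuous_on_indicator[OF _ k_cont]) simp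
  also have "(\<lambda>s. indicator {0<..} s *\<^sub>R k s) = k"
    using k_nonpos_arg by (auto simp: indicator_def fun_eq_iff not_less)
  finally show ?thesis .
qed

text \<open>The factor \<open>1 / 2\<close> cancels the one from differentiating
  \<open>z \<bullet> z\<close>, so that \<open>\<Psi> (z \<bullet> z)\<close> has gradient
  \<open>- k (z \<bullet> z) z\<close> away from the origin. As \<open>k\<close> vanishes from
  \<open>1\<close> on, the upper limit \<open>2\<close> gives the same values as \<open>1\<close>
  would, but makes \<open>1\<close> an interior point for the derivative formula.\<close>

definition \<Psi> :: "real \<Rightarrow> real" where "\<Psi> s = integral {s..2} k / 2"

lemma Psi_ge1: "\<Psi> s = 0" if "1 \<le> s"
proof -
  have "integral {s..2} k = integral {s..2} (\<lambda>_. 0)"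
    by (rule Henstock_Kurzweil_Integration.integral_cong) (use that k_ge1 in auto)
  then show ?thesis by (simp add: \<Psi>_def)
qed

lemma Psi_deriv: "(\<Psi> has_real_derivative - k s / 2) (at s)" if "0 < s"
proof (cases "s < 2")
  case True
  have "continuous_on {s/2..2} k"
    by (rule continuous_on_subset[OF k_cont]) (use that in auto)
  from integral_has_real_derivative'[OF this, of s]
  have "((\<lambda>s. integral {s..2} k) has_real_derivative - k s) (at s within {s/2..2})"
    using True that by simp
  moreover have "at s within {s/2..2} = at s"
    using True that by (intro at_within_Icc_at) auto
  ultimately show ?thesis
    unfolding \<Psi>_def by (auto intro!: derivative_eq_intros)
next
  case False
  have "(\<Psi> has_real_derivative 0) (at s)"
    by (rule has_field_derivative_transform_within_open[where f = "\<lambda>_. 0" and S = "{1<..}"])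
      (use False Psi_ge1 in auto)
  then show ?thesis using k_ge1[of s] False by simp
qed

lemma Psi_antimono: "\<Psi> t \<le> \<Psi> s" if "0 < s" "s \<le> t"
proof (rule DERIV_nonpos_imp_nonincreasing[OF that(2)])
  fix x assume "s \<le> x" "x \<le> t"
  then show "\<exists>y. (\<Psi> has_real_derivative y) (at x) \<and> y \<le> 0"
    using Psi_deriv[of x] k_nonneg[of x] that by (intro exI[of _ "- k x / 2"]) auto
qed

lemma Psi_nonneg: "0 \<le> \<Psi> s" if "0 < s"
  using Psi_antimono[of s "max s 1"] Psi_ge1[of "max s 1"] that by simp

lemma Psi_cont: "continuous_on {0<..} \<Psi>"
  using Psi_deriv by (intro continuous_at_imp_continuous_on ballI DERIV_isCont) auto

definition Q :: "'a \<Rightarrow> real" where "Q z = (if z = 0 then 0 else \<Psi> (z \<bullet> z))"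

lemma Q_nonneg: "0 \<le> Q z"
  using Psi_nonneg by (simp add: Q_def)

lemma Q_support: "Q z \<noteq> 0 \<Longrightarrow> norm z \<le> 1"
proof (rule ccontr)
  assume z: "Q z \<noteq> 0" "\<not> norm z \<le> 1"
  then have "1 \<le> z \<bullet> z"
    by (simp add: power2_norm_eq_inner[symmetric])
  with z Psi_ge1 show False by (auto simp: Q_def split: if_splits)
qed

text \<open>Adding \<open>\<tau>\<close> to the squared radius makes kernel and potential continuous
  at the origin, so no boundary term arises. The bounded support comes from the kernel, hence
  \<open>f\<close> may also be a linear coordinate.\<close>

lemma regularized_ibp:
  fixes f :: "'a \<Rightarrow> real"
  assumes "\<tau> > 0" and f: "\<And>x. (f has_derivative f' x) (at x)" and cont: "continuous_on UNIV (\<lambda>x. f' x i)"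
  shows "(LBINT h. \<Psi> (h \<bullet> h + \<tau>) * f' h i) = (LBINT h. k (h \<bullet> h + \<tau>) * (h \<bullet> i) * f h)"
    and "integrable lborel (\<lambda>h. \<Psi> (h \<bullet> h + \<tau>) * f' h i)"
    and "integrable lborel (\<lambda>h. k (h \<bullet> h + \<tau>) * (h \<bullet> i) * f h)"
proof -
  have pos: "h \<bullet> h + \<tau> > 0" for h :: 'a
    using \<open>\<tau> > 0\<close> by (simp add: add_nonneg_pos)
  have big: "1 \<le> h \<bullet> h + \<tau>" if "norm h > 1" for h :: 'a
  proof -
    have "1 \<le> (norm h)\<^sup>2" using that by (simp add: one_le_power)
    then show ?thesis using \<open>\<tau> > 0\<close> by (simp add: power2_norm_eq_inner)
  qed
  have contf: "continuous_on UNIV f"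
    using f has_derivative_continuous_on has_derivative_at_withinI by blast
  have ck: "continuous_on UNIV (\<lambda>h::'a. k (h \<bullet> h + \<tau>))"
    by (rule continuous_on_compose2[OF k_cont]) (use pos in \<open>auto intro!: continuous_intros\<close>)
  have cP: "continuous_on UNIV (\<lambda>h::'a. \<Psi> (h \<bullet> h + \<tau>))"
    by (rule continuous_on_compose2[OF Psi_cont]) (use pos in \<open>auto intro!: continuous_intros\<close>)
  have bP: "bsupp (\<lambda>h. \<Psi> (h \<bullet> h + \<tau>) * g h)" for g :: "'a \<Rightarrow> real"
    unfolding bsupp_def using big Psi_ge1 by (metis mult_zero_left not_le)
  have bk: "bsupp (\<lambda>h. k (h \<bullet> h + \<tau>) * (h \<bullet> i) * g h)" for g :: "'a \<Rightarrow> real"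
    unfolding bsupp_def using big k_ge1 by (metis mult_zero_left not_le)
  show i1: "integrable lborel (\<lambda>h. \<Psi> (h \<bullet> h + \<tau>) * f' h i)"
    by (intro integrable_continuous_bsupp continuous_intros cP cont bP)
  show i2: "integrable lborel (\<lambda>h. k (h \<bullet> h + \<tau>) * (h \<bullet> i) * f h)"
    by (intro integrable_continuous_bsupp continuous_intros ck contf bk)
  let ?D = "\<lambda>h v. \<Psi> (h \<bullet> h + \<tau>) * f' h v + (- k (h \<bullet> h + \<tau>) / 2 * (2 * (h \<bullet> v))) * f h"
  have "((\<lambda>h. \<Psi> (h \<bullet> h + \<tau>) * f h) has_derivative ?D h) (at h)" for h
  proof (rule has_derivative_mult[OF _ f])
    have "((\<lambda>h. h \<bullet> h + \<tau>) has_derivative (\<lambda>v. 2 * (h \<bullet> v))) (at h)"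
      by (auto intro!: derivative_eq_intros simp: inner_commute)
    from has_derivative_compose[OF this Psi_deriv[OF pos, unfolded has_field_derivative_def]]
    show "((\<lambda>h. \<Psi> (h \<bullet> h + \<tau>)) has_derivative (\<lambda>v. - k (h \<bullet> h + \<tau>) / 2 * (2 * (h \<bullet> v)))) (at h)" .
  qed
  moreover have "continuous_on UNIV (\<lambda>h. ?D h i)"
    by (intro continuous_intros cP cont ck contf) auto
  ultimately have "(LBINT h. ?D h i) = 0"
    using bP by (rule integral_directional_derivative_zero)
  moreover have "(\<lambda>h. ?D h i) = (\<lambda>h. \<Psi> (h \<bullet> h + \<tau>) * f' h i - k (h \<bullet> h + \<tau>) * (h \<bullet> i) * f h)"
    by (auto simp: fun_eq_iff)
  ultimately show "(LBINT h. \<Psi> (h \<bullet> h + \<tau>) * f' h i) = (LBINT h. k (h \<bullet> h + \<tau>) * (h \<bullet> i) * f h)"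
    using i1 i2 by simp
qed

text \<open>Apply \<open>regularized_ibp\<close> to the coordinate \<open>h \<bullet> i\<close> in
  direction \<open>i\<close>; summing over the basis turns squared coordinates into
  \<open>h \<bullet> h\<close>. This is how the kernel mass \<open>DIM('a)\<close> becomes mass
  \<open>1\<close> of the potential.\<close>

lemma regularized_mass:
  assumes "\<tau> > 0"
  shows "real DIM('a) * (LBINT h. \<Psi> ((h::'a) \<bullet> h + \<tau>)) = (LBINT h. ((h::'a) \<bullet> h) * k (h \<bullet> h + \<tau>))"
    and "integrable lborel (\<lambda>h::'a. \<Psi> (h \<bullet> h + \<tau>))"
proof -
  have d: "((\<lambda>x. x \<bullet> i) has_derivative (\<lambda>v. v \<bullet> i)) (at x)" for x i :: 'a
    by (auto intro!: derivative_eq_intros)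
  have b: "(LBINT h. \<Psi> ((h::'a) \<bullet> h + \<tau>)) = (LBINT h. k (h \<bullet> h + \<tau>) * (h \<bullet> i) * (h \<bullet> i))"
    "integrable lborel (\<lambda>h::'a. k (h \<bullet> h + \<tau>) * (h \<bullet> i) * (h \<bullet> i))"
    "integrable lborel (\<lambda>h::'a. \<Psi> (h \<bullet> h + \<tau>))"
    if "i \<in> Basis" for i
    using regularized_ibp[OF assms d continuous_on_const, of i i] that by (simp_all add: inner_Basis)
  show "integrable lborel (\<lambda>h::'a. \<Psi> (h \<bullet> h + \<tau>))"
    using b(3) nonempty_Basis by blast
  have "real DIM('a) * (LBINT h. \<Psi> ((h::'a) \<bullet> h + \<tau>))
      = (\<Sum>i\<in>Basis. LBINT h. k (h \<bullet> h + \<tau>) * (h \<bullet> i) * ((h::'a) \<bullet> i))"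
    using b(1) by (simp flip: b(1) cong: sum.cong)
  also have "\<dots> = (LBINT h. (\<Sum>i\<in>Basis. k (h \<bullet> h + \<tau>) * (h \<bullet> i) * ((h::'a) \<bullet> i)))"
    using b(2) by (intro Bochner_Integration.integral_sum[symmetric]) auto
  also have "(\<lambda>h::'a. \<Sum>i\<in>Basis. k (h \<bullet> h + \<tau>) * (h \<bullet> i) * (h \<bullet> i)) = (\<lambda>h. (h \<bullet> h) * k (h \<bullet> h + \<tau>))"
    by (auto simp: fun_eq_iff euclidean_inner[of h h for h] sum_distrib_right mult_ac)
  finally show "real DIM('a) * (LBINT h. \<Psi> ((h::'a) \<bullet> h + \<tau>)) = (LBINT h. ((h::'a) \<bullet> h) * k (h \<bullet> h + \<tau>))" .
qed

abbreviation \<kappa> :: "'a \<Rightarrow> real" where "\<kappa> z \<equiv> k (z \<bullet> z)"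

lemma k_shift: "k (h \<bullet> h + \<tau>) \<le> \<kappa> h" if "h \<noteq> 0" "0 \<le> \<tau>" for h :: 'a
  using k_antimono[of "h \<bullet> h" "h \<bullet> h + \<tau>"] that by simp

abbreviation \<tau>s :: "nat \<Rightarrow> real" where "\<tau>s n \<equiv> inverse (real (Suc n))"

lemma k_shift_tendsto: "(\<lambda>n. k (h \<bullet> h + \<tau>s n)) \<longlonglongrightarrow> \<kappa> h" if "h \<noteq> 0" for h :: 'a
proof (rule continuous_on_tendsto_compose[OF k_cont])
  show "(\<lambda>n. h \<bullet> h + \<tau>s n) \<longlonglongrightarrow> h \<bullet> h"
    using tendsto_add[OF tendsto_const LIMSEQ_inverse_real_of_nat, of "h \<bullet> h"] by simp
qed (use that in \<open>auto simp: add_pos_nonneg intro!: always_eventually\<close>)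

lemma Psi_shift_tendsto: "(\<lambda>n. \<Psi> (h \<bullet> h + \<tau>s n)) \<longlonglongrightarrow> \<Psi> (h \<bullet> h)" if "h \<noteq> 0" for h :: 'a
proof (rule continuous_on_tendsto_compose[OF Psi_cont])
  show "(\<lambda>n. h \<bullet> h + \<tau>s n) \<longlonglongrightarrow> h \<bullet> h"
    using tendsto_add[OF tendsto_const LIMSEQ_inverse_real_of_nat, of "h \<bullet> h"] by simp
qed (use that in \<open>auto simp: add_pos_nonneg intro!: always_eventually\<close>)

lemma AE_nonzero: "AE h in lborel. (h::'a) \<noteq> 0"
  by (rule AE_lborel_singleton)

lemma Q_borel [measurable]: "Q \<in> borel_measurable borel"
proof -
  have "continuous_on (- {0}) (\<lambda>z::'a. \<Psi> (z \<bullet> z))"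
    by (rule continuous_on_compose2[OF Psi_cont]) (auto intro!: continuous_intros)
  from borel_measurable_continuous_on_indicator[OF _ this]
  have "(\<lambda>z::'a. indicator (- {0}) z *\<^sub>R \<Psi> (z \<bullet> z)) \<in> borel_measurable borel"
    by simp
  also have "(\<lambda>z::'a. indicator (- {0}) z *\<^sub>R \<Psi> (z \<bullet> z)) = Q"
    by (auto simp: Q_def indicator_def fun_eq_iff)
  finally show ?thesis .
qed

text \<open>As \<open>\<tau>\<close> decreases to \<open>0\<close>, the kernel side converges with
  its own limit as majorant, because \<open>k\<close> is nonincreasing, and the potential side
  increases to \<open>Q\<close>. Monotone convergence yields integrability of \<open>Q\<close>
  together with its mass.\<close>

lemma Q_mass: "integrable lborel Q" "(LBINT z. Q z) = 1"
proof -
  have "(\<lambda>n. LBINT h. ((h::'a) \<bullet> h) * k (h \<bullet> h + \<tau>s n)) \<longlonglongrightarrow> (LBINT h. ((h::'a) \<bullet> h) * \<kappa> h)"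
  proof (rule integral_dominated_convergence[OF _ _ rho_integrable])
    show "AE h::'a in lborel. (\<lambda>n. (h \<bullet> h) * k (h \<bullet> h + \<tau>s n)) \<longlonglongrightarrow> (h \<bullet> h) * \<kappa> h"
      using AE_nonzero by eventually_elim (intro tendsto_intros k_shift_tendsto)
    show "AE h::'a in lborel. norm ((h \<bullet> h) * k (h \<bullet> h + \<tau>s n)) \<le> (h \<bullet> h) * \<kappa> h" for n
      using AE_nonzero by eventually_elim (auto intro!: mult_left_mono k_shift simp: k_nonneg abs_mult)
  qed measurable
  then have lim: "(\<lambda>n. LBINT h. \<Psi> ((h::'a) \<bullet> h + \<tau>s n)) \<longlonglongrightarrow> 1"
  proof -
    have "(LBINT h. \<Psi> ((h::'a) \<bullet> h + \<tau>s n)) = (LBINT h. ((h::'a) \<bullet> h) * k (h \<bullet> h + \<tau>s n)) / DIM('a)" for n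
      using regularized_mass(1)[of "\<tau>s n"] by (simp add: field_simps)
    moreover have "(\<lambda>n. (LBINT h. ((h::'a) \<bullet> h) * k (h \<bullet> h + \<tau>s n)) / DIM('a)) \<longlonglongrightarrow> real DIM('a) / DIM('a)"
      using \<open>_ \<longlonglongrightarrow> (LBINT h. ((h::'a) \<bullet> h) * \<kappa> h)\<close> unfolding rho_mass
      by (intro tendsto_intros) auto
    ultimately show ?thesis by simp
  qed
  have 1: "AE h in lborel. mono (\<lambda>n. \<Psi> ((h::'a) \<bullet> h + \<tau>s n))"
    by (intro AE_I2 monoI Psi_antimono) (auto simp: add_nonneg_pos)
  have 2: "AE h in lborel. (\<lambda>n. \<Psi> ((h::'a) \<bullet> h + \<tau>s n)) \<longlonglongrightarrow> Q h"
    using AE_nonzero by eventually_elim (use Psi_shift_tendsto in \<open>auto simp: Q_def\<close>)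
  have 3: "integrable lborel (\<lambda>h::'a. \<Psi> (h \<bullet> h + \<tau>s n))" for n
    by (rule regularized_mass) simp
  show "integrable lborel Q" "(LBINT z. Q z) = 1"
    using integrable_monotone_convergence[OF 3 1 2 lim] integral_monotone_convergence[OF 3 1 2 lim] by auto
qed

text \<open>Subtracting \<open>f 0\<close> leaves the derivative alone and makes the right integrand
  of order \<open>(h \<bullet> h) * \<kappa> h\<close>, which is integrable; then
  \<open>\<tau>\<close> may tend to \<open>0\<close> in \<open>regularized_ibp\<close>.\<close>

lemma singular_ibp:
  fixes f :: "'a \<Rightarrow> real"
  assumes f: "smooth f" "bsupp f"
  shows "(LBINT h. Q h * fd f h i) = (LBINT h. \<kappa> h * (h \<bullet> i) * (f h - f 0))"
    and "integrable lborel (\<lambda>h. \<kappa> h * (h \<bullet> i) * (f h - f 0))"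
proof -
  obtain B where B: "B > 0" "\<And>x v. norm (fd f x v) \<le> B * norm v"
    using smooth_fd_bound[OF f] by blast
  have lip: "norm (f x - f y) \<le> B * norm (x - y)" for x y
    using fd_bound_imp_lipschitz[OF f(1) B(2)] .
  have [measurable]: "f \<in> borel_measurable borel" "(\<lambda>h. fd f h i) \<in> borel_measurable borel"
    using smooth_borel f(1) smooth_fd by blast+
  have [measurable]: "(\<lambda>h::'a. \<Psi> (h \<bullet> h + \<tau>s n)) \<in> borel_measurable borel" for n
    using borel_measurable_integrable[OF regularized_mass(2)[of "\<tau>s n"]] by simp
  have bound: "\<bar>k t * (h \<bullet> i) * (f h - f 0)\<bar> \<le> B * norm i * ((h \<bullet> h) * \<kappa> h)"
    if "k t \<le> \<kappa> h" for h t
  proof -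
    have "\<bar>k t * (h \<bullet> i) * (f h - f 0)\<bar> = k t * \<bar>h \<bullet> i\<bar> * \<bar>f h - f 0\<bar>"
      by (simp add: abs_mult k_nonneg)
    also have "\<dots> \<le> \<kappa> h * (norm h * norm i) * (B * norm h)"
      using lip[of h 0] that Cauchy_Schwarz_ineq2[of h i]
      by (intro mult_mono) (auto simp: k_nonneg)
    also have "\<dots> = B * norm i * ((h \<bullet> h) * \<kappa> h)"
      by (simp add: power2_norm_eq_inner[symmetric] power2_eq_square)
    finally show ?thesis .
  qed
  have dom: "integrable lborel (\<lambda>h::'a. B * norm i * ((h \<bullet> h) * \<kappa> h))"
    using rho_integrable by simp
  show "integrable lborel (\<lambda>h. \<kappa> h * (h \<bullet> i) * (f h - f 0))"
    by (rule Bochner_Integration.integrable_bound[OF dom])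
      (use bound in \<open>auto intro!: AE_I2 order.trans[OF _ abs_ge_self]\<close>)
  have "(\<lambda>n. LBINT h. k (h \<bullet> h + \<tau>s n) * (h \<bullet> i) * (f h - f 0)) \<longlonglongrightarrow>
      (LBINT h. \<kappa> h * (h \<bullet> i) * (f h - f 0))"
  proof (rule integral_dominated_convergence[OF _ _ dom])
    show "AE h in lborel. (\<lambda>n. k (h \<bullet> h + \<tau>s n) * (h \<bullet> i) * (f h - f 0)) \<longlonglongrightarrow> \<kappa> h * (h \<bullet> i) * (f h - f 0)"
      using AE_nonzero by eventually_elim (intro tendsto_intros k_shift_tendsto)
    show "AE h in lborel. norm (k (h \<bullet> h + \<tau>s n) * (h \<bullet> i) * (f h - f 0)) \<le> B * norm i * ((h \<bullet> h) * \<kappa> h)" for n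
      using AE_nonzero by eventually_elim (use bound k_shift in auto)
  qed measurable
  moreover have "(\<lambda>n. LBINT h. \<Psi> (h \<bullet> h + \<tau>s n) * fd f h i) \<longlonglongrightarrow> (LBINT h. Q h * fd f h i)"
  proof (rule integral_dominated_convergence[where w = "\<lambda>h. Q h * (B * norm i)"])
    show "AE h in lborel. (\<lambda>n. \<Psi> (h \<bullet> h + \<tau>s n) * fd f h i) \<longlonglongrightarrow> Q h * fd f h i"
      using AE_nonzero by eventually_elim (use Psi_shift_tendsto in \<open>auto simp: Q_def intro!: tendsto_intros\<close>)
    show "AE h in lborel. norm (\<Psi> (h \<bullet> h + \<tau>s n) * fd f h i) \<le> Q h * (B * norm i)" for n
      using AE_nonzero
    proof eventually_elim
      case (elim h)
      have "0 < h \<bullet> h" "0 < h \<bullet> h + \<tau>s n"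
        using elim by (auto simp: add_pos_nonneg)
      then have "0 \<le> \<Psi> (h \<bullet> h + \<tau>s n)" "\<Psi> (h \<bullet> h + \<tau>s n) \<le> \<Psi> (h \<bullet> h)"
        using Psi_nonneg Psi_antimono by auto
      moreover have "0 \<le> \<Psi> (h \<bullet> h)" using Psi_nonneg \<open>0 < h \<bullet> h\<close> by blast
      ultimately show ?case
        using B(2)[of h i] elim by (simp add: Q_def abs_mult mult_mono)
    qed
    show "integrable lborel (\<lambda>h. Q h * (B * norm i))"
      using Q_mass by simp
  qed measurable
  moreover have "(LBINT h. \<Psi> (h \<bullet> h + \<tau>s n) * fd f h i) = (LBINT h. k (h \<bullet> h + \<tau>s n) * (h \<bullet> i) * (f h - f 0))" for n
  proof -
    have "((\<lambda>x. f x - f 0) has_derivative fd f x) (at x)" for x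
      using has_derivative_diff[OF smooth_has_derivative[OF f(1)] has_derivative_const] by simp
    from regularized_ibp(1)[OF _ this smooth_continuous_on[OF smooth_fd[OF f(1)]]]
    show ?thesis by simp
  qed
  ultimately show "(LBINT h. Q h * fd f h i) = (LBINT h. \<kappa> h * (h \<bullet> i) * (f h - f 0))"
    by (simp add: LIMSEQ_unique)
qed

end

section \<open>Nonlocal and classical perimeters\<close>

lemma classical_div_smooth:
  fixes p :: "'a::euclidean_space \<Rightarrow> 'a"
  assumes "smooth p"
  shows "smooth (classical_div p)"
  unfolding classical_div_def using assms
  by (intro smooth_sum smooth_bounded_linear_comp[OF bounded_linear_inner_left] smooth_fd) auto

lemma classical_div_bsupp:
  fixes p :: "'a::euclidean_space \<Rightarrow> 'a"
  assumes "bsupp p"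
  shows "bsupp (classical_div p)"
proof -
  obtain R where "\<And>x. norm x > R \<Longrightarrow> p x = 0"
    using bsuppE[OF assms] by metis
  then have "classical_div p x = 0" if "norm x > R" for x
    using fd_zero_outside[of R p x] that by (simp add: classical_div_def)
  then show ?thesis unfolding bsupp_def by (metis not_le)
qed

lemma test_fieldsD:
  assumes "p \<in> test_fields"
  shows "smooth p" "bsupp p" "\<And>x. norm (p x) \<le> 1"
  using assms unfolding test_fields_def compact_support_iff by auto

lemma test_fieldsI:
  assumes "smooth p" "bsupp p" "\<And>x. norm (p x) \<le> 1"
  shows "p \<in> test_fields"
  using assms unfolding test_fields_def compact_support_iff by auto

lemma integrable_lebesgue:
  fixes f :: "'a::euclidean_space \<Rightarrow> 'b::{banach, second_countable_topology}"
  assumes "integrable lborel f"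
  shows "integrable lebesgue f"
  using assms integrable_completion[of f lborel] borel_measurable_integrable[OF assms] by simp

section \<open>The nonlocal divergence as a smeared classical divergence\<close>

context radial_kernel
begin

abbreviation ndiv :: "real \<Rightarrow> ('a \<Rightarrow> 'a) \<Rightarrow> 'a \<Rightarrow> real"
  where "ndiv \<epsilon> \<equiv> nonlocal_div (rescale \<rho> \<epsilon>)"

abbreviation nper :: "real \<Rightarrow> 'a set \<Rightarrow> ereal"
  where "nper \<epsilon> \<equiv> nonlocal_perimeter (rescale \<rho> \<epsilon>)"

context
  fixes \<epsilon> :: real assumes eps: "\<epsilon> > 0"
begin

text \<open>Substitute \<open>y = x + \<epsilon> z\<close>: the Jacobian cancels the normalization
  of \<open>rescale\<close>, the squared norm in \<open>\<rho>\<close> cancels the two denominators,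
  and one \<open>1 / \<epsilon>\<close> remains. At \<open>y = x\<close>, where
  \<open>\<rho>\<close> is arbitrary, both integrands vanish.\<close>

lemma nonlocal_div_eq_lborel:
  assumes p: "smooth p" "bsupp p"
  shows "ndiv \<epsilon> p x = (LBINT z. \<kappa> z * ((p (x + \<epsilon> *\<^sub>R z) - p x) \<bullet> z) / \<epsilon>)"
proof -
  define g where "g z = \<kappa> z * ((p (x + \<epsilon> *\<^sub>R z) - p x) \<bullet> z) / \<epsilon>" for z
  have [measurable]: "p \<in> borel_measurable borel"
    by (rule smooth_borel[OF p(1)])
  have [measurable]: "g \<in> borel_measurable borel"
    unfolding g_def by measurable
  define G where "G y = g ((1 / \<epsilon>) *\<^sub>R (y - x)) / \<epsilon> ^ DIM('a)" for y
  have Gb [measurable]: "G \<in> borel_measurable borel"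
    unfolding G_def by measurable
  have "((p y - p x) /\<^sub>R norm (y - x)) \<bullet> ((y - x) /\<^sub>R norm (y - x)) * rescale \<rho> \<epsilon> (y - x) = G y" for y
  proof (cases "y = x")
    case True
    then show ?thesis by (simp add: G_def g_def)
  next
    case False
    define z where "z = (1 / \<epsilon>) *\<^sub>R (y - x)"
    have y: "y = x + \<epsilon> *\<^sub>R z" and z: "z \<noteq> 0"
      using eps False by (auto simp: z_def)
    have "norm z \<noteq> 0" using z by simp
    have "((p y - p x) /\<^sub>R norm (y - x)) \<bullet> ((y - x) /\<^sub>R norm (y - x)) * rescale \<rho> \<epsilon> (y - x)
      = ((p y - p x) \<bullet> z) * \<epsilon> / (\<epsilon> * norm z)\<^sup>2 * ((norm z)\<^sup>2 * \<kappa> z) / \<epsilon> ^ DIM('a)"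
      using eps z rho_eq[OF z] unfolding y rescale_def
      by (simp add: power2_eq_square divide_inverse dot_square_norm)
    also have "\<dots> = G y"
      unfolding G_def g_def z_def[symmetric] y[symmetric] using eps \<open>norm z \<noteq> 0\<close>
      by (simp add: power2_eq_square)
    finally show ?thesis .
  qed
  then have "ndiv \<epsilon> p x = (LINT y|lebesgue. G y)"
    unfolding nonlocal_div_def by simp
  also have "\<dots> = (LBINT y. G y)"
    using Gb by (intro integral_completion) simp
  also have "\<dots> = \<epsilon> ^ DIM('a) * (LBINT z. G (x + \<epsilon> *\<^sub>R z))"
    using lborel_integral_affine(1)[OF Gb, of \<epsilon> x] eps by simp
  also have "(\<lambda>z. G (x + \<epsilon> *\<^sub>R z)) = (\<lambda>z. g z / \<epsilon> ^ DIM('a))"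
    using eps by (simp add: G_def)
  finally show ?thesis
    using eps by (simp add: g_def)
qed

lemma smoothing_measurable: "(\<lambda>z::'a. \<epsilon> *\<^sub>R z) \<in> borel_measurable lborel"
  by simp

abbreviation smear :: "('a \<Rightarrow> 'b) \<Rightarrow> 'a \<Rightarrow> 'b::{banach, second_countable_topology}"
  where "smear \<equiv> avg lborel Q (\<lambda>z. \<epsilon> *\<^sub>R z)"

text \<open>\<open>singular_ibp\<close> is applied to each component of
  \<open>z \<mapsto> p (x + \<epsilon> z)\<close> in the matching direction; the chain rule factor
  \<open>\<epsilon>\<close> cancels the remaining \<open>1 / \<epsilon>\<close>.\<close>

lemma nonlocal_div_eq_smear:
  assumes p: "smooth p" "bsupp p"
  shows "ndiv \<epsilon> p x = smear (classical_div p) x"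
proof -
  define F where "F i z = p (\<epsilon> *\<^sub>R z + x) \<bullet> i" for i z
  have F: "smooth (F i)" for i
    unfolding F_def by (intro smooth_bounded_linear_comp[OF bounded_linear_inner_left] smooth_affine p)
  have Fs: "bsupp (F i)" for i
  proof -
    obtain R where R: "\<And>y. norm y > R \<Longrightarrow> p y = 0"
      using bsuppE[OF p(2)] by blast
    have "F i z = 0" if "norm z > (R + norm x) / \<epsilon>" for z
    proof -
      have "\<epsilon> * norm z > R + norm x"
        using that eps by (simp add: field_simps)
      then have "norm (\<epsilon> *\<^sub>R z + x) > R"
        using norm_triangle_ineq4[of "\<epsilon> *\<^sub>R z + x" x] eps by simp
      then show ?thesis using R by (simp add: F_def)
    qed
    then show ?thesis unfolding bsupp_def by (metis not_le)
  qed
  have fdF: "fd (F i) z v = \<epsilon> * (fd p (\<epsilon> *\<^sub>R z + x) v \<bullet> i)" for i z v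
  proof -
    have "(F i has_derivative (\<lambda>v. (\<epsilon> *\<^sub>R fd p (\<epsilon> *\<^sub>R z + x) v) \<bullet> i)) (at z)"
      unfolding F_def
      by (rule bounded_linear.has_derivative[OF bounded_linear_inner_left has_derivative_affine[OF p(1)]])
    then show ?thesis by (simp add: fd_eqI)
  qed
  have "(LBINT z. Q z * classical_div p (x + \<epsilon> *\<^sub>R z))
      = (LBINT z. (\<Sum>i\<in>Basis. Q z * fd (F i) z i / \<epsilon>))"
    using eps by (simp add: classical_div_def fdF sum_distrib_left add.commute)
  also have "\<dots> = (\<Sum>i\<in>Basis. (LBINT z. Q z * fd (F i) z i) / \<epsilon>)"
  proof -
    have "integrable lborel (\<lambda>z. Q z * fd (F i) z i)" for i
    proof -
      obtain B where "\<And>x v. norm (fd (F i) x v) \<le> B * norm v"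
        using smooth_fd_bound[OF F Fs] by blast
      from integrable_weighted[OF Q_mass(1) _ this] show ?thesis
        using smooth_borel[OF smooth_fd[OF F]] by simp
    qed
    then show ?thesis
      by (subst Bochner_Integration.integral_sum) auto
  qed
  also have "\<dots> = (\<Sum>i\<in>Basis. (LBINT z. \<kappa> z * (z \<bullet> i) * (F i z - F i 0)) / \<epsilon>)"
    using singular_ibp(1)[OF F Fs] by simp
  also have "\<dots> = (LBINT z. (\<Sum>i\<in>Basis. \<kappa> z * (z \<bullet> i) * (F i z - F i 0) / \<epsilon>))"
    using singular_ibp(2)[OF F Fs] by (subst Bochner_Integration.integral_sum) auto
  also have "\<dots> = (LBINT z. \<kappa> z * ((p (x + \<epsilon> *\<^sub>R z) - p x) \<bullet> z) / \<epsilon>)"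
  proof (intro Bochner_Integration.integral_cong refl)
    fix z
    have "(p (x + \<epsilon> *\<^sub>R z) - p x) \<bullet> z = (\<Sum>i\<in>Basis. (z \<bullet> i) * (F i z - F i 0))"
      by (subst euclidean_inner) (simp add: F_def inner_diff_left add.commute mult.commute)
    then show "(\<Sum>i\<in>Basis. \<kappa> z * (z \<bullet> i) * (F i z - F i 0) / \<epsilon>)
        = \<kappa> z * ((p (x + \<epsilon> *\<^sub>R z) - p x) \<bullet> z) / \<epsilon>"
      by (simp add: sum_distrib_left sum_divide_distrib mult.assoc)
  qed
  finally show ?thesis
    using nonlocal_div_eq_lborel[OF p] by (simp add: avg_def)
qed

lemma smear_bsupp: "bsupp f \<Longrightarrow> bsupp (smear f)"
  by (rule bsupp_avg[where R = \<epsilon>]) (use Q_support eps in auto)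

lemma smear_classical_div:
  assumes p: "smooth p" "bsupp p"
  shows "classical_div (smear p) x = smear (classical_div p) x"
proof -
  have 1: "integrable lborel (\<lambda>z. Q z *\<^sub>R fd p (x + \<epsilon> *\<^sub>R z) i)" for i
    by (rule integrable_avg[OF Q_mass(1) smoothing_measurable smooth_fd[OF p(1)] bsupp_fd[OF p(2)]])
  have "classical_div (smear p) x = (\<Sum>i\<in>Basis. (LBINT z. Q z *\<^sub>R fd p (x + \<epsilon> *\<^sub>R z) i) \<bullet> i)"
    unfolding classical_div_def fd_avg[OF Q_mass(1) smoothing_measurable p] by (simp add: avg_def)
  also have "\<dots> = (\<Sum>i\<in>Basis. LBINT z. (Q z *\<^sub>R fd p (x + \<epsilon> *\<^sub>R z) i) \<bullet> i)"
    by (intro sum.cong refl integral_inner_left[symmetric] 1)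
  also have "\<dots> = (LBINT z. (\<Sum>i\<in>Basis. (Q z *\<^sub>R fd p (x + \<epsilon> *\<^sub>R z) i) \<bullet> i))"
    using 1 by (intro Bochner_Integration.integral_sum[symmetric]) (auto simp del: inner_scaleR_left)
  finally show ?thesis by (simp add: avg_def classical_div_def sum_distrib_left)
qed

lemma smear_test_field:
  assumes "p \<in> test_fields"
  shows "smear p \<in> test_fields"
proof (rule test_fieldsI)
  note p = test_fieldsD[OF assms]
  show "smooth (smear p)" by (rule smooth_avg[OF Q_mass(1) smoothing_measurable p(1,2)])
  show "bsupp (smear p)" by (rule smear_bsupp[OF p(2)])
  show "norm (smear p x) \<le> 1" for x
    using norm_weighted_le[OF Q_mass(1), of "\<lambda>z. p (x + \<epsilon> *\<^sub>R z)" 1] p(3) Q_mass(2) Q_nonneg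
    by (simp add: avg_def)
qed

lemma nonlocal_perimeter_le: "nper \<epsilon> E \<le> perimeter E"
  unfolding nonlocal_perimeter_def
proof (rule SUP_least)
  fix p :: "'a \<Rightarrow> 'a" assume p: "p \<in> test_fields"
  have "ndiv \<epsilon> p = classical_div (smear p)"
    using nonlocal_div_eq_smear smear_classical_div test_fieldsD[OF p] by (auto simp: fun_eq_iff)
  then show "ereal (LINT x:E|lebesgue. ndiv \<epsilon> p x) \<le> perimeter E"
    unfolding perimeter_def using smear_test_field[OF p] by (auto intro: SUP_upper)
qed

lemma nonlocal_div_smooth:
  assumes p: "smooth p" "bsupp p"
  shows "smooth (ndiv \<epsilon> p)" "bsupp (ndiv \<epsilon> p)"
proof -
  have "ndiv \<epsilon> p = smear (classical_div p)"
    using nonlocal_div_eq_smear[OF p] by auto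
  then show "smooth (ndiv \<epsilon> p)" "bsupp (ndiv \<epsilon> p)"
    using smooth_avg[OF Q_mass(1) smoothing_measurable classical_div_smooth[OF p(1)] classical_div_bsupp[OF p(2)]]
      smear_bsupp[OF classical_div_bsupp[OF p(2)]] by auto
qed

lemma nonlocal_div_approx:
  assumes p: "smooth p" "bsupp p" and L: "\<And>x y. norm (classical_div p x - classical_div p y) \<le> L * norm (x - y)"
  shows "\<bar>ndiv \<epsilon> p x - classical_div p x\<bar> \<le> L * \<epsilon>"
proof -
  let ?c = "classical_div p"
  obtain b :: 'a where b: "b \<in> Basis" using nonempty_Basis by blast
  have "0 \<le> L" using L[of b 0] b norm_ge_zero[of "?c b - ?c 0"] by simp
  have i: "integrable lborel (\<lambda>z. Q z *\<^sub>R ?c (x + \<epsilon> *\<^sub>R z))"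
    by (rule integrable_avg[OF Q_mass(1) smoothing_measurable classical_div_smooth[OF p(1)] classical_div_bsupp[OF p(2)]])
  have "ndiv \<epsilon> p x - ?c x = (LBINT z. Q z *\<^sub>R ?c (x + \<epsilon> *\<^sub>R z)) - (LBINT z. Q z *\<^sub>R ?c x)"
    using Q_mass by (simp add: nonlocal_div_eq_smear[OF p] avg_def)
  also have "\<dots> = (LBINT z. Q z *\<^sub>R ?c (x + \<epsilon> *\<^sub>R z) - Q z *\<^sub>R ?c x)"
    using i Q_mass by (intro Bochner_Integration.integral_diff[symmetric]) auto
  also have "\<bar>\<dots>\<bar> \<le> (LBINT z. Q z * (L * \<epsilon>))"
  proof (rule integral_abs_bound_integral)
    show "integrable lborel (\<lambda>z. Q z *\<^sub>R ?c (x + \<epsilon> *\<^sub>R z) - Q z *\<^sub>R ?c x)"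
      using i Q_mass by (intro Bochner_Integration.integrable_diff) auto
    show "\<bar>Q z *\<^sub>R ?c (x + \<epsilon> *\<^sub>R z) - Q z *\<^sub>R ?c x\<bar> \<le> Q z * (L * \<epsilon>)" for z
    proof (cases "Q z = 0")
      case False
      then have "norm z \<le> 1" by (rule Q_support)
      have "\<bar>?c (x + \<epsilon> *\<^sub>R z) - ?c x\<bar> \<le> L * (\<epsilon> * norm z)"
        using L[of "x + \<epsilon> *\<^sub>R z" x] eps by simp
      also have "\<dots> \<le> L * \<epsilon>"
        using \<open>norm z \<le> 1\<close> \<open>0 \<le> L\<close> eps by (intro mult_left_mono) auto
      finally show ?thesis
        using Q_nonneg[of z] by (simp add: right_diff_distrib[symmetric] abs_mult mult_left_mono)
    qed simp
  qed (use Q_mass in simp)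
  finally show ?thesis using Q_mass by simp
qed

lemma nonlocal_div_vanishes:
  assumes p: "smooth p" "bsupp p" and R: "\<And>x. norm x > R \<Longrightarrow> classical_div p x = 0"
    and "norm x > R + \<epsilon>"
  shows "ndiv \<epsilon> p x = 0"
proof -
  have "Q z * classical_div p (x + \<epsilon> *\<^sub>R z) = 0" for z
  proof (cases "Q z = 0")
    case False
    then have "norm (\<epsilon> *\<^sub>R z) \<le> \<epsilon>" using Q_support[OF False] eps by simp
    moreover have "norm x \<le> norm (x + \<epsilon> *\<^sub>R z) + norm (\<epsilon> *\<^sub>R z)"
      using norm_triangle_ineq4[of "x + \<epsilon> *\<^sub>R z" "\<epsilon> *\<^sub>R z"] by simp
    ultimately have "norm (x + \<epsilon> *\<^sub>R z) > R"
      using assms(4) by linarith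
    then show ?thesis using R by simp
  qed simp
  then show ?thesis
    by (simp only: nonlocal_div_eq_smear[OF p] avg_def real_scaleR_def integral_zero)
qed

end

section \<open>Convergence of the fluxes and the lower bound\<close>

lemma integrable_indicator_lebesgue:
  fixes f :: "'a \<Rightarrow> real"
  assumes "smooth f" "bsupp f" "E \<in> sets lebesgue"
  shows "integrable lebesgue (\<lambda>x. indicator E x *\<^sub>R f x)"
  using integrable_mult_indicator[OF assms(3) integrable_lebesgue[OF integrable_continuous_bsupp[OF
        smooth_continuous_on[OF assms(1)] assms(2)]]] .

text \<open>Once \<open>\<epsilon> n \<le> 1\<close>, both divergences vanish outside one fixed ball
  \<open>K\<close>. There the error splits into the uniform distance \<open>L * \<epsilon> n\<close>
  of the divergences and a bounded divergence times the local distance of the sets.\<close>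

lemma nonlocal_flux_tendsto:
  fixes X :: "nat \<Rightarrow> 'a set"
  assumes \<epsilon>: "\<And>n. 0 < \<epsilon> n" "\<epsilon> \<longlonglongrightarrow> 0"
    and X: "\<And>n. X n \<in> sets lebesgue" and E: "E \<in> sets lebesgue" and conv: "local_set_conv X E"
    and p: "smooth p" "bsupp p"
  shows "(\<lambda>n. LINT x:X n|lebesgue. ndiv (\<epsilon> n) p x) \<longlonglongrightarrow> (LINT x:E|lebesgue. classical_div p x)"
proof -
  let ?c = "classical_div p" and ?d = "\<lambda>n. ndiv (\<epsilon> n) p"
  have c: "smooth ?c" "bsupp ?c"
    using p classical_div_smooth classical_div_bsupp by blast+
  obtain L where L: "L > 0" "\<And>x v. norm (fd ?c x v) \<le> L * norm v"
    using smooth_fd_bound[OF c] by blast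
  have lip: "norm (?c x - ?c y) \<le> L * norm (x - y)" for x y
    by (rule fd_bound_imp_lipschitz[OF c(1) L(2)])
  obtain B where B: "B > 0" "\<And>x. norm (?c x) \<le> B"
    using continuous_bsupp_bounded[OF smooth_continuous_on[OF c(1)] c(2)] by blast
  obtain R where R: "R > 0" "\<And>x. norm x > R \<Longrightarrow> ?c x = 0"
    using bsuppE[OF c(2)] by blast
  define K where "K = cball (0::'a) (R + 1)"
  have Kl: "K \<in> lmeasurable" "compact K" by (auto simp: K_def)
  let ?\<delta> = "\<lambda>n x. \<bar>indicator (X n) x - indicator E x :: real\<bar>"
  have iK: "integrable lebesgue (\<lambda>x. indicator K x *\<^sub>R (1::real))"
    using Kl(1) by (simp add: lmeasurable_iff_integrable)
  have i\<delta>: "integrable lebesgue (\<lambda>x. indicator K x *\<^sub>R ?\<delta> n x)" for n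
    by (rule Bochner_Integration.integrable_bound[OF iK])
      (use X E Kl(1) in \<open>auto simp: indicator_def fmeasurable_def\<close>)
  have bound: "\<bar>(LINT x:X n|lebesgue. ?d n x) - (LINT x:E|lebesgue. ?c x)\<bar>
      \<le> L * \<epsilon> n * measure lebesgue K + B * (LINT x:K|lebesgue. ?\<delta> n x)" if "\<epsilon> n \<le> 1" for n
  proof -
    note d = nonlocal_div_smooth[OF \<epsilon>(1)[of n] p]
    have id: "integrable lebesgue (\<lambda>x. indicator (X n) x *\<^sub>R ?d n x)"
      by (rule integrable_indicator_lebesgue[OF d X])
    have ic: "integrable lebesgue (\<lambda>x. indicator E x *\<^sub>R ?c x)"
      by (rule integrable_indicator_lebesgue[OF c E])
    have "(LINT x:X n|lebesgue. ?d n x) - (LINT x:E|lebesgue. ?c x)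
        = (LINT x|lebesgue. indicator (X n) x *\<^sub>R ?d n x - indicator E x *\<^sub>R ?c x)"
      using id ic by (simp add: set_lebesgue_integral_def)
    also have "\<bar>\<dots>\<bar> \<le> (LINT x|lebesgue. L * \<epsilon> n * (indicator K x *\<^sub>R 1) + B * (indicator K x *\<^sub>R ?\<delta> n x))"
    proof (rule integral_abs_bound_integral)
      show "\<bar>indicator (X n) x *\<^sub>R ?d n x - indicator E x *\<^sub>R ?c x\<bar>
          \<le> L * \<epsilon> n * (indicator K x *\<^sub>R 1) + B * (indicator K x *\<^sub>R ?\<delta> n x)" for x
      proof (cases "x \<in> K")
        case True
        have "\<bar>?d n x - ?c x\<bar> \<le> L * \<epsilon> n" "\<bar>?c x\<bar> \<le> B"
          using nonlocal_div_approx[OF \<epsilon>(1) p lip] B(2) by auto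
        then show ?thesis
          using True L(1) \<epsilon>(1)[of n] by (auto simp: indicator_def)
      next
        case False
        then have n: "norm x > R + 1" by (simp add: K_def)
        then have "?d n x = 0"
          by (intro nonlocal_div_vanishes[OF \<epsilon>(1) p R(2)]) (use that in auto)
        then show ?thesis using n R(2)[of x] False by simp
      qed
    qed (use id ic iK i\<delta> in auto)
    also have "\<dots> = L * \<epsilon> n * measure lebesgue K + B * (LINT x:K|lebesgue. ?\<delta> n x)"
      using iK i\<delta>[of n] Kl(1) by (simp add: set_lebesgue_integral_def)
    finally show ?thesis .
  qed
  have "(\<lambda>n. L * \<epsilon> n * measure lebesgue K + B * (LINT x:K|lebesgue. ?\<delta> n x))
      \<longlonglongrightarrow> L * 0 * measure lebesgue K + B * 0"
    using conv Kl(2) unfolding local_set_conv_def by (intro tendsto_intros \<epsilon>(2)) blast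
  then have lim: "(\<lambda>n. L * \<epsilon> n * measure lebesgue K + B * (LINT x:K|lebesgue. ?\<delta> n x)) \<longlonglongrightarrow> 0"
    by simp
  have "\<forall>\<^sub>F n in sequentially. \<epsilon> n < 1"
    using order_tendstoD(2)[OF \<epsilon>(2), of 1] by simp
  then have "\<forall>\<^sub>F n in sequentially. norm ((LINT x:X n|lebesgue. ?d n x) - (LINT x:E|lebesgue. ?c x))
      \<le> L * \<epsilon> n * measure lebesgue K + B * (LINT x:K|lebesgue. ?\<delta> n x)"
    by eventually_elim (use bound in simp)
  from Lim_null_comparison[OF this lim] show ?thesis
    by (rule LIM_zero_cancel)
qed

lemma perimeter_le_liminf:
  fixes X :: "nat \<Rightarrow> 'a set"
  assumes "\<And>n. 0 < \<epsilon> n" "\<epsilon> \<longlonglongrightarrow> 0"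
    and "\<And>n. X n \<in> sets lebesgue" and "E \<in> sets lebesgue" and "local_set_conv X E"
  shows "perimeter E \<le> liminf (\<lambda>n. nper (\<epsilon> n) (X n))"
  unfolding perimeter_def
proof (rule SUP_least)
  fix p :: "'a \<Rightarrow> 'a" assume p: "p \<in> test_fields"
  let ?I = "\<lambda>n. ereal (LINT x:X n|lebesgue. ndiv (\<epsilon> n) p x)"
  have "?I \<longlonglongrightarrow> ereal (LINT x:E|lebesgue. classical_div p x)"
    using nonlocal_flux_tendsto[OF assms test_fieldsD(1,2)[OF p]] by simp
  then have "ereal (LINT x:E|lebesgue. classical_div p x) = liminf ?I"
    by (rule lim_imp_Liminf[OF trivial_limit_sequentially, symmetric])
  also have "\<dots> \<le> liminf (\<lambda>n. nper (\<epsilon> n) (X n))"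
    using p unfolding nonlocal_perimeter_def by (intro Liminf_mono always_eventually allI SUP_upper)
  finally show "ereal (LINT x:E|lebesgue. classical_div p x) \<le> \<dots>" .
qed

end

section \<open>Increments in mean square\<close>

lemma fubini_dominated:
  fixes F :: "'a::euclidean_space \<Rightarrow> 'b::euclidean_space \<Rightarrow> real"
  assumes F [measurable]: "(\<lambda>(x, y). F x y) \<in> borel_measurable (lborel \<Otimes>\<^sub>M lborel)"
    and g: "integrable lborel g" and h: "integrable lborel h"
    and le: "\<And>x y. \<bar>F x y\<bar> \<le> g x * h y"
  shows "(LBINT x. LBINT y. F x y) = (LBINT y. LBINT x. F x y)"
    and "integrable lborel (\<lambda>y. LBINT x. F x y)"
proof -
  have [measurable]: "g \<in> borel_measurable lborel" "h \<in> borel_measurable lborel"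
    using g h by auto
  have "integrable (lborel \<Otimes>\<^sub>M lborel) (\<lambda>(x, y). g x * h y)"
  proof (rule lborel_pair.Fubini_integrable)
    have "(\<lambda>x. LBINT y. norm (case (x, y) of (x, y) \<Rightarrow> g x * h y)) = (\<lambda>x. \<bar>g x\<bar> * (LBINT y. \<bar>h y\<bar>))"
      by (simp add: abs_mult)
    then show "integrable lborel (\<lambda>x. LBINT y. norm (case (x, y) of (x, y) \<Rightarrow> g x * h y))"
      using g by simp
  qed (use h in auto)
  then have int: "integrable (lborel \<Otimes>\<^sub>M lborel) (\<lambda>(x, y). F x y)"
    by (rule Bochner_Integration.integrable_bound)
      (use le in \<open>auto intro!: AE_I2 order.trans[OF _ abs_ge_self]\<close>)
  show "(LBINT x. LBINT y. F x y) = (LBINT y. LBINT x. F x y)"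
    using lborel_pair.Fubini_integral[OF int] by simp
  show "integrable lborel (\<lambda>y. LBINT x. F x y)"
    by (rule lborel_pair.integrable_snd[OF int])
qed

text \<open>A common class for indicators of bounded sets and their mollifications, on which all
  square integrals below are finite.\<close>

definition unit_density :: "('a::euclidean_space \<Rightarrow> real) \<Rightarrow> bool" where
  "unit_density w \<longleftrightarrow> w \<in> borel_measurable borel \<and> bsupp w \<and> (\<forall>x. 0 \<le> w x \<and> w x \<le> 1)"

definition sqdiff :: "('a::euclidean_space \<Rightarrow> real) \<Rightarrow> 'a \<Rightarrow> real" where
  "sqdiff w h = (LBINT x. (w (x + h) - w x)\<^sup>2)"

lemma densityD:
  assumes "unit_density w"
  shows "w \<in> borel_measurable borel" "bsupp w" "0 \<le> w x" "w x \<le> 1"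
  using assms by (auto simp: unit_density_def)

lemma bsupp_translate:
  assumes "bsupp w"
  shows "bsupp (\<lambda>x. w (x + h))"
proof -
  obtain R where R: "\<And>x. norm x > R \<Longrightarrow> w x = 0"
    using bsuppE[OF assms] by blast
  have "w (x + h) = 0" if "norm x > R + norm h" for x
    using R[of "x + h"] that norm_triangle_ineq4[of "x + h" h] by simp
  then show ?thesis unfolding bsupp_def by (metis not_le)
qed

lemma bsupp_diff_sq:
  fixes f g :: "'a::real_normed_vector \<Rightarrow> real"
  assumes "bsupp f" "bsupp g"
  shows "bsupp (\<lambda>x. (f x - g x)\<^sup>2)"
proof -
  obtain R where R: "\<And>x. norm x > R \<Longrightarrow> f x = 0"
    using bsuppE[OF assms(1)] by blast
  obtain S where S: "\<And>x. norm x > S \<Longrightarrow> g x = 0"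
    using bsuppE[OF assms(2)] by blast
  have "(f x - g x)\<^sup>2 = 0" if "norm x > max R S" for x
    using that R S by auto
  then show ?thesis unfolding bsupp_def by (metis not_le)
qed

lemma density_diff_sq_integrable:
  assumes u: "unit_density u" and w: "unit_density w"
  shows "integrable lborel (\<lambda>x. (u (x + a) - w (x + b))\<^sup>2)"
proof (rule integrable_bounded_bsupp)
  show "bsupp (\<lambda>x. (u (x + a) - w (x + b))\<^sup>2)"
    using bsupp_diff_sq[OF bsupp_translate bsupp_translate] densityD(2) u w by blast
  have [measurable]: "u \<in> borel_measurable borel" "w \<in> borel_measurable borel"
    using densityD(1) u w by auto
  show "(\<lambda>x. (u (x + a) - w (x + b))\<^sup>2) \<in> borel_measurable lborel"
    by measurable
  show "norm ((u (x + a) - w (x + b))\<^sup>2) \<le> 1" for x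
    using densityD(3,4)[OF u, of "x + a"] densityD(3,4)[OF w, of "x + b"]
    by (simp add: abs_square_le_1 abs_if)
qed

lemma sq_sum2: "(a + b)\<^sup>2 \<le> 2 * a\<^sup>2 + 2 * (b::real)\<^sup>2"
  using zero_le_power2[of "a - b"] by (simp add: power2_eq_square algebra_simps)

lemma sqdiff_nonneg: "0 \<le> sqdiff w h"
  unfolding sqdiff_def by (rule integral_nonneg_AE) simp

lemma sqdiff_zero [simp]: "sqdiff w 0 = 0"
  by (simp add: sqdiff_def)

lemma sqdiff_add:
  assumes "unit_density w"
  shows "sqdiff w (a + b) \<le> 2 * sqdiff w a + 2 * sqdiff w b"
proof -
  have [measurable]: "w \<in> borel_measurable borel" using densityD(1)[OF assms] .
  note i = density_diff_sq_integrable[OF assms assms]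
  have "(LBINT x. (w (x + (a + b)) - w (x + 0))\<^sup>2)
      \<le> (LBINT x. 2 * (w (x + b + a) - w (x + b))\<^sup>2 + 2 * (w (x + b) - w (x + 0))\<^sup>2)"
  proof (rule integral_mono)
    show "(w (x + (a + b)) - w (x + 0))\<^sup>2 \<le> 2 * (w (x + b + a) - w (x + b))\<^sup>2 + 2 * (w (x + b) - w (x + 0))\<^sup>2" for x
      using sq_sum2[of "w (x + b + a) - w (x + b)" "w (x + b) - w (x + 0)"] by (simp add: add_ac)
    show "integrable lborel (\<lambda>x. 2 * (w (x + b + a) - w (x + b))\<^sup>2 + 2 * (w (x + b) - w (x + 0))\<^sup>2)"
      using i[of "b + a" b] i[of b 0] by (simp add: add.assoc)
  qed (rule i)
  also have "\<dots> = 2 * (LBINT x. (w (x + b + a) - w (x + b))\<^sup>2) + 2 * (LBINT x. (w (x + b) - w (x + 0))\<^sup>2)"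
    using i[of "b + a" b] i[of b 0] by (simp add: add.assoc)
  also have "(LBINT x. (w (x + b + a) - w (x + b))\<^sup>2) = sqdiff w a"
    using lborel_integral_translate(1)[of "\<lambda>x. (w (x + a) - w x)\<^sup>2" b] by (simp add: sqdiff_def)
  finally show ?thesis by (simp add: sqdiff_def)
qed

text \<open>Telescoping into \<open>n\<close> increments of equal mean square, with a Cauchy-Schwarz
  factor \<open>n\<close>. The loss \<open>n\<^sup>2\<close> is what the factor
  \<open>\<epsilon>\<^sup>2\<close> of the energy estimate can pay.\<close>

lemma sqdiff_scale:
  assumes "unit_density w"
  shows "sqdiff w (real n *\<^sub>R a) \<le> (real n)\<^sup>2 * sqdiff w a"
proof -
  have [measurable]: "w \<in> borel_measurable borel" using densityD(1)[OF assms] .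
  note i = density_diff_sq_integrable[OF assms assms]
  let ?d = "\<lambda>j x. w (x + real (Suc j) *\<^sub>R a) - w (x + real j *\<^sub>R a)"
  have "(LBINT x. (w (x + real n *\<^sub>R a) - w (x + 0))\<^sup>2) \<le> (LBINT x. (\<Sum>j<n. (?d j x)\<^sup>2) * real n)"
  proof (rule integral_mono)
    show "(w (x + real n *\<^sub>R a) - w (x + 0))\<^sup>2 \<le> (\<Sum>j<n. (?d j x)\<^sup>2) * real n" for x
    proof -
      have "w (x + real n *\<^sub>R a) - w (x + 0) = (\<Sum>j<n. ?d j x)"
        using sum_lessThan_telescope[of "\<lambda>j. w (x + real j *\<^sub>R a)" n] by simp
      then show ?thesis
        using sum_squared_le_sum_of_squares[of "\<lambda>j. ?d j x" "{..<n}"] by simp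
    qed
  qed (intro i integrable_mult_left Bochner_Integration.integrable_sum)+
  also have "\<dots> = (\<Sum>j<n. LBINT x. (?d j x)\<^sup>2) * real n"
    using i by (simp add: Bochner_Integration.integral_sum)
  also have "\<dots> = (\<Sum>j<n. sqdiff w a) * real n"
  proof -
    have "(LBINT x. (?d j x)\<^sup>2) = sqdiff w a" for j
    proof -
      have "(LBINT x. (?d j x)\<^sup>2) = (LBINT x. (w (x + real j *\<^sub>R a + a) - w (x + real j *\<^sub>R a))\<^sup>2)"
        by (simp add: algebra_simps)
      also have "\<dots> = sqdiff w a"
        using lborel_integral_translate(1)[of "\<lambda>x. (w (x + a) - w x)\<^sup>2" "real j *\<^sub>R a"] by (simp add: sqdiff_def)
      finally show ?thesis .
    qed
    then show ?thesis by (simp only:)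
  qed
  finally show ?thesis by (simp add: sqdiff_def power2_eq_square mult_ac)
qed

lemma sqdiff_borel:
  assumes "unit_density w"
  shows "sqdiff w \<in> borel_measurable borel"
proof -
  have [measurable]: "w \<in> borel_measurable borel" using densityD(1)[OF assms] .
  show ?thesis unfolding sqdiff_def[abs_def] by measurable
qed

lemma integrable_indicator_bounded:
  fixes A :: "'a::euclidean_space set"
  assumes "A \<in> sets borel" "bounded A"
  shows "integrable lborel (indicator A :: 'a \<Rightarrow> real)"
  by (rule integrable_real_indicator) (use assms emeasure_bounded_finite[OF assms(2)] in \<open>auto simp: infinity_ennreal_def\<close>)

lemma sqdiff_le:
  fixes w :: "'a::euclidean_space \<Rightarrow> real"
  assumes w: "unit_density w" and "norm h \<le> 1"
    and R: "\<And>x. norm x > R \<Longrightarrow> w x = 0" and d: "\<And>x. \<bar>w (x + h) - w x\<bar> \<le> D"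
  shows "sqdiff w h \<le> D\<^sup>2 * measure lborel (cball (0::'a::euclidean_space) (R + 1))"
proof -
  have "sqdiff w h = (LBINT x. (w (x + h) - w (x + 0))\<^sup>2)" by (simp add: sqdiff_def)
  also have "\<dots> \<le> (LBINT x. D\<^sup>2 * indicator (cball (0::'a) (R + 1)) x)"
  proof (rule integral_mono)
    show "integrable lborel (\<lambda>x. (w (x + h) - w (x + 0))\<^sup>2)"
      by (rule density_diff_sq_integrable[OF w w])
    show "(w (x + h) - w (x + 0))\<^sup>2 \<le> D\<^sup>2 * indicator (cball (0::'a) (R + 1)) x" for x
    proof (cases "norm x \<le> R + 1")
      case True
      then show ?thesis using power_mono[OF d[of x], of 2] by (simp add: indicator_def)
    next
      case False
      then have "w (x + h) = 0" "w x = 0"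
        using R[of "x + h"] R[of x] assms(2) norm_triangle_ineq4[of "x + h" h] by auto
      then show ?thesis by simp
    qed
  qed (use integrable_indicator_bounded[of "cball (0::'a) (R + 1)"] in simp)
  finally show ?thesis by simp
qed

definition grad :: "('a::euclidean_space \<Rightarrow> real) \<Rightarrow> 'a \<Rightarrow> 'a" where
  "grad v x = (\<Sum>i\<in>Basis. fd v x i *\<^sub>R i)"

lemma grad_inner:
  assumes "smooth v"
  shows "grad v x \<bullet> h = fd v x h"
proof -
  interpret bounded_linear "fd v x" by (rule smooth_linear_fd[OF assms])
  have "fd v x h = (\<Sum>i\<in>Basis. (h \<bullet> i) *\<^sub>R fd v x i)"
    using sum[of "\<lambda>i. (h \<bullet> i) *\<^sub>R i" Basis] scaleR by (simp add: euclidean_representation)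
  then show ?thesis
    by (simp add: grad_def inner_sum_left inner_commute[of h] mult.commute)
qed

lemma smooth_grad:
  assumes "smooth v"
  shows "smooth (grad v)"
  unfolding grad_def[abs_def]
  by (intro smooth_sum smooth_bounded_linear_comp[OF bounded_linear_scaleR_left] smooth_fd assms) simp

lemma bsupp_grad:
  assumes "bsupp v"
  shows "bsupp (grad v)"
proof -
  obtain R where "\<And>x. norm x > R \<Longrightarrow> v x = 0"
    using bsuppE[OF assms] by metis
  then have "grad v x = 0" if "norm x > R" for x
    using fd_zero_outside[of R v x] that by (simp add: grad_def)
  then show ?thesis unfolding bsupp_def by (metis not_le)
qed

lemma norm_grad_le:
  assumes "smooth v" "\<And>h. \<bar>fd v x h\<bar> \<le> \<Lambda> * norm h"
  shows "norm (grad v x) \<le> \<Lambda>"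
proof (cases "grad v x = 0")
  case True
  obtain b :: 'a where "b \<in> Basis" using nonempty_Basis by blast
  then show ?thesis using True assms(2)[of b] by simp
next
  case False
  have "(norm (grad v x))\<^sup>2 \<le> \<Lambda> * norm (grad v x)"
    using assms(2)[of "grad v x"] grad_inner[OF assms(1), of x "grad v x"]
    by (simp add: power2_norm_eq_inner)
  then show ?thesis using False by (simp add: power2_eq_square)
qed

text \<open>A bound on the nonlocal perimeter with a function in place of the indicator: unlike a
  property of sets, it can be passed on to mollifications.\<close>

definition (in radial_kernel) controlled :: "real \<Rightarrow> real \<Rightarrow> ('a \<Rightarrow> real) \<Rightarrow> bool" where
  "controlled \<epsilon> C w \<longleftrightarrow> (\<forall>p\<in>test_fields. (LBINT x. w x * ndiv \<epsilon> p x) \<le> C)"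

text \<open>The two scaling bounds say through \<open>k\<close> that
  \<open>r powr (d - 2) * \<rho>b r\<close> is nonincreasing, and near \<open>0\<close> even after
  multiplication by \<open>r powr \<nu>\<close>; replacing \<open>r\<close> by \<open>r / l\<close>
  explains the powers of \<open>l\<close>. The last bound is the almost monotonicity of
  \<open>r powr (d + \<sigma> - 1) * \<rho>b r\<close>, with two more powers of \<open>r\<close>
  because \<open>\<rho>\<close> carries the factor \<open>z \<bullet> z\<close>.\<close>

locale coercive_kernel = radial_kernel \<rho> k
  for \<rho> :: "'a::euclidean_space \<Rightarrow> real" and k :: "real \<Rightarrow> real" +
  fixes \<nu> \<eta> \<sigma> c :: real
  assumes pos: "0 < \<nu>" "0 < \<eta>" "0 < \<sigma>" "\<sigma> < 1" "0 < c"
    and k_scale: "\<And>s l. 0 < s \<Longrightarrow> 1 \<le> l \<Longrightarrow> l ^ DIM('a) * k s \<le> k (s / l\<^sup>2)"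
    and k_scale_near: "\<And>s l. 0 < s \<Longrightarrow> s < \<eta>\<^sup>2 \<Longrightarrow> 1 \<le> l \<Longrightarrow> l powr \<nu> * (l ^ DIM('a) * k s) \<le> k (s / l\<^sup>2)"
    and k_lower: "\<And>r. 0 < r \<Longrightarrow> r < \<eta> \<Longrightarrow> c * r powr (- (real DIM('a) + 1 + \<sigma>)) \<le> k (r\<^sup>2)"
begin

text \<open>The radial derivative of \<open>b\<close> against the kernel: differentiate the dilation
  \<open>\<lambda> \<mapsto> \<integral> k (\<bar>z\<bar>\<^sup>2) b (\<lambda> z) dz\<close> at \<open>\<lambda> = 1\<close>, moving the dilation onto the kernel.\<close>

lemma radial_derivative_bound:
  fixes b D :: "'a \<Rightarrow> real"
  assumes b [measurable]: "b \<in> borel_measurable borel" and b0: "\<And>z. 0 \<le> b z" and bq: "\<And>z. b z \<le> L * (z \<bullet> z)"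
    and D: "integrable lborel (\<lambda>z. \<kappa> z * D z)"
    and taylor: "\<And>z t. 0 < t \<Longrightarrow> \<bar>b (z + t *\<^sub>R z) - b z - t * D z\<bar> \<le> L * t\<^sup>2 * (z \<bullet> z)"
  shows "\<nu> * (LBINT z. indicator (ball 0 \<eta>) z * (\<kappa> z * b z)) \<le> (LBINT z. \<kappa> z * D z)"
    and "integrable lborel (\<lambda>z. \<kappa> z * b z)"
proof -
  have kb: "integrable lborel (\<lambda>z. \<kappa> z * b (a *\<^sub>R z))" for a
  proof (rule Bochner_Integration.integrable_bound)
    show "integrable lborel (\<lambda>z. L * a\<^sup>2 * (((z::'a) \<bullet> z) * \<kappa> z))"
      using rho_integrable by simp
    have "\<kappa> z * b (a *\<^sub>R z) \<le> L * a\<^sup>2 * ((z \<bullet> z) * \<kappa> z)" for z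
      using mult_left_mono[OF bq[of "a *\<^sub>R z"] k_nonneg[of "z \<bullet> z"]] by (simp add: power2_eq_square mult_ac)
    then show "AE z in lborel. norm (\<kappa> z * b (a *\<^sub>R z)) \<le> norm (L * a\<^sup>2 * ((z \<bullet> z) * \<kappa> z))"
      using b0 k_nonneg by (intro AE_I2) (simp add: order.trans[OF _ abs_ge_self])
  qed measurable
  show kb1: "integrable lborel (\<lambda>z. \<kappa> z * b z)"
    using kb[of 1] by simp
  let ?I = "LBINT z. indicator (ball 0 \<eta>) z * (\<kappa> z * b z)"
  let ?K = "LBINT z. \<kappa> z * D z"
  have iI: "integrable lborel (\<lambda>z. indicator (ball 0 \<eta>) z * (\<kappa> z * b z))"
    using integrable_mult_indicator[OF _ kb1, of "ball 0 \<eta>"] by simp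
  have I0: "0 \<le> ?I"
    using b0 k_nonneg by (intro integral_nonneg_AE AE_I2) auto
  \<comment> \<open>The integral dilated by \<open>1 + t\<close> is bounded below by dilating the
    kernel and above by expanding \<open>b\<close>; the common undilated term cancels, and
    \<open>t\<close> is divided out before it tends to \<open>0\<close>.\<close>
  have main: "\<nu> / (1 + t) * ?I \<le> ?K + L * t * DIM('a)" if t: "0 < t" for t
  proof -
    let ?l = "1 + t"
    have intl: "integrable lborel (\<lambda>y. inverse (?l ^ DIM('a)) * (k ((y \<bullet> y) / ?l\<^sup>2) * b y))"
      and eq: "(LBINT z. \<kappa> z * b (?l *\<^sub>R z))
        = (LBINT y. inverse (?l ^ DIM('a)) * (k ((y \<bullet> y) / ?l\<^sup>2) * b y))"
    proof -
      have m: "(\<lambda>y. inverse (?l ^ DIM('a)) * (k ((y \<bullet> y) / ?l\<^sup>2) * b y)) \<in> borel_measurable borel"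
        by measurable
      have "?l *\<^sub>R z \<bullet> ?l *\<^sub>R z / ?l\<^sup>2 = z \<bullet> z" for z :: 'a
        using t by (simp add: power2_eq_square)
      then show "integrable lborel (\<lambda>y. inverse (?l ^ DIM('a)) * (k ((y \<bullet> y) / ?l\<^sup>2) * b y))"
        "(LBINT z. \<kappa> z * b (?l *\<^sub>R z))
        = (LBINT y. inverse (?l ^ DIM('a)) * (k ((y \<bullet> y) / ?l\<^sup>2) * b y))"
        using lborel_integral_affine[OF m, of ?l 0] t kb[of ?l] by simp_all
    qed
    have "\<nu> / ?l * t * ?I + (LBINT z. \<kappa> z * b z)
        = (LBINT z. \<nu> / ?l * t * (indicator (ball 0 \<eta>) z * (\<kappa> z * b z)) + \<kappa> z * b z)"
      using iI kb1 by simp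
    also have "\<dots> \<le> (LBINT y. inverse (?l ^ DIM('a)) * (k ((y \<bullet> y) / ?l\<^sup>2) * b y))"
    proof (rule integral_mono[OF _ intl])
      show "integrable lborel (\<lambda>z. \<nu> / ?l * t * (indicator (ball 0 \<eta>) z * (\<kappa> z * b z)) + \<kappa> z * b z)"
        using iI kb1 by simp
      fix z :: 'a
      have 1: "\<kappa> z \<le> inverse (?l ^ DIM('a)) * k ((z \<bullet> z) / ?l\<^sup>2)" if "z \<noteq> 0"
        using k_scale[of "z \<bullet> z" ?l] that t by (simp add: field_simps)
      have 2: "\<nu> / ?l * t * \<kappa> z + \<kappa> z \<le> inverse (?l ^ DIM('a)) * k ((z \<bullet> z) / ?l\<^sup>2)"
        if z: "z \<noteq> 0" "z \<in> ball 0 \<eta>"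
      proof -
        have "z \<bullet> z < \<eta>\<^sup>2"
          using z(2) by (simp add: dot_square_norm power_strict_mono)
        then have "?l powr \<nu> * \<kappa> z \<le> inverse (?l ^ DIM('a)) * k ((z \<bullet> z) / ?l\<^sup>2)"
          using k_scale_near[of "z \<bullet> z" ?l] z(1) t by (simp add: field_simps)
        \<comment> \<open>From \<open>ln l \<ge> 1 - 1 / l\<close> and
          \<open>exp x \<ge> 1 + x\<close>: a gain linear in \<open>t\<close>, which survives the
          division by \<open>t\<close>.\<close>
        moreover have "1 + \<nu> / ?l * t \<le> ?l powr \<nu>"
        proof -
          have "t / ?l \<le> ln ?l"
          proof -
            have "- ln ?l \<le> inverse ?l - 1"
              using ln_le_minus_one[of "inverse ?l"] ln_inverse[of ?l] t by simp
            moreover have "inverse ?l - 1 = - (t / ?l)"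
              using t by (simp add: field_simps)
            ultimately show ?thesis by linarith
          qed
          then have "\<nu> / ?l * t \<le> \<nu> * ln ?l"
            using mult_left_mono[of "t / ?l" "ln ?l" \<nu>] pos(1) by simp
          also have "1 + \<nu> * ln ?l \<le> ?l powr \<nu>"
            using exp_ge_add_one_self[of "\<nu> * ln ?l"] t by (simp add: powr_def)
          finally show ?thesis by simp
        qed
        ultimately show ?thesis
          using mult_right_mono[of "1 + \<nu> / ?l * t" "?l powr \<nu>" "\<kappa> z"] k_nonneg[of "z \<bullet> z"]
          by (simp add: algebra_simps)
      qed
      \<comment> \<open>The dilation bounds say nothing at the origin, where \<open>k\<close> is
        \<open>0\<close> by convention; there \<open>b\<close> vanishes.\<close>
      have bz: "b 0 = 0" using b0[of 0] bq[of 0] by simp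
      show "\<nu> / ?l * t * (indicator (ball 0 \<eta>) z * (\<kappa> z * b z)) + \<kappa> z * b z
          \<le> inverse (?l ^ DIM('a)) * (k ((z \<bullet> z) / ?l\<^sup>2) * b z)"
      proof (cases "z = 0")
        case False
        show ?thesis
        proof (cases "z \<in> ball 0 \<eta>")
          case True
          from mult_right_mono[OF 2[OF False True] b0[of z]] True show ?thesis
            by (simp add: algebra_simps)
        next
          case F: False
          from mult_right_mono[OF 1[OF False] b0[of z]] F show ?thesis
            by (simp add: algebra_simps)
        qed
      qed (simp add: bz)
    qed
    also have "\<dots> = (LBINT z. \<kappa> z * b (z + t *\<^sub>R z))"
      using eq by (simp add: scaleR_add_left)
    also have "\<dots> \<le> (LBINT z. \<kappa> z * b z + t * (\<kappa> z * D z) + L * t\<^sup>2 * ((z \<bullet> z) * \<kappa> z))"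
    proof (rule integral_mono)
      show "integrable lborel (\<lambda>z. \<kappa> z * b (z + t *\<^sub>R z))"
        using kb[of ?l] by (simp add: scaleR_add_left)
      show "\<kappa> z * b (z + t *\<^sub>R z) \<le> \<kappa> z * b z + t * (\<kappa> z * D z) + L * t\<^sup>2 * ((z \<bullet> z) * \<kappa> z)" for z
      proof -
        have "b (z + t *\<^sub>R z) \<le> b z + t * D z + L * t\<^sup>2 * (z \<bullet> z)"
          using taylor[OF t, of z] by linarith
        from mult_left_mono[OF this k_nonneg[of "z \<bullet> z"]] show ?thesis
          by (simp add: algebra_simps)
      qed
    qed (use kb1 D rho_integrable in simp)
    also have "\<dots> = (LBINT z. \<kappa> z * b z) + t * ?K + L * t\<^sup>2 * DIM('a)"
      using kb1 D rho_integrable rho_mass by simp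
    finally have "t * (\<nu> / ?l * ?I) \<le> t * (?K + L * t * DIM('a))"
      by (simp add: algebra_simps power2_eq_square)
    then show ?thesis by (rule mult_left_le_imp_le[OF _ t])
  qed
  show "\<nu> * ?I \<le> ?K"
  proof (rule tendsto_le)
    show "((\<lambda>t. ?K + L * t * DIM('a)) \<longlongrightarrow> ?K) (at_right 0)"
      by (auto intro!: tendsto_eq_intros)
    show "((\<lambda>t. \<nu> / (1 + t) * ?I) \<longlongrightarrow> \<nu> * ?I) (at_right 0)"
      by (auto intro!: tendsto_eq_intros)
    show "\<forall>\<^sub>F t in at_right 0. \<nu> / (1 + t) * ?I \<le> ?K + L * t * DIM('a)"
      using main by (auto simp: eventually_at_filter)
  qed simp
qed

end

section \<open>The energy estimate\<close>

context coercive_kernel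
begin

text \<open>The \<open>8\<close> is the \<open>2\<close> of the energy bound times the
  \<open>4\<close> of averaging over pairs of points; \<open>2 ^ DIM('a)\<close> comes from a ball
  of half the radius; \<open>1 / \<eta> + 2\<close> bounds \<open>n * \<epsilon>\<close> when a step
  of length at most \<open>1\<close> is cut into \<open>n\<close> pieces.\<close>

definition modulus_const :: real where
  "modulus_const = 8 * 2 ^ DIM('a) / (unit_ball_vol (real DIM('a)) * c * \<nu>) * (1 / \<eta> + 2) powr (1 - \<sigma>)"

lemma modulus_const_pos: "0 < modulus_const"
proof -
  have "0 < 1 / \<eta> + 2" using pos by (simp add: add_pos_pos)
  then show ?thesis
    unfolding modulus_const_def using pos by (intro mult_pos_pos divide_pos_pos) auto
qed

context
  fixes v :: "'a \<Rightarrow> real" and \<epsilon> C \<Lambda> :: real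
  assumes v: "smooth v" "unit_density v" and eps: "0 < \<epsilon>" "\<epsilon> \<le> 1" and C: "0 \<le> C" and \<Lambda>: "0 < \<Lambda>"
    and ctrl: "controlled \<epsilon> C v" and slope: "\<And>x h. \<bar>fd v x h\<bar> \<le> \<Lambda> * norm h"
begin

lemmas vb = densityD(2)[OF v(2)]

text \<open>The autocorrelation \<open>h \<mapsto> \<integral> v x v (x + h) dx\<close>, written as
  a weighted average so that smoothness and derivatives come from the lemmas on
  \<open>avg\<close>.\<close>

definition autocorr :: "'a \<Rightarrow> real" where "autocorr = avg lborel v (\<lambda>x. x) v"

lemma v_integrable: "integrable lborel v"
  by (rule integrable_continuous_bsupp[OF smooth_continuous_on[OF v(1)] vb])

lemma autocorr_smooth: "smooth autocorr" "bsupp autocorr"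
proof -
  show "smooth autocorr"
    unfolding autocorr_def by (rule smooth_avg[OF v_integrable _ v(1) vb]) simp
  obtain R where "\<And>x. v x \<noteq> 0 \<Longrightarrow> norm x \<le> R"
    using vb unfolding bsupp_def by blast
  then show "bsupp autocorr"
    unfolding autocorr_def by (intro bsupp_avg[OF vb])
qed

lemma fd_autocorr: "fd autocorr h z = (LBINT x. v x * fd v (h + x) z)"
  unfolding autocorr_def using fd_avg[OF v_integrable _ v(1) vb, of "\<lambda>x. x" h z]
  by (simp add: avg_def)

text \<open>The integrand is half the derivative of \<open>v * v\<close>, and derivatives of
  functions of bounded support integrate to zero. Hence the autocorrelation deviates only
  quadratically from its value at the origin.\<close>

lemma fd_autocorr_zero: "fd autocorr 0 z = 0"
proof -
  have d: "((\<lambda>x. v x * v x) has_derivative (\<lambda>h. v x * fd v x h + fd v x h * v x)) (at x)" for x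
    by (intro has_derivative_mult smooth_has_derivative v(1))
  have "bsupp (\<lambda>x. v x * v x)"
    using vb unfolding bsupp_def by simp
  moreover have "continuous_on UNIV (\<lambda>x. v x * fd v x z + fd v x z * v x)"
    by (intro continuous_intros smooth_continuous_on smooth_fd v(1))
  ultimately have "(LBINT x. v x * fd v x z + fd v x z * v x) = 0"
    by (intro integral_directional_derivative_zero(1)[OF d])
  then have "(LBINT x. 2 * (v x * fd v x z)) = 0"
    by (simp add: mult.commute)
  then show ?thesis by (simp add: fd_autocorr)
qed

lemma sqdiff_eq_autocorr: "sqdiff v h = 2 * (autocorr 0 - autocorr h)"
proof -
  have [measurable]: "v \<in> borel_measurable borel" by (rule smooth_borel[OF v(1)])
  have b: "\<bar>v x\<bar> \<le> 1" for x using densityD(3,4)[OF v(2), of x] by simp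
  have i: "integrable lborel (\<lambda>x. v x * v (x + a))" for a
    using integrable_weighted[OF v_integrable, of "\<lambda>x. v (x + a)" 1] b by simp
  have i2: "integrable lborel (\<lambda>x. v (x + a) * v (x + a))" for a
    using lborel_integral_translate(2)[of "\<lambda>x. v x * v x" a] i[of 0] by simp
  have "sqdiff v h = (LBINT x. v (x + h) * v (x + h) + v x * v (x + 0) - 2 * (v x * v (x + h)))"
    unfolding sqdiff_def by (simp add: power2_eq_square algebra_simps)
  also have "\<dots> = (LBINT x. v (x + h) * v (x + h)) + (LBINT x. v x * v (x + 0)) - 2 * (LBINT x. v x * v (x + h))"
    using i[of 0] i[of h] i2[of h] by simp
  also have "(LBINT x. v (x + h) * v (x + h)) = (LBINT x. v x * v (x + 0))"
    using lborel_integral_translate(1)[of "\<lambda>x. v x * v x" h] by simp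
  finally show ?thesis
    by (simp add: autocorr_def avg_def add.commute)
qed

text \<open>Testing the perimeter bound with the normalized field \<open>- \<nabla>v / \<Lambda>\<close>.\<close>

lemma energy_flux:
  shows "(LBINT z. \<kappa> z * (- \<epsilon> * fd autocorr (\<epsilon> *\<^sub>R z) z)) \<le> \<epsilon>\<^sup>2 * C * \<Lambda>"
    and "integrable lborel (\<lambda>z. \<kappa> z * (- \<epsilon> * fd autocorr (\<epsilon> *\<^sub>R z) z))"
proof -
  have [measurable]: "v \<in> borel_measurable borel" by (rule smooth_borel[OF v(1)])
  have g: "smooth (grad v)" "bsupp (grad v)"
    using smooth_grad[OF v(1)] bsupp_grad[OF vb] .
  have [measurable]: "grad v \<in> borel_measurable borel" by (rule smooth_borel[OF g(1)])
  define p where "p x = (- 1 / \<Lambda>) *\<^sub>R grad v x" for x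
  have p: "smooth p" "bsupp p"
    using g(2) smooth_scaleR[OF g(1), of "- 1 / \<Lambda>"] unfolding p_def[abs_def] bsupp_def by auto
  have "p \<in> test_fields"
    using p norm_grad_le[OF v(1) slope] \<Lambda> by (intro test_fieldsI) (auto simp: p_def)
  then have le: "(LBINT x. v x * ndiv \<epsilon> p x) \<le> C"
    using ctrl unfolding controlled_def by blast
  let ?F = "\<lambda>x z. v x * (\<kappa> z * ((grad v (x + \<epsilon> *\<^sub>R z) - grad v x) \<bullet> z))"
  obtain B where B: "B > 0" "\<And>x h. norm (fd (grad v) x h) \<le> B * norm h"
    using smooth_fd_bound[OF g] by blast
  \<comment> \<open>The Lipschitz bound of the gradient supplies a second factor
    \<open>norm z\<close>, so that the integrable weight \<open>(z \<bullet> z) * \<kappa> z\<close>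
    justifies Fubini.\<close>
  have "\<bar>?F x z\<bar> \<le> \<bar>v x\<bar> * (B * \<epsilon> * ((z \<bullet> z) * \<kappa> z))" for x z
  proof -
    have "\<bar>(grad v (x + \<epsilon> *\<^sub>R z) - grad v x) \<bullet> z\<bar> \<le> (B * norm (\<epsilon> *\<^sub>R z)) * norm z"
      using fd_bound_imp_lipschitz[OF g(1) B(2), of "x + \<epsilon> *\<^sub>R z" x]
      by (intro order.trans[OF Cauchy_Schwarz_ineq2] mult_right_mono) auto
    also have "\<dots> = B * \<epsilon> * (z \<bullet> z)"
      using eps by (simp add: dot_square_norm power2_eq_square)
    finally have "\<kappa> z * \<bar>(grad v (x + \<epsilon> *\<^sub>R z) - grad v x) \<bullet> z\<bar> \<le> \<kappa> z * (B * \<epsilon> * (z \<bullet> z))"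
      by (rule mult_left_mono[OF _ k_nonneg])
    from mult_left_mono[OF this abs_ge_zero[of "v x"]] show ?thesis
      by (simp add: abs_mult k_nonneg mult_ac)
  qed
  note fub = fubini_dominated[OF _ _ _ this]
  have m: "(\<lambda>(x, z). ?F x z) \<in> borel_measurable (lborel \<Otimes>\<^sub>M lborel)"
    by measurable
  have i1: "integrable lborel (\<lambda>x. \<bar>v x\<bar>)" using v_integrable by simp
  have i2: "integrable lborel (\<lambda>z::'a. B * \<epsilon> * ((z \<bullet> z) * \<kappa> z))" using rho_integrable by simp
  \<comment> \<open>Integrating in \<open>x\<close> first leaves the derivative of the
    autocorrelation at \<open>\<epsilon> z\<close> minus the one at \<open>0\<close>, which
    vanishes.\<close>
  have inner: "(LBINT x. ?F x z) = \<kappa> z * fd autocorr (\<epsilon> *\<^sub>R z) z" for z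
  proof -
    have iv: "integrable lborel (\<lambda>x. v x * fd v (x + a) z)" for a
    proof -
      have "\<bar>fd v (x + a) z\<bar> \<le> \<Lambda> * norm z" for x using slope .
      from integrable_weighted[OF v_integrable _ this[folded real_norm_def]] show ?thesis
        using measurable_compose[OF _ smooth_borel[OF smooth_fd[OF v(1)]], of "\<lambda>x. x + a" lborel z] by simp
    qed
    have "(LBINT x. ?F x z) = (LBINT x. \<kappa> z * (v x * fd v (x + \<epsilon> *\<^sub>R z) z - v x * fd v (x + 0) z))"
      by (simp add: inner_diff_left grad_inner[OF v(1)] algebra_simps)
    also have "\<dots> = \<kappa> z * ((LBINT x. v x * fd v (x + \<epsilon> *\<^sub>R z) z) - (LBINT x. v x * fd v (x + 0) z))"
      using iv by (simp del: add_0_right)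
    also have "\<dots> = \<kappa> z * (fd autocorr (\<epsilon> *\<^sub>R z) z - fd autocorr 0 z)"
      by (simp add: fd_autocorr add.commute)
    finally show ?thesis by (simp add: fd_autocorr_zero)
  qed
  have "integrable lborel (\<lambda>z. \<kappa> z * fd autocorr (\<epsilon> *\<^sub>R z) z)"
    using fub(2)[OF m i1 i2] unfolding inner .
  from integrable_mult_right[OF this, of "- \<epsilon>"]
  show "integrable lborel (\<lambda>z. \<kappa> z * (- \<epsilon> * fd autocorr (\<epsilon> *\<^sub>R z) z))"
    by (simp add: mult_ac)
  have "ndiv \<epsilon> p x
      = (- 1 / (\<Lambda> * \<epsilon>)) * (LBINT z. \<kappa> z * ((grad v (x + \<epsilon> *\<^sub>R z) - grad v x) \<bullet> z))" for x
  proof -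
    have "ndiv \<epsilon> p x
      = (LBINT z. (- 1 / (\<Lambda> * \<epsilon>)) * (\<kappa> z * ((grad v (x + \<epsilon> *\<^sub>R z) - grad v x) \<bullet> z)))"
      using \<Lambda> eps unfolding nonlocal_div_eq_lborel[OF eps(1) p] p_def scaleR_diff_right[symmetric] inner_scaleR_left
      by (intro Bochner_Integration.integral_cong) auto
    then show ?thesis by simp
  qed
  then have "(LBINT x. v x * ndiv \<epsilon> p x)
      = (- 1 / (\<Lambda> * \<epsilon>)) * (LBINT x. LBINT z. ?F x z)"
    by (simp add: mult.left_commute[of "v _"] del: integral_mult_right_zero flip: integral_mult_right_zero)
  also have "(LBINT x. LBINT z. ?F x z) = (LBINT z. \<kappa> z * fd autocorr (\<epsilon> *\<^sub>R z) z)"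
    using fub(1)[OF m i1 i2] unfolding inner .
  finally have "(- 1 / (\<Lambda> * \<epsilon>)) * (LBINT z. \<kappa> z * fd autocorr (\<epsilon> *\<^sub>R z) z) \<le> C"
    using le by simp
  then have "- (LBINT z. \<kappa> z * fd autocorr (\<epsilon> *\<^sub>R z) z) \<le> C * (\<Lambda> * \<epsilon>)"
    using \<Lambda> eps by (simp add: field_simps)
  from mult_left_mono[OF this, of \<epsilon>]
  have "- \<epsilon> * (LBINT z. \<kappa> z * fd autocorr (\<epsilon> *\<^sub>R z) z) \<le> \<epsilon>\<^sup>2 * C * \<Lambda>"
    using eps by (simp add: power2_eq_square mult_ac)
  then show "(LBINT z. \<kappa> z * (- \<epsilon> * fd autocorr (\<epsilon> *\<^sub>R z) z)) \<le> \<epsilon>\<^sup>2 * C * \<Lambda>"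
    by (simp add: mult.left_commute[of "k _"])
qed

text \<open>\<open>b\<close> is half the mean square increment. Its derivative along rays is what
  \<open>energy_flux\<close> bounds, and \<open>radial_derivative_bound\<close> recovers
  \<open>b\<close> itself on the ball of radius \<open>\<eta>\<close>.\<close>

lemma energy_bound:
  shows "\<nu> * (LBINT z. indicator (ball 0 \<eta>) z * (\<kappa> z * sqdiff v (\<epsilon> *\<^sub>R z))) \<le> 2 * (\<epsilon>\<^sup>2 * C * \<Lambda>)"
    and "integrable lborel (\<lambda>z. \<kappa> z * sqdiff v (\<epsilon> *\<^sub>R z))"
proof -
  obtain L where L: "L > 0" "\<And>x h. norm (autocorr (x + h) - autocorr x - fd autocorr x h) \<le> L * (norm h)\<^sup>2"
    using smooth_taylor[OF autocorr_smooth] by blast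
  define b where "b z = autocorr 0 - autocorr (\<epsilon> *\<^sub>R z)" for z
  have sb: "sqdiff v (\<epsilon> *\<^sub>R z) = 2 * b z" for z
    by (simp add: b_def sqdiff_eq_autocorr)
  have [measurable]: "autocorr \<in> borel_measurable borel" by (rule smooth_borel[OF autocorr_smooth(1)])
  have bm: "b \<in> borel_measurable borel" unfolding b_def by measurable
  have b0: "0 \<le> b z" for z
    using sqdiff_nonneg[of v "\<epsilon> *\<^sub>R z"] by (simp add: sb)
  have bq: "b z \<le> L * \<epsilon>\<^sup>2 * (z \<bullet> z)" for z
    using L(2)[of 0 "\<epsilon> *\<^sub>R z"] eps
    by (simp add: b_def fd_autocorr_zero power_mult_distrib dot_square_norm abs_if mult_ac split: if_splits)
  interpret A: bounded_linear "fd autocorr x" for x by (rule smooth_linear_fd[OF autocorr_smooth(1)])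
  have taylor: "\<bar>b (z + t *\<^sub>R z) - b z - t * (- \<epsilon> * fd autocorr (\<epsilon> *\<^sub>R z) z)\<bar> \<le> L * \<epsilon>\<^sup>2 * t\<^sup>2 * (z \<bullet> z)" if "0 < t" for z t
  proof -
    have "b (z + t *\<^sub>R z) - b z - t * (- \<epsilon> * fd autocorr (\<epsilon> *\<^sub>R z) z)
        = - (autocorr (\<epsilon> *\<^sub>R z + (t * \<epsilon>) *\<^sub>R z) - autocorr (\<epsilon> *\<^sub>R z) - fd autocorr (\<epsilon> *\<^sub>R z) ((t * \<epsilon>) *\<^sub>R z))"
      by (simp add: b_def A.scaleR scaleR_add_right mult_ac)
    then show ?thesis
      using L(2)[of "\<epsilon> *\<^sub>R z" "(t * \<epsilon>) *\<^sub>R z"] by (simp add: power_mult_distrib dot_square_norm mult_ac)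
  qed
  note rad = radial_derivative_bound[OF bm b0 bq energy_flux(2) taylor]
  show "integrable lborel (\<lambda>z. \<kappa> z * sqdiff v (\<epsilon> *\<^sub>R z))"
    using integrable_mult_right[OF rad(2), of 2] by (simp add: sb mult_ac)
  have "(LBINT z. indicator (ball 0 \<eta>) z * (\<kappa> z * sqdiff v (\<epsilon> *\<^sub>R z)))
      = 2 * (LBINT z. indicator (ball 0 \<eta>) z * (\<kappa> z * b z))"
    by (simp add: sb mult.left_commute[of _ 2])
  then show "\<nu> * (LBINT z. indicator (ball 0 \<eta>) z * (\<kappa> z * sqdiff v (\<epsilon> *\<^sub>R z))) \<le> 2 * (\<epsilon>\<^sup>2 * C * \<Lambda>)"
    using rad(1) energy_flux(1) by simp
qed

text \<open>Averages over balls control single increments because increments are quasi-subadditive.\<close>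

lemma microscopic_modulus:
  assumes "norm z0 < \<eta>"
  shows "sqdiff v (\<epsilon> *\<^sub>R z0) \<le> 8 * 2 ^ DIM('a) / (unit_ball_vol (real DIM('a)) * c * \<nu>)
      * norm z0 powr (1 + \<sigma>) * (\<epsilon>\<^sup>2 * C * \<Lambda>)"
proof (cases "z0 = 0")
  case True
  then show ?thesis by simp
next
  case False
  let ?V = "unit_ball_vol (real DIM('a))"
  define t where "t = norm z0"
  have t: "0 < t" "t < \<eta>" using False assms by (auto simp: t_def)
  define q where "q = real DIM('a) + 1 + \<sigma>"
  define e where "e z = sqdiff v (\<epsilon> *\<^sub>R z)" for z
  have e0: "0 \<le> e z" for z by (simp add: e_def sqdiff_nonneg)
  have [measurable]: "e \<in> borel_measurable borel"
    unfolding e_def[abs_def] by (rule measurable_compose[OF _ sqdiff_borel[OF v(2)]]) simp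
  define g where "g z = indicator (ball 0 t) z * e z" for z
  have gm [measurable]: "g \<in> borel_measurable borel"
    unfolding g_def[abs_def] by (intro borel_measurable_times borel_measurable_indicator) auto
  have ie: "integrable lborel (\<lambda>z. indicator (ball 0 \<eta>) z * (\<kappa> z * e z))"
    using integrable_mult_indicator[OF _ energy_bound(2), of "ball 0 \<eta>"] by (simp add: e_def)
  \<comment> \<open>On the ball of radius \<open>t < \<eta>\<close> the kernel is at least
    \<open>c * t powr (- q)\<close>, so it can be traded for a constant weight.\<close>
  have gle: "g z \<le> t powr q / c * (indicator (ball 0 \<eta>) z * (\<kappa> z * e z))" for z
  proof (cases "z \<in> ball 0 t \<and> z \<noteq> 0")
    case True
    then have z: "0 < norm z" "norm z < t" by auto
    have "c * t powr - q \<le> c * norm z powr - q"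
      using z pos by (intro mult_left_mono powr_mono2') (auto simp: q_def)
    also have "\<dots> \<le> \<kappa> z"
      using k_lower[of "norm z"] z t by (simp add: q_def dot_square_norm)
    finally have "e z \<le> t powr q / c * (\<kappa> z * e z)"
      using mult_right_mono[of "c * t powr - q" "\<kappa> z" "e z"] e0[of z] pos(5) t
      by (simp add: powr_minus field_simps)
    then show ?thesis using True t by (simp add: g_def)
  next
    case False
    then have "g z = 0" by (auto simp: g_def e_def)
    moreover have "0 \<le> t powr q / c * (indicator (ball 0 \<eta>) z * (\<kappa> z * e z))"
      using k_nonneg[of "z \<bullet> z"] e0[of z] pos(5) by simp
    ultimately show ?thesis by simp
  qed
  have g0: "0 \<le> g z" for z using e0 by (simp add: g_def)
  have ig: "integrable lborel g"
  proof (rule Bochner_Integration.integrable_bound)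
    show "integrable lborel (\<lambda>z. t powr q / c * (indicator (ball 0 \<eta>) z * (\<kappa> z * e z)))"
      using ie by simp
    show "AE z in lborel. norm (g z) \<le> norm (t powr q / c * (indicator (ball 0 \<eta>) z * (\<kappa> z * e z)))"
      using g0 order.trans[OF gle abs_ge_self] by (intro AE_I2) simp
  qed simp
  have "(LBINT z. g z) \<le> t powr q / c * (LBINT z. indicator (ball 0 \<eta>) z * (\<kappa> z * e z))"
    using integral_mono[OF ig _ gle] ie by simp
  also have "\<dots> \<le> t powr q / c * (2 * (\<epsilon>\<^sup>2 * C * \<Lambda>) / \<nu>)"
    using energy_bound(1) pos by (intro mult_left_mono) (auto simp: e_def field_simps)
  finally have gint: "(LBINT z. g z) \<le> t powr q / c * (2 * (\<epsilon>\<^sup>2 * C * \<Lambda>) / \<nu>)" .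
  have gp: "(LBINT y. g (z0 /\<^sub>R 2 + y)) = (LBINT z. g z)" "integrable lborel (\<lambda>y. g (z0 /\<^sub>R 2 + y))"
    using lborel_integral_affine[OF gm, of 1 "z0 /\<^sub>R 2"] ig by simp_all
  have gn: "(LBINT y. g (z0 /\<^sub>R 2 - y)) = (LBINT z. g z)" "integrable lborel (\<lambda>y. g (z0 /\<^sub>R 2 - y))"
    using lborel_integral_affine[OF gm, of "- 1" "z0 /\<^sub>R 2"] ig by simp_all
  have "e z0 * (?V * (t / 2) ^ DIM('a)) = (LBINT y. e z0 * indicator (ball (0::'a) (t / 2)) y)"
    using t by (simp add: content_ball)
  \<comment> \<open>For \<open>y\<close> in the ball of radius \<open>t / 2\<close>, the points
    \<open>z0 / 2 + y\<close> and \<open>z0 / 2 - y\<close> add up to \<open>z0\<close> and both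
    stay in the ball of radius \<open>t\<close>, where \<open>g\<close> is the increment.\<close>
  also have "\<dots> \<le> (LBINT y. 2 * g (z0 /\<^sub>R 2 + y) + 2 * g (z0 /\<^sub>R 2 - y))"
  proof (rule integral_mono)
    show "integrable lborel (\<lambda>y. e z0 * indicator (ball (0::'a) (t / 2)) y)"
      by (intro integrable_mult_right integrable_indicator_bounded) auto
    show "e z0 * indicator (ball 0 (t / 2)) y \<le> 2 * g (z0 /\<^sub>R 2 + y) + 2 * g (z0 /\<^sub>R 2 - y)" for y
    proof (cases "y \<in> ball 0 (t / 2)")
      case True
      then have "norm (z0 /\<^sub>R 2 + y) < t" "norm (z0 /\<^sub>R 2 - y) < t"
        using norm_triangle_ineq[of "z0 /\<^sub>R 2" y] norm_triangle_ineq4[of "z0 /\<^sub>R 2" y] by (auto simp: t_def)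
      moreover have "e z0 \<le> 2 * e (z0 /\<^sub>R 2 + y) + 2 * e (z0 /\<^sub>R 2 - y)"
      proof -
        have "\<epsilon> *\<^sub>R (z0 /\<^sub>R 2 + y) + \<epsilon> *\<^sub>R (z0 /\<^sub>R 2 - y) = \<epsilon> *\<^sub>R z0"
          by (simp add: scaleR_add_right[symmetric] scaleR_add_left[symmetric])
        then show ?thesis
          using sqdiff_add[OF v(2), of "\<epsilon> *\<^sub>R (z0 /\<^sub>R 2 + y)" "\<epsilon> *\<^sub>R (z0 /\<^sub>R 2 - y)"] by (simp add: e_def)
      qed
      ultimately show ?thesis using True by (simp add: g_def)
    qed (use g0 in auto)
  qed (use gp gn in auto)
  also have "\<dots> = 4 * (LBINT z. g z)"
    using gp gn by simp
  also have "\<dots> \<le> 4 * (t powr q / c * (2 * (\<epsilon>\<^sup>2 * C * \<Lambda>) / \<nu>))"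
    using gint by simp
  finally have fin: "e z0 * (?V * (t / 2) ^ DIM('a)) \<le> 4 * (t powr q / c * (2 * (\<epsilon>\<^sup>2 * C * \<Lambda>) / \<nu>))" .
  have "e z0 \<le> 4 * (t powr q / c * (2 * (\<epsilon>\<^sup>2 * C * \<Lambda>) / \<nu>)) / (?V * (t / 2) ^ DIM('a))"
  proof -
    have "0 < ?V * (t / 2) ^ DIM('a)" using t by simp
    then show ?thesis using fin by (subst pos_le_divide_eq) auto
  qed
  also have "\<dots> = 8 * 2 ^ DIM('a) / (?V * c * \<nu>) * (t powr q / t ^ DIM('a)) * (\<epsilon>\<^sup>2 * C * \<Lambda>)"
    by (simp add: power_divide field_simps)
  also have "t powr q / t ^ DIM('a) = t powr (1 + \<sigma>)"
    using t powr_realpow[of t "DIM('a)"] by (simp add: q_def powr_add)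
  finally show ?thesis by (simp add: e_def t_def)
qed

text \<open>Cut \<open>a\<close> into \<open>n\<close> equal pieces of length below
  \<open>\<epsilon> * \<eta>\<close> and apply \<open>microscopic_modulus\<close> to one:
  \<open>n\<^sup>2\<close> and \<open>\<epsilon>\<^sup>2\<close> combine into the square of
  \<open>n * \<epsilon>\<close>, which is bounded independently of
  \<open>\<epsilon>\<close>.\<close>

lemma macroscopic_modulus:
  assumes a: "norm a \<le> 1"
  shows "sqdiff v a \<le> modulus_const * C * \<Lambda> * norm a powr (1 + \<sigma>)"
proof -
  define A where "A = 8 * 2 ^ DIM('a) / (unit_ball_vol (real DIM('a)) * c * \<nu>)"
  have A: "0 \<le> A" using pos by (simp add: A_def)
  \<comment> \<open>The ceiling plus one makes the pieces strictly short enough and keeps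
    \<open>n\<close> positive even for \<open>a = 0\<close>, at the price of the summand
    \<open>2\<close> in the upper bound.\<close>
  define n where "n = Suc (nat \<lceil>norm a / (\<epsilon> * \<eta>)\<rceil>)"
  have "0 \<le> norm a / (\<epsilon> * \<eta>)" using pos eps by simp
  then have "real n = real_of_int \<lceil>norm a / (\<epsilon> * \<eta>)\<rceil> + 1"
    unfolding n_def by simp
  then have "norm a / (\<epsilon> * \<eta>) < real n" and n2: "real n \<le> norm a / (\<epsilon> * \<eta>) + 2"
    by linarith+
  moreover have npos: "0 < real n" by (simp add: n_def)
  ultimately have n1: "norm a / (real n * \<epsilon>) < \<eta>"
    using pos eps by (simp add: pos_divide_less_eq mult_ac)
  define z where "z = a /\<^sub>R (real n * \<epsilon>)"
  have nz: "norm z = norm a / (real n * \<epsilon>)"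
    using npos eps by (simp add: z_def divide_inverse mult.commute)
  have "real n * \<epsilon> \<le> norm a / \<eta> + 2 * \<epsilon>"
  proof -
    have "(norm a / (\<epsilon> * \<eta>) + 2) * \<epsilon> = norm a / \<eta> + 2 * \<epsilon>"
      using eps by (simp add: field_simps)
    then show ?thesis using mult_right_mono[OF n2, of \<epsilon>] eps by simp
  qed
  also have "\<dots> \<le> 1 / \<eta> + 2"
    using a eps pos by (intro add_mono divide_right_mono) auto
  finally have ne: "real n * \<epsilon> \<le> 1 / \<eta> + 2" .
  have "sqdiff v a = sqdiff v (real n *\<^sub>R (\<epsilon> *\<^sub>R z))"
  proof -
    have "real n * (\<epsilon> * inverse (real n * \<epsilon>)) = 1"
      using npos eps by (simp add: field_simps)
    then show ?thesis by (simp only: z_def scaleR_scaleR scaleR_one)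
  qed
  also have "\<dots> \<le> (real n)\<^sup>2 * sqdiff v (\<epsilon> *\<^sub>R z)"
    by (rule sqdiff_scale[OF v(2)])
  also have "\<dots> \<le> (real n)\<^sup>2 * (A * norm z powr (1 + \<sigma>) * (\<epsilon>\<^sup>2 * C * \<Lambda>))"
    using microscopic_modulus[of z] n1 nz unfolding A_def by (intro mult_left_mono) auto
  also have "\<dots> = A * C * \<Lambda> * ((real n * \<epsilon>)\<^sup>2 * norm z powr (1 + \<sigma>))"
    by (simp add: power_mult_distrib mult_ac)
  \<comment> \<open>The power \<open>1 + \<sigma>\<close> of \<open>n * \<epsilon>\<close> cancels
    against the denominator of \<open>norm z\<close>; the rest has the positive exponent
    \<open>1 - \<sigma>\<close>, so the upper bound for \<open>n * \<epsilon>\<close>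
    applies.\<close>
  also have "(real n * \<epsilon>)\<^sup>2 * norm z powr (1 + \<sigma>) = (real n * \<epsilon>) powr (1 - \<sigma>) * norm a powr (1 + \<sigma>)"
  proof -
    have "0 < real n * \<epsilon>" using npos eps by simp
    moreover from this have "(real n * \<epsilon>)\<^sup>2 = (real n * \<epsilon>) powr (1 - \<sigma>) * (real n * \<epsilon>) powr (1 + \<sigma>)"
      by (simp add: powr_add[symmetric])
    ultimately show ?thesis
      unfolding nz by (simp add: powr_divide)
  qed
  also have "A * C * \<Lambda> * ((real n * \<epsilon>) powr (1 - \<sigma>) * norm a powr (1 + \<sigma>))
      \<le> A * C * \<Lambda> * ((1 / \<eta> + 2) powr (1 - \<sigma>) * norm a powr (1 + \<sigma>))"
    using ne npos eps pos A C \<Lambda> by (intro mult_left_mono mult_right_mono powr_mono2) auto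
  finally show ?thesis
    by (simp add: modulus_const_def A_def mult_ac)
qed

end

end

section \<open>Mollification\<close>

locale bump =
  fixes m :: "'a::euclidean_space \<Rightarrow> real"
  assumes m_smooth: "smooth m" and m_nonneg: "\<And>x. 0 \<le> m x"
    and m_support: "\<And>x. norm x > 1 \<Longrightarrow> m x = 0" and m_mass: "(LBINT x. m x) = 1"
begin

lemma m_bsupp: "bsupp m"
  using m_support unfolding bsupp_def by (metis not_le)

lemma m_integrable: "integrable lborel m"
  by (rule integrable_continuous_bsupp[OF smooth_continuous_on[OF m_smooth] m_bsupp])

lemma m_borel [measurable]: "m \<in> borel_measurable borel"
  by (rule smooth_borel[OF m_smooth])

definition mollify :: "real \<Rightarrow> ('a \<Rightarrow> real) \<Rightarrow> 'a \<Rightarrow> real" where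
  "mollify r w x = (LBINT z. m z * w (x + r *\<^sub>R z))"

text \<open>The reflection is needed because \<open>mollify\<close> averages over
  \<open>x + r z\<close>; the summand \<open>0\<close> fits the pattern of
  \<open>smooth_affine\<close>.\<close>

definition scaled_bump :: "real \<Rightarrow> 'a \<Rightarrow> real" where
  "scaled_bump r x = m ((- 1 / r) *\<^sub>R x + 0) /\<^sub>R r ^ DIM('a)"

lemma scaled_bump_smooth: "smooth (scaled_bump r)"
  unfolding scaled_bump_def[abs_def] by (intro smooth_scaleR smooth_affine m_smooth)

lemma scaled_bump_bsupp: "r > 0 \<Longrightarrow> bsupp (scaled_bump r)"
proof -
  assume "r > 0"
  have "scaled_bump r x = 0" if "norm x > r" for x
    using that \<open>r > 0\<close> m_support[of "(- 1 / r) *\<^sub>R x"] by (simp add: scaled_bump_def field_simps)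
  then show ?thesis unfolding bsupp_def by (metis not_le)
qed

text \<open>A change of variables moves \<open>x\<close> from the rough \<open>w\<close> to the
  smooth bump, so that the lemmas on \<open>avg\<close> apply with \<open>w\<close> as
  weight.\<close>

lemma mollify_eq_avg:
  assumes "r > 0" and w: "w \<in> borel_measurable borel"
  shows "mollify r w = avg lborel w (\<lambda>y. - y) (scaled_bump r)"
proof
  fix x
  have [measurable]: "w \<in> borel_measurable borel" by (rule w)
  have "(LBINT y. w y *\<^sub>R scaled_bump r (x + - y))
      = r ^ DIM('a) * (LBINT z. w (x + r *\<^sub>R z) *\<^sub>R scaled_bump r (x + - (x + r *\<^sub>R z)))"
    using lborel_integral_affine(1)[of "\<lambda>y. w y *\<^sub>R scaled_bump r (x + - y)" r x] assms(1)
      smooth_borel[OF scaled_bump_smooth[of r]] by simp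
  also have "(\<lambda>z. w (x + r *\<^sub>R z) *\<^sub>R scaled_bump r (x + - (x + r *\<^sub>R z))) = (\<lambda>z. m z * w (x + r *\<^sub>R z) / r ^ DIM('a))"
    using assms(1) by (simp add: scaled_bump_def fun_eq_iff divide_inverse)
  finally show "mollify r w x = avg lborel w (\<lambda>y. - y) (scaled_bump r) x"
    using assms(1) by (simp add: mollify_def avg_def)
qed

context
  fixes w :: "'a \<Rightarrow> real" and r :: real
  assumes w: "unit_density w" and r: "r > 0"
begin

lemma wb [measurable]: "w \<in> borel_measurable borel"
  using densityD(1)[OF w] .

lemma w_integrable: "integrable lborel w"
  using integrable_bounded_bsupp[of w 1] densityD[OF w] by simp

lemma mollify_smooth: "smooth (mollify r w)"
  unfolding mollify_eq_avg[OF r wb]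
  by (rule smooth_avg[OF w_integrable _ scaled_bump_smooth scaled_bump_bsupp[OF r]]) simp

lemma mollify_integrand: "integrable lborel (\<lambda>z. m z * w (x + r *\<^sub>R z))"
  using integrable_weighted[OF m_integrable, of "\<lambda>z. w (x + r *\<^sub>R z)" 1] densityD(3,4)[OF w]
  by simp

lemma mollify_support:
  assumes "\<And>x. norm x > R \<Longrightarrow> w x = 0" "norm x > R + r"
  shows "mollify r w x = 0"
proof -
  have "m z * w (x + r *\<^sub>R z) = 0" for z
  proof (cases "norm z > 1")
    case True
    then show ?thesis using m_support by simp
  next
    case False
    then have "norm (r *\<^sub>R z) \<le> r" using r by simp
    moreover have "norm x \<le> norm (x + r *\<^sub>R z) + norm (r *\<^sub>R z)"
      using norm_triangle_ineq4[of "x + r *\<^sub>R z" "r *\<^sub>R z"] by simp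
    ultimately show ?thesis using assms by auto
  qed
  then show ?thesis by (simp only: mollify_def integral_zero)
qed

lemma mollify_density: "unit_density (mollify r w)"
  unfolding unit_density_def
proof (intro conjI allI)
  show "mollify r w \<in> borel_measurable borel"
    by (rule smooth_borel[OF mollify_smooth])
  obtain R where "\<And>x. norm x > R \<Longrightarrow> w x = 0"
    using bsuppE[OF densityD(2)[OF w]] by blast
  then show "bsupp (mollify r w)"
    unfolding bsupp_def using mollify_support by (metis not_le)
  show "0 \<le> mollify r w x" for x
    unfolding mollify_def using m_nonneg densityD(3)[OF w] by (intro integral_nonneg_AE) auto
  have "mollify r w x \<le> (LBINT z. m z)" for x
    unfolding mollify_def
    by (rule integral_mono[OF mollify_integrand m_integrable])
      (use m_nonneg densityD(4)[OF w] in \<open>auto intro: mult_left_le\<close>)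
  then show "mollify r w x \<le> 1" for x by (simp add: m_mass)
qed

text \<open>As \<open>w\<close> lies between \<open>0\<close> and \<open>1\<close>, the slope is at
  most the integral of the absolute derivative of the scaled bump. By scaling this is
  \<open>1 / r\<close> times that of \<open>m\<close>, whose derivative is at most
  \<open>B * norm h\<close> on the unit ball and zero outside.\<close>

lemma mollify_slope:
  assumes B: "\<And>x h. norm (fd m x h) \<le> B * norm h"
  shows "\<bar>fd (mollify r w) x h\<bar> \<le> B * unit_ball_vol DIM('a) / r * norm h"
proof -
  have fdF: "fd (scaled_bump r) u h = (- 1 / r) * fd m ((- 1 / r) *\<^sub>R u) h / r ^ DIM('a)" for u
  proof -
    have "(scaled_bump r has_derivative
        (\<lambda>v. ((- 1 / r) *\<^sub>R fd m ((- 1 / r) *\<^sub>R u + 0) v) /\<^sub>R r ^ DIM('a))) (at u)"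
      unfolding scaled_bump_def[abs_def]
      by (rule has_derivative_scaleR_right[OF has_derivative_affine[OF m_smooth]])
    then show ?thesis by (simp add: fd_eqI divide_inverse)
  qed
  have fm [measurable]: "(\<lambda>u. fd m u h) \<in> borel_measurable borel"
    by (rule smooth_borel[OF smooth_fd[OF m_smooth]])
  have Fb [measurable]: "(\<lambda>u. fd (scaled_bump r) u h) \<in> borel_measurable borel"
    by (rule smooth_borel[OF smooth_fd[OF scaled_bump_smooth]])
  have iF: "integrable lborel (\<lambda>y. w y * fd (scaled_bump r) (x - y) h)"
    using integrable_avg[OF w_integrable _ smooth_fd[OF scaled_bump_smooth] bsupp_fd[OF scaled_bump_bsupp[OF r]],
        of "\<lambda>y. - y" x h] by simp
  have m0: "fd m z h = 0" if "z \<notin> cball 0 1" for z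
    using fd_zero_outside[of 1 m z] m_support that by simp
  let ?G = "\<lambda>z. \<bar>fd m z h\<bar>"
  have iG: "integrable lborel ?G"
    using integrable_continuous_bsupp[OF smooth_continuous_on[OF smooth_fd[OF m_smooth]] bsupp_fd[OF m_bsupp]]
    by simp
  have G: "(LBINT z. ?G z) \<le> B * unit_ball_vol DIM('a) * norm h"
  proof -
    have "(LBINT z. ?G z) \<le> (LBINT z. B * norm h * indicator (cball (0::'a) 1) z)"
    proof (rule integral_mono[OF iG])
      show "integrable lborel (\<lambda>z. B * norm h * indicator (cball (0::'a) 1) z)"
        using integrable_indicator_bounded[of "cball (0::'a) 1"] by simp
      show "?G z \<le> B * norm h * indicator (cball 0 1) z" for z
        using B[of z h] m0[of z] by (cases "z \<in> cball 0 1") auto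
    qed
    also have "\<dots> = B * unit_ball_vol DIM('a) * norm h"
      by (simp add: content_cball)
    finally show ?thesis .
  qed
  have scaled: "integrable lborel (\<lambda>y. \<bar>fd (scaled_bump r) (x - y) h\<bar>)"
    "(LBINT y. \<bar>fd (scaled_bump r) (x - y) h\<bar>) = (LBINT z. ?G z) / r"
  proof -
    have *: "(\<lambda>z. \<bar>fd (scaled_bump r) (x - (x + r *\<^sub>R z)) h\<bar>) = (\<lambda>z. ?G z / (r * r ^ DIM('a)))"
      using r by (simp add: fdF fun_eq_iff abs_mult)
    have "(\<lambda>y. \<bar>fd (scaled_bump r) (x - y) h\<bar>) \<in> borel_measurable borel" by measurable
    from lborel_integral_affine[OF this, of r x] r iG
    show "integrable lborel (\<lambda>y. \<bar>fd (scaled_bump r) (x - y) h\<bar>)"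
      "(LBINT y. \<bar>fd (scaled_bump r) (x - y) h\<bar>) = (LBINT z. ?G z) / r"
      unfolding * by simp_all
  qed
  have "fd (mollify r w) x h = (LBINT y. w y * fd (scaled_bump r) (x - y) h)"
    unfolding mollify_eq_avg[OF r wb]
    using fd_avg[OF w_integrable _ scaled_bump_smooth scaled_bump_bsupp[OF r], of "\<lambda>y. - y" x h]
    by (simp add: avg_def)
  also have "\<bar>\<dots>\<bar> \<le> (LBINT y. \<bar>fd (scaled_bump r) (x - y) h\<bar>)"
    using densityD(3,4)[OF w]
    by (intro integral_abs_bound_integral[OF iF scaled(1)]) (auto simp: abs_mult intro!: mult_left_le_one_le)
  also have "\<dots> \<le> B * unit_ball_vol DIM('a) * norm h / r"
    unfolding scaled(2) using G r by (intro divide_right_mono) auto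
  finally show ?thesis by simp
qed

text \<open>Jensen's inequality for the probability density \<open>m\<close>, obtained from the
  nonnegative variance of \<open>w (x + r z) - w x\<close>.\<close>

lemma mollify_sq_le:
  "(mollify r w x - w x)\<^sup>2 \<le> (LBINT z. m z * (w (x + r *\<^sub>R z) - w x)\<^sup>2)"
proof -
  let ?f = "\<lambda>z. w (x + r *\<^sub>R z) - w x" and ?c = "mollify r w x - w x"
  have i1: "integrable lborel (\<lambda>z. m z * ?f z)"
    using mollify_integrand m_integrable by (simp add: right_diff_distrib)
  have c: "?c = (LBINT z. m z * ?f z)"
    using mollify_integrand m_integrable m_mass by (simp add: mollify_def right_diff_distrib)
  have i2: "integrable lborel (\<lambda>z. m z * (?f z)\<^sup>2)"
  proof -
    have "norm ((?f z)\<^sup>2) \<le> 1" for z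
      using densityD(3,4)[OF w, of "x + r *\<^sub>R z"] densityD(3,4)[OF w, of x]
      by (simp add: abs_square_le_1 abs_if)
    from integrable_weighted[OF m_integrable _ this] show ?thesis by simp
  qed
  have "0 \<le> (LBINT z. m z * (?f z - ?c)\<^sup>2)"
    using m_nonneg by (intro integral_nonneg_AE) auto
  also have "\<dots> = (LBINT z. m z * (?f z)\<^sup>2 - 2 * ?c * (m z * ?f z) + ?c\<^sup>2 * m z)"
    by (intro Bochner_Integration.integral_cong) (auto simp: power2_eq_square algebra_simps)
  also have "\<dots> = (LBINT z. m z * (?f z)\<^sup>2) - 2 * ?c * (LBINT z. m z * ?f z) + ?c\<^sup>2 * 1"
    using i1 i2 m_integrable m_mass by simp
  also have "\<dots> = (LBINT z. m z * (?f z)\<^sup>2) - ?c\<^sup>2"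
    by (simp only: c[symmetric]) (simp add: power2_eq_square)
  finally show ?thesis by simp
qed

text \<open>By Jensen and Fubini the left side is bounded by an average of \<open>sqdiff w a\<close>
  over \<open>norm a \<le> r\<close>.\<close>

lemma mollify_dist:
  assumes S: "\<And>a. norm a \<le> r \<Longrightarrow> sqdiff w a \<le> S"
  shows "(LBINT x. (mollify r w x - w x)\<^sup>2) \<le> S"
proof -
  obtain R where R: "\<And>x. norm x > R \<Longrightarrow> w x = 0"
    using bsuppE[OF densityD(2)[OF w]] by blast
  let ?F = "\<lambda>x z. m z * (w (x + r *\<^sub>R z) - w x)\<^sup>2"
  have le: "\<bar>?F x z\<bar> \<le> indicator (cball 0 (R + r)) x * m z" for x z
  proof (cases "norm z \<le> 1 \<and> norm x > R + r")
    case True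
    then have "norm (r *\<^sub>R z) \<le> r" using r by simp
    moreover have "norm x \<le> norm (x + r *\<^sub>R z) + norm (r *\<^sub>R z)"
      using norm_triangle_ineq4[of "x + r *\<^sub>R z" "r *\<^sub>R z"] by simp
    ultimately have "R < norm (x + r *\<^sub>R z)" "R < norm x"
      using True r by linarith+
    then have "w (x + r *\<^sub>R z) = 0" "w x = 0"
      using R by auto
    then show ?thesis using m_nonneg by simp
  next
    case False
    have "(w (x + r *\<^sub>R z) - w x)\<^sup>2 \<le> 1"
      using densityD(3,4)[OF w, of "x + r *\<^sub>R z"] densityD(3,4)[OF w, of x]
      by (simp add: abs_square_le_1 abs_if)
    then have "m z * (w (x + r *\<^sub>R z) - w x)\<^sup>2 \<le> m z"
      using m_nonneg[of z] by (simp add: mult_left_le)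
    then show ?thesis using False m_support[of z] m_nonneg[of z]
      by (cases "norm z > 1") (auto simp: indicator_def)
  qed
  have meas: "(\<lambda>(x, z). ?F x z) \<in> borel_measurable (lborel \<Otimes>\<^sub>M lborel)"
    by measurable
  note fub = fubini_dominated[OF meas integrable_indicator_bounded m_integrable le]
  have "(LBINT x. (mollify r w x - w x)\<^sup>2) \<le> (LBINT x. LBINT z. ?F x z)"
  proof (rule integral_mono[OF _ _ mollify_sq_le])
    show "integrable lborel (\<lambda>x. (mollify r w x - w x)\<^sup>2)"
      using density_diff_sq_integrable[OF mollify_density w, of 0 0] by simp
    \<comment> \<open>\<open>fubini_dominated\<close> gives integrability in its second variable;
      swapping the variables gives it in \<open>x\<close>.\<close>
    have "(\<lambda>(z, x). ?F x z) \<in> borel_measurable (lborel \<Otimes>\<^sub>M lborel)" by measurable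
    from fubini_dominated(2)[OF this m_integrable integrable_indicator_bounded[of "cball 0 (R + r)"]]
    show "integrable lborel (\<lambda>x. LBINT z. ?F x z)"
      using le by (simp add: mult.commute)
  qed
  also have "\<dots> = (LBINT z. LBINT x. ?F x z)"
    by (rule fub) auto
  also have "\<dots> = (LBINT z. m z * sqdiff w (r *\<^sub>R z))"
    by (simp add: sqdiff_def)
  also have "\<dots> \<le> (LBINT z. m z * S)"
  proof (rule integral_mono)
    have "integrable lborel (\<lambda>z. LBINT x. ?F x z)" by (rule fub) auto
    then show "integrable lborel (\<lambda>z. m z * sqdiff w (r *\<^sub>R z))"
      by (simp add: sqdiff_def)
    show "m z * sqdiff w (r *\<^sub>R z) \<le> m z * S" for z
    proof (cases "norm z > 1")
      case False
      then show ?thesis using S[of "r *\<^sub>R z"] r m_nonneg[of z] by (intro mult_left_mono) auto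
    qed (use m_support in simp)
  qed (use m_integrable in simp)
  finally show ?thesis using m_mass by simp
qed

end

end

locale coercive_bump = coercive_kernel \<rho> k \<nu> \<eta> \<sigma> c + bump m
  for \<rho> :: "'a::euclidean_space \<Rightarrow> real" and k :: "real \<Rightarrow> real" and \<nu> \<eta> \<sigma> c :: real and m :: "'a \<Rightarrow> real"
begin

lemma nonlocal_div_translate:
  assumes "0 < \<epsilon>" "smooth p" "bsupp p"
  shows "ndiv \<epsilon> (\<lambda>x. p (x + a)) x = ndiv \<epsilon> p (x + a)"
proof -
  have "smooth (\<lambda>x. p (x + a))" using smooth_affine[OF assms(2), of 1 a] by simp
  from nonlocal_div_eq_lborel[OF assms(1) this bsupp_translate[OF assms(3)]]
    nonlocal_div_eq_lborel[OF assms]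
  show ?thesis by (simp add: add_ac)
qed

text \<open>Translations commute with the nonlocal divergence and preserve test fields, so every
  translate of \<open>w\<close> satisfies the bound; averaging with the density \<open>m\<close>
  keeps \<open>C\<close>.\<close>

lemma controlled_mollify:
  assumes eps: "0 < \<epsilon>" and w: "unit_density w" and r: "r > 0" and ctrl: "controlled \<epsilon> C w"
  shows "controlled \<epsilon> C (mollify r w)"
  unfolding controlled_def
proof
  fix p :: "'a \<Rightarrow> 'a" assume "p \<in> test_fields"
  note p = test_fieldsD[OF this]
  have [measurable]: "w \<in> borel_measurable borel" using densityD(1)[OF w] .
  let ?d = "ndiv \<epsilon> p"
  note d = nonlocal_div_smooth[OF eps p(1,2)]
  have [measurable]: "?d \<in> borel_measurable borel" by (rule smooth_borel[OF d(1)])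
  have id: "integrable lborel (\<lambda>x. \<bar>?d x\<bar>)"
    using integrable_continuous_bsupp[OF smooth_continuous_on[OF d(1)] d(2)] by simp
  let ?F = "\<lambda>x z. m z * (w (x + r *\<^sub>R z) * ?d x)"
  have meas: "(\<lambda>(x, z). ?F x z) \<in> borel_measurable (lborel \<Otimes>\<^sub>M lborel)"
    by measurable
  have le: "\<bar>?F x z\<bar> \<le> \<bar>?d x\<bar> * m z" for x z
  proof -
    have "\<bar>?F x z\<bar> = m z * (w (x + r *\<^sub>R z) * \<bar>?d x\<bar>)"
      using m_nonneg[of z] densityD(3)[OF w, of "x + r *\<^sub>R z"] by (simp add: abs_mult)
    also have "\<dots> \<le> m z * \<bar>?d x\<bar>"
      using m_nonneg[of z] densityD(3,4)[OF w, of "x + r *\<^sub>R z"] by (intro mult_left_mono mult_left_le_one_le) auto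
    finally show ?thesis by (simp add: mult.commute)
  qed
  note fub = fubini_dominated[OF meas id m_integrable le]
  have "(LBINT x. mollify r w x * ?d x) = (LBINT x. LBINT z. ?F x z)"
    unfolding mollify_def by (simp add: mult.assoc flip: integral_mult_left_zero)
  also have "\<dots> = (LBINT z. LBINT x. ?F x z)"
    by (rule fub)
  also have "\<dots> \<le> (LBINT z. m z * C)"
  proof (rule integral_mono[OF fub(2)])
    fix z
    let ?q = "\<lambda>x. p (x + - (r *\<^sub>R z))"
    have "?q \<in> test_fields"
      using smooth_affine[OF p(1), of 1 "- (r *\<^sub>R z)"] bsupp_translate[OF p(2), of "- (r *\<^sub>R z)"] p(3)
      by (intro test_fieldsI) auto
    then have "(LBINT x. w x * ndiv \<epsilon> ?q x) \<le> C"
      using ctrl unfolding controlled_def by blast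
    moreover have "(LBINT x. w x * ndiv \<epsilon> ?q x) = (LBINT x. w (x + r *\<^sub>R z) * ?d x)"
      using lborel_integral_translate(1)[of "\<lambda>x. w x * ?d (x + - (r *\<^sub>R z))" "r *\<^sub>R z"]
      by (simp only: nonlocal_div_translate[OF eps p(1,2)]) (simp add: add.assoc)
    ultimately have "m z * (LBINT x. w (x + r *\<^sub>R z) * ?d x) \<le> m z * C"
      using m_nonneg[of z] by (intro mult_left_mono) auto
    then show "(LBINT x. ?F x z) \<le> m z * C" by simp
  qed (use m_integrable in simp)
  finally show "(LBINT x. mollify r w x * ?d x) \<le> C" using m_mass by simp
qed

end

section \<open>Translation moduli and compactness\<close>

text \<open>Insert \<open>v\<close> at \<open>x + h\<close> and at \<open>x\<close>: three terms
  cost the factor \<open>3\<close>, and the two comparison terms agree after a translation.\<close>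

lemma sqdiff_triangle:
  assumes w: "unit_density w" and v: "unit_density v"
  shows "sqdiff w h \<le> 3 * sqdiff v h + 6 * (LBINT x. (v x - w x)\<^sup>2)"
proof -
  have [measurable]: "w \<in> borel_measurable borel" "v \<in> borel_measurable borel"
    using densityD(1) w v by auto
  note i = density_diff_sq_integrable
  have "sqdiff w h \<le> (LBINT x. 3 * (v (x + h) - v (x + 0))\<^sup>2
      + 3 * (v (x + h) - w (x + h))\<^sup>2 + 3 * (v (x + 0) - w (x + 0))\<^sup>2)"
    unfolding sqdiff_def
  proof (rule integral_mono)
    show "integrable lborel (\<lambda>x. (w (x + h) - w x)\<^sup>2)"
      using i[OF w w, of h 0] by simp
    show "integrable lborel (\<lambda>x. 3 * (v (x + h) - v (x + 0))\<^sup>2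
      + 3 * (v (x + h) - w (x + h))\<^sup>2 + 3 * (v (x + 0) - w (x + 0))\<^sup>2)"
      by (intro Bochner_Integration.integrable_add integrable_mult_right i v w)
    have three: "(a - b + c)\<^sup>2 \<le> 3 * a\<^sup>2 + 3 * b\<^sup>2 + 3 * c\<^sup>2" for a b c :: real
    proof -
      have "0 \<le> (a + b)\<^sup>2 + (a - c)\<^sup>2 + (b + c)\<^sup>2" by simp
      then show ?thesis by (simp add: power2_eq_square algebra_simps)
    qed
    show "(w (x + h) - w x)\<^sup>2 \<le> 3 * (v (x + h) - v (x + 0))\<^sup>2
      + 3 * (v (x + h) - w (x + h))\<^sup>2 + 3 * (v (x + 0) - w (x + 0))\<^sup>2" for x
      using three[of "v (x + h) - v x" "v (x + h) - w (x + h)" "v x - w x"] by simp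
  qed
  also have "\<dots> = 3 * (LBINT x. (v (x + h) - v (x + 0))\<^sup>2)
      + 3 * (LBINT x. (v (x + h) - w (x + h))\<^sup>2) + 3 * (LBINT x. (v (x + 0) - w (x + 0))\<^sup>2)"
    using i[OF v v, of h 0] i[OF v w, of h h] i[OF v w, of 0 0] by simp
  also have "(LBINT x. (v (x + h) - w (x + h))\<^sup>2) = (LBINT x. (v x - w x)\<^sup>2)"
    using lborel_integral_translate(1)[of "\<lambda>x. (v x - w x)\<^sup>2" h] by simp
  finally show ?thesis by (simp add: sqdiff_def)
qed

context coercive_bump
begin

text \<open>Comparing a function at scale \<open>\<bar>h\<bar>\<close> with its mollification at the smaller scale
  \<open>\<bar>h\<bar> / M\<close> halves any Hoelder constant up to a fixed additive error, so the a priori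
  constant of a smooth function does not enter the final one.\<close>

lemma translation_modulus_smooth:
  assumes C: "0 \<le> C"
  obtains K where "0 \<le> K"
    "\<And>w \<epsilon> h. unit_density w \<Longrightarrow> smooth w \<Longrightarrow> 0 < \<epsilon> \<Longrightarrow> \<epsilon> \<le> 1 \<Longrightarrow> controlled \<epsilon> C w \<Longrightarrow>
      norm h \<le> 1 \<Longrightarrow> sqdiff w h \<le> K * norm h powr \<sigma>"
proof -
  obtain B where B: "B > 0" "\<And>x h. norm (fd m x h) \<le> B * norm h"
    using smooth_fd_bound[OF m_smooth m_bsupp] by blast
  define G where "G = B * unit_ball_vol (real DIM('a))"
  have G: "0 < G" using B(1) by (simp add: G_def)
  \<comment> \<open>Chosen so that mollifying at scale \<open>norm h / M\<close> costs
    \<open>6 * K / 12\<close>, half of the Hoelder constant \<open>K\<close>; the \<open>6\<close>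
    is that of \<open>sqdiff_triangle\<close>.\<close>
  define M where "M = (12::real) powr (1 / \<sigma>)"
  have M: "1 \<le> M" "M powr \<sigma> = 12"
    using pos(3) by (auto simp: M_def powr_powr ge_one_powr_ge_zero)
  define K1 where "K1 = 3 * (modulus_const * C * G * M)"
  have K1: "0 \<le> K1" using C G M modulus_const_pos by (simp add: K1_def)
  have main: "sqdiff w h \<le> 2 * K1 * norm h powr \<sigma>"
    if w: "unit_density w" "smooth w" and eps: "0 < \<epsilon>" "\<epsilon> \<le> 1" and ctrl: "controlled \<epsilon> C w" and h: "norm h \<le> 1"
    for w \<epsilon> h
  proof -
    have half: "sqdiff w h \<le> (K1 + K / 2) * norm h powr \<sigma>"
      if K: "\<And>a. norm a \<le> 1 \<Longrightarrow> sqdiff w a \<le> K * norm a powr \<sigma>" and K0: "0 \<le> K" and h: "norm h \<le> 1" for K h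
    proof (cases "h = 0")
      case True
      then show ?thesis by simp
    next
      case False
      define r where "r = norm h / M"
      have "r \<le> norm h" using mult_left_mono[OF M(1), of "norm h"] M(1) by (simp add: r_def divide_le_eq)
      then have r: "0 < r" "r \<le> 1" using False M(1) h by (auto simp: r_def)
      let ?v = "mollify r w"
      have "sqdiff ?v h \<le> modulus_const * C * (G / r) * norm h powr (1 + \<sigma>)"
      proof (rule macroscopic_modulus[OF mollify_smooth[OF w(1) r(1)] mollify_density[OF w(1) r(1)] eps C _ _ _ h])
        show "controlled \<epsilon> C ?v" by (rule controlled_mollify[OF eps(1) w(1) r(1) ctrl])
        show "\<bar>fd ?v x a\<bar> \<le> G / r * norm a" for x a
          using mollify_slope[OF w(1) r(1) B(2)] by (simp add: G_def)
      qed (use G r in simp)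
      also have "\<dots> = modulus_const * C * G * M * norm h powr \<sigma>"
        using False M(1) by (simp add: r_def powr_add)
      finally have 1: "3 * sqdiff ?v h \<le> K1 * norm h powr \<sigma>" by (simp add: K1_def)
      have "(LBINT x. (?v x - w x)\<^sup>2) \<le> K * r powr \<sigma>"
      proof (rule mollify_dist[OF w(1) r(1)])
        fix a :: 'a assume a: "norm a \<le> r"
        have "sqdiff w a \<le> K * norm a powr \<sigma>" using K a r(2) by simp
        also have "\<dots> \<le> K * r powr \<sigma>"
          using a K0 pos(3) by (intro mult_left_mono powr_mono2) auto
        finally show "sqdiff w a \<le> K * r powr \<sigma>" .
      qed
      also have "r powr \<sigma> = norm h powr \<sigma> / 12"
        using M by (simp add: r_def powr_divide)
      finally have "6 * (LBINT x. (?v x - w x)\<^sup>2) \<le> K / 2 * norm h powr \<sigma>" by simp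
      with 1 sqdiff_triangle[OF w(1) mollify_density[OF w(1) r(1)], of h] show ?thesis
        by (simp add: distrib_right)
    qed
    obtain L where L: "L > 0" "\<And>x v. norm (fd w x v) \<le> L * norm v"
      using smooth_fd_bound[OF w(2) densityD(2)[OF w(1)]] by blast
    obtain R where R: "\<And>x. norm x > R \<Longrightarrow> w x = 0"
      using bsuppE[OF densityD(2)[OF w(1)]] by blast
    \<comment> \<open>An a priori constant from the Lipschitz bound; it depends on \<open>w\<close>
      without control and only starts the iteration.\<close>
    define K0 where "K0 = L\<^sup>2 * measure lborel (cball (0::'a) (R + 1))"
    have K0: "0 \<le> K0" by (simp add: K0_def)
    have init: "sqdiff w a \<le> K0 * norm a powr \<sigma>" if "norm a \<le> 1" for a
    proof -
      have "\<bar>w (x + a) - w x\<bar> \<le> L * norm a" for x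
        using fd_bound_imp_lipschitz[OF w(2) L(2), of "x + a" x] by simp
      from sqdiff_le[OF w(1) that R this]
      have "sqdiff w a \<le> K0 * (norm a)\<^sup>2" by (simp add: K0_def power_mult_distrib mult_ac)
      also have "(norm a)\<^sup>2 \<le> norm a powr \<sigma>"
      proof (cases "a = 0")
        case False
        then have "(norm a)\<^sup>2 = norm a powr 2" by simp
        also have "\<dots> \<le> norm a powr \<sigma>" using that pos by (intro powr_mono') auto
        finally show ?thesis .
      qed simp
      finally show ?thesis using K0 by (simp add: mult_left_mono)
    qed
    \<comment> \<open>\<open>2 * K1\<close> is the fixed point of
      \<open>K \<mapsto> K1 + K / 2\<close>, and the excess \<open>K0\<close> is halved in each
      round.\<close>
    have iter: "sqdiff w a \<le> (2 * K1 + K0 / 2 ^ n) * norm a powr \<sigma>" if "norm a \<le> 1" for a n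
      using that
    proof (induction n arbitrary: a)
      case 0
      have "K0 * norm a powr \<sigma> \<le> (2 * K1 + K0 / 2 ^ 0) * norm a powr \<sigma>"
        using K1 by (intro mult_right_mono) auto
      with init[OF 0] show ?case by simp
    next
      case (Suc n)
      from half[OF Suc.IH _ Suc.prems] K0 K1
      have "sqdiff w a \<le> (K1 + (2 * K1 + K0 / 2 ^ n) / 2) * norm a powr \<sigma>" by simp
      also have "K1 + (2 * K1 + K0 / 2 ^ n) / 2 = 2 * K1 + K0 / 2 ^ Suc n"
        by (simp add: field_simps)
      finally show ?case .
    qed
    have "(\<lambda>n. (2 * K1 + K0 * (1 / 2) ^ n) * norm h powr \<sigma>) \<longlonglongrightarrow> (2 * K1 + K0 * 0) * norm h powr \<sigma>"
      by (intro tendsto_intros LIMSEQ_realpow_zero) auto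
    then show ?thesis
      using iter[OF h] by (intro LIMSEQ_le_const) (auto simp: power_divide)
  qed
  show thesis
    by (rule that[of "2 * K1"]) (use K1 main in auto)
qed

text \<open>Mollifications of \<open>u\<close> at scale \<open>\<delta>\<close> are smooth and
  inherit the control, so their constant \<open>K\<close> does not see \<open>\<delta>\<close>.
  Continuity of translations, even without a rate, makes the error of mollifying arbitrarily
  small.\<close>

lemma translation_modulus:
  assumes C: "0 \<le> C"
  obtains K where "0 \<le> K"
    "\<And>u \<epsilon> h. unit_density u \<Longrightarrow> 0 < \<epsilon> \<Longrightarrow> \<epsilon> \<le> 1 \<Longrightarrow> controlled \<epsilon> C u \<Longrightarrow>
      (\<And>\<tau>. 0 < \<tau> \<Longrightarrow> \<exists>\<delta>>0. \<forall>a. norm a \<le> \<delta> \<longrightarrow> sqdiff u a \<le> \<tau>) \<Longrightarrow>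
      norm h \<le> 1 \<Longrightarrow> sqdiff u h \<le> K * norm h powr \<sigma>"
proof -
  obtain K where K: "0 \<le> K" "\<And>w \<epsilon> h. unit_density w \<Longrightarrow> smooth w \<Longrightarrow> 0 < \<epsilon> \<Longrightarrow> \<epsilon> \<le> 1 \<Longrightarrow> controlled \<epsilon> C w \<Longrightarrow>
      norm h \<le> 1 \<Longrightarrow> sqdiff w h \<le> K * norm h powr \<sigma>"
    using translation_modulus_smooth[OF C] by blast
  have "sqdiff u h \<le> 3 * K * norm h powr \<sigma>"
    if u: "unit_density u" and eps: "0 < \<epsilon>" "\<epsilon> \<le> 1" and ctrl: "controlled \<epsilon> C u"
      and cont: "\<And>\<tau>. 0 < \<tau> \<Longrightarrow> \<exists>\<delta>>0. \<forall>a. norm a \<le> \<delta> \<longrightarrow> sqdiff u a \<le> \<tau>" and h: "norm h \<le> 1" for u \<epsilon> h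
  proof (rule field_le_epsilon)
    fix e :: real assume e: "0 < e"
    obtain \<delta> where \<delta>: "\<delta> > 0" "\<And>a. norm a \<le> \<delta> \<Longrightarrow> sqdiff u a \<le> e / 6"
      using cont[of "e / 6"] e by auto
    have "sqdiff (mollify \<delta> u) h \<le> K * norm h powr \<sigma>"
      by (rule K(2)[OF mollify_density[OF u \<delta>(1)] mollify_smooth[OF u \<delta>(1)] eps
          controlled_mollify[OF eps(1) u \<delta>(1) ctrl] h])
    moreover have "(LBINT x. (mollify \<delta> u x - u x)\<^sup>2) \<le> e / 6"
      by (rule mollify_dist[OF u \<delta>])
    ultimately show "sqdiff u h \<le> 3 * K * norm h powr \<sigma> + e"
      using sqdiff_triangle[OF u mollify_density[OF u \<delta>(1)], of h] by linarith
  qed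
  then show thesis using that[of "3 * K"] K(1) by auto
qed

end

section \<open>Continuity of translations for indicators\<close>

lemma indicator_density:
  assumes "E \<in> sets borel" "bounded E"
  shows "unit_density (indicator E :: 'a::euclidean_space \<Rightarrow> real)"
proof -
  obtain R where "\<And>x. x \<in> E \<Longrightarrow> norm x \<le> R"
    using assms(2) bounded_iff by blast
  then have "bsupp (indicator E :: 'a \<Rightarrow> real)"
    unfolding bsupp_def by (metis indicator_simps(2))
  then show ?thesis using assms(1) by (auto simp: unit_density_def indicator_def)
qed

text \<open>Enclose \<open>E\<close> between a compact \<open>K\<close> and an open \<open>U\<close>
  with \<open>U - K\<close> of small measure. For short shifts, which cannot lead from
  \<open>K\<close> out of \<open>U\<close>, \<open>E\<close> separates \<open>x\<close> and
  \<open>x + a\<close> only if one of them lies in \<open>U - K\<close>.\<close>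

lemma indicator_translation_continuous:
  fixes E :: "'a::euclidean_space set"
  assumes E: "E \<in> sets borel" "bounded E" and "0 < \<tau>"
  shows "\<exists>\<delta>>0. \<forall>a. norm a \<le> \<delta> \<longrightarrow> sqdiff (indicator E) a \<le> \<tau>"
proof -
  have El: "E \<in> lmeasurable"
    using E by (simp add: bounded_set_imp_lmeasurable)
  obtain U where U: "open U" "E \<subseteq> U" "U - E \<in> lmeasurable" "emeasure lebesgue (U - E) < ennreal (\<tau> / 4)"
    using sets_lebesgue_outer_open[of E "\<tau> / 4"] El \<open>0 < \<tau>\<close> by (auto simp: fmeasurable_def)
  obtain K where K: "closed K" "K \<subseteq> E" "E - K \<in> lmeasurable" "emeasure lebesgue (E - K) < ennreal (\<tau> / 4)"
    using sets_lebesgue_inner_closed[of E "\<tau> / 4"] El \<open>0 < \<tau>\<close> by (auto simp: fmeasurable_def)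
  have cK: "compact K"
    using K(1,2) E(2) bounded_subset compact_eq_bounded_closed by blast
  obtain d where d: "d > 0" "(\<Union>x\<in>K. ball x d) \<subseteq> U"
    using compact_subset_open_imp_ball_epsilon_subset[OF cK U(1)] K(2) U(2) by blast
  let ?A = "U - K"
  have Ab: "?A \<in> sets borel" using U(1) K(1) by auto
  have eA: "emeasure lborel ?A < ennreal (\<tau> / 2)"
  proof -
    have split: "?A = (U - E) \<union> (E - K)" using U(2) K(2) by blast
    have "emeasure lborel ?A = emeasure lebesgue ((U - E) \<union> (E - K))"
      using Ab unfolding split[symmetric] by simp
    also have "\<dots> \<le> emeasure lebesgue (U - E) + emeasure lebesgue (E - K)"
      using U(3) K(3) by (intro emeasure_subadditive) (auto simp: fmeasurable_def)
    also have "\<dots> < ennreal (\<tau> / 4) + ennreal (\<tau> / 4)"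
      using U(4) K(4) by (rule add_strict_mono)
    also have "\<dots> = ennreal (\<tau> / 2)"
      using \<open>0 < \<tau>\<close> by (simp flip: ennreal_plus)
    finally show ?thesis .
  qed
  have iA: "integrable lborel (indicator ?A :: 'a \<Rightarrow> real)"
    using Ab eA by (intro integrable_real_indicator) (auto intro: less_trans)
  have mA: "measure lborel ?A \<le> \<tau> / 2"
    using enn2real_mono[OF less_imp_le[OF eA]] \<open>0 < \<tau>\<close> by (simp add: measure_def)
  have "sqdiff (indicator E) a \<le> \<tau>" if a: "norm a \<le> d / 2" for a
  proof -
    have iAa: "integrable lborel (\<lambda>x. indicator ?A (x + a) :: real)"
      and eqA: "(LBINT x. indicator ?A (x + a) :: real) = measure lborel ?A"
      using lborel_integral_translate[of "indicator ?A :: 'a \<Rightarrow> real" a] iA Ab by auto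
    have near: "y \<in> U" if "x \<in> K" "norm (y - x) \<le> d / 2" for x y
      using d that by (force simp: dist_norm norm_minus_commute)
    have "sqdiff (indicator E) a \<le> (LBINT x. indicator ?A x + indicator ?A (x + a))"
      unfolding sqdiff_def
    proof (rule integral_mono)
      show "integrable lborel (\<lambda>x. (indicat_real E (x + a) - indicator E x)\<^sup>2)"
        using density_diff_sq_integrable[OF indicator_density[OF E] indicator_density[OF E], of a 0] by simp
      show "(indicat_real E (x + a) - indicator E x)\<^sup>2 \<le> indicator ?A x + indicator ?A (x + a)" for x
        using near[of x "x + a"] near[of "x + a" x] a U(2) K(2)
        by (auto simp: indicator_def)
    qed (use iA iAa in auto)
    also have "\<dots> = 2 * measure lborel ?A"
      using iA iAa eqA by simp
    finally show ?thesis using mA by simp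
  qed
  then show ?thesis using d(1) by (intro exI[of _ "d / 2"]) auto
qed

lemma sq_sum4: "(a + b - c - d)\<^sup>2 \<le> 4 * (a\<^sup>2 + b\<^sup>2 + c\<^sup>2 + (d::real)\<^sup>2)"
proof -
  have "(a + b - c - d)\<^sup>2 + (a - b)\<^sup>2 + (a + c)\<^sup>2 + (a + d)\<^sup>2 + (b + c)\<^sup>2 + (b + d)\<^sup>2 + (c - d)\<^sup>2
      = 4 * (a\<^sup>2 + b\<^sup>2 + c\<^sup>2 + d\<^sup>2)"
    by (simp add: power2_eq_square algebra_simps)
  then show ?thesis
    using zero_le_power2[of "a - b"] zero_le_power2[of "a + c"] zero_le_power2[of "a + d"]
      zero_le_power2[of "b + c"] zero_le_power2[of "b + d"] zero_le_power2[of "c - d"] by linarith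
qed

section \<open>Compactness from a uniform translation modulus\<close>

context bump
begin

text \<open>A diagonal extraction over all scales \<open>k\<close> and the points of a countable
  dense set at once. At each scale the slopes are bounded uniformly in \<open>n\<close>, so
  convergence spreads from the dense set to every point.\<close>

lemma mollified_subsequence_converges:
  assumes u: "\<And>n. unit_density (u n)" and t: "\<And>k. t k > 0"
  obtains s g where "strict_mono (s :: nat \<Rightarrow> nat)" "\<And>k x. (\<lambda>n. mollify (t k) (u (s n)) x) \<longlonglongrightarrow> g (k::nat) x"
proof -
  obtain B where B: "B > 0" "\<And>x h. norm (fd m x h) \<le> B * norm h"
    using smooth_fd_bound[OF m_smooth m_bsupp] by blast
  define L where "L k = B * unit_ball_vol (real DIM('a)) / t k" for k
  have L: "0 < L k" for k using B(1) t by (simp add: L_def)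
  let ?f = "\<lambda>k n. mollify (t k) (u n)"
  have lip: "norm (?f k n x - ?f k n y) \<le> L k * norm (x - y)" for k n x y
    using mollify_slope[OF u t B(2)] unfolding L_def
    by (intro fd_bound_imp_lipschitz[OF mollify_smooth[OF u t]]) auto
  obtain D :: "'a set" where D: "countable D" "\<And>X. open X \<Longrightarrow> X \<noteq> {} \<Longrightarrow> \<exists>d\<in>D. d \<in> X"
    using countable_dense_setE by blast
  have "norm (?f (fst p) n (snd p)) \<le> 1" for n p
    using densityD(3,4)[OF mollify_density[OF u t]] by simp
  then obtain s where s: "strict_mono s"
    "\<And>p. p \<in> UNIV \<times> D \<Longrightarrow> \<exists>l. (\<lambda>n. ?f (fst p) (s n) (snd p)) \<longlonglongrightarrow> l"
    using function_convergent_subsequence[of "UNIV \<times> D" "\<lambda>n p. ?f (fst p) n (snd p)" 1] D(1)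
    by (metis countable_SIGMA uncountable_def countableI_type)
  have "convergent (\<lambda>n. ?f k (s n) x)" for k x
  proof -
    have "Cauchy (\<lambda>n. ?f k (s n) x)"
    proof (rule CauchyI)
      fix e :: real assume e: "0 < e"
      have "0 < e / (4 * L k)" using e L[of k] by (intro divide_pos_pos) auto
      then have "ball x (e / (4 * L k)) \<noteq> {}" by simp
      then obtain d where d: "d \<in> D" "d \<in> ball x (e / (4 * L k))"
        using D(2)[of "ball x (e / (4 * L k))"] by auto
      have "convergent (\<lambda>n. ?f k (s n) d)"
        using s(2)[of "(k, d)"] d(1) by (auto simp: convergent_def)
      then obtain N where N: "\<And>i j. N \<le> i \<Longrightarrow> N \<le> j \<Longrightarrow> norm (?f k (s i) d - ?f k (s j) d) < e / 2"
        using CauchyD[OF convergent_Cauchy, of _ "e / 2"] e by (metis half_gt_zero)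
      have near: "norm (?f k n x - ?f k n d) \<le> e / 4" for n
      proof -
        have "L k * norm (x - d) \<le> e / 4"
          using d(2) L[of k] by (simp add: dist_norm field_simps)
        then show ?thesis using lip[of k n x d] by linarith
      qed
      have "norm (?f k (s i) x - ?f k (s j) x) < e" if "N \<le> i" "N \<le> j" for i j
        using near[of "s i"] near[of "s j"] N[OF that] unfolding real_norm_def by linarith
      then show "\<exists>M. \<forall>m\<ge>M. \<forall>n\<ge>M. norm (?f k (s m) x - ?f k (s n) x) < e" by blast
    qed
    then show ?thesis by (rule Cauchy_convergent)
  qed
  then show thesis
    using that[OF s(1), of "\<lambda>k x. lim (\<lambda>n. ?f k (s n) x)"] by (simp add: convergent_LIMSEQ_iff)
qed

text \<open>Two members are compared through their mollifications at scale \<open>t k\<close>: these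
  are within \<open>K * t k powr \<sigma>\<close> of all members, and at fixed \<open>k\<close> they
  converge in mean square by dominated convergence.\<close>

lemma equicontinuous_Cauchy_subsequence:
  fixes u :: "nat \<Rightarrow> 'a \<Rightarrow> real"
  assumes u: "\<And>n. unit_density (u n)" and R: "\<And>n x. norm x > R \<Longrightarrow> u n x = 0" and \<sigma>: "0 < \<sigma>" and K: "0 \<le> K"
    and mod: "\<And>n h. norm h \<le> 1 \<Longrightarrow> sqdiff (u n) h \<le> K * norm h powr \<sigma>"
  obtains s where "strict_mono (s :: nat \<Rightarrow> nat)"
    "\<And>\<tau>. 0 < \<tau> \<Longrightarrow> \<exists>N. \<forall>i\<ge>N. \<forall>j\<ge>N. (LBINT x. (u (s i) x - u (s j) x)\<^sup>2) \<le> \<tau>"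
proof -
  define t where "t k = inverse (real (Suc k))" for k
  have t: "0 < t k" "t k \<le> 1" for k by (auto simp: t_def inverse_le_1_iff)
  obtain s g where s: "strict_mono s" and g: "\<And>k x. (\<lambda>n. mollify (t k) (u (s n)) x) \<longlonglongrightarrow> g (k::nat) x"
    by (rule mollified_subsequence_converges[where u = u and t = t, OF u t(1)]) (rule that)
  let ?f = "\<lambda>k n. mollify (t k) (u (s n))"
  have fd: "unit_density (?f k n)" for k n by (rule mollify_density[OF u t(1)])
  have [measurable]: "?f k n \<in> borel_measurable borel" "u n \<in> borel_measurable borel" for k n
    using densityD(1) fd u by auto
  have [measurable]: "g k \<in> borel_measurable borel" for k
    by (rule borel_measurable_LIMSEQ_real[OF g]) simp
  have g01: "0 \<le> g k x" "g k x \<le> 1" for k x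
    using LIMSEQ_le_const[OF g] LIMSEQ_le_const2[OF g] densityD(3,4)[OF fd] by blast+
  have f0: "?f k n x = 0" if "norm x > R + 1" for k n x
    by (rule mollify_support[OF u t(1) R]) (use that t(2)[of k] in auto)
  have g0: "g k x = 0" if "norm x > R + 1" for k x
    using g[of k x] f0[OF that] by (simp add: LIMSEQ_const_iff)
  have "bsupp (g k)" for k
    unfolding bsupp_def using g0 by (metis not_le)
  then have gd: "unit_density (g k)" for k
    unfolding unit_density_def using g01 by auto
  have fg: "(\<lambda>n. LBINT x. (?f k n x - g k x)\<^sup>2) \<longlonglongrightarrow> 0" for k
  proof -
    have "(\<lambda>n. LBINT x. (?f k n x - g k x)\<^sup>2) \<longlonglongrightarrow> (LINT (x::'a)|lborel. 0)"
    proof (rule integral_dominated_convergence)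
      show "integrable lborel (indicator (cball (0::'a) (R + 1)) :: 'a \<Rightarrow> real)"
        by (rule integrable_indicator_bounded) auto
      show "AE x in lborel. (\<lambda>n. (?f k n x - g k x)\<^sup>2) \<longlonglongrightarrow> 0"
      proof (rule AE_I2)
        fix x
        have "(\<lambda>n. (?f k n x - g k x)\<^sup>2) \<longlonglongrightarrow> (g k x - g k x)\<^sup>2"
          by (intro tendsto_intros g)
        then show "(\<lambda>n. (?f k n x - g k x)\<^sup>2) \<longlonglongrightarrow> 0" by simp
      qed
      show "AE x in lborel. norm ((?f k n x - g k x)\<^sup>2) \<le> indicator (cball 0 (R + 1)) x" for n
      proof (rule AE_I2)
        fix x
        have "\<bar>?f k n x - g k x\<bar> \<le> 1"
          using densityD(3,4)[OF fd, of k n x] g01[of k x] by simp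
        then show "norm ((?f k n x - g k x)\<^sup>2) \<le> indicator (cball 0 (R + 1)) x"
          using f0[of x k n] g0[of x k] by (cases "norm x \<le> R + 1") (auto simp: abs_square_le_1)
      qed
    qed measurable
    then show ?thesis by simp
  qed
  have uf: "(LBINT x. (?f k n x - u (s n) x)\<^sup>2) \<le> K * t k powr \<sigma>" for k n
  proof (rule mollify_dist[OF u t(1)])
    fix a :: 'a assume a: "norm a \<le> t k"
    have "sqdiff (u (s n)) a \<le> K * norm a powr \<sigma>"
      by (rule mod) (use a t(2)[of k] in simp)
    also have "\<dots> \<le> K * t k powr \<sigma>"
      using a K \<sigma> by (intro mult_left_mono powr_mono2) auto
    finally show "sqdiff (u (s n)) a \<le> K * t k powr \<sigma>" .
  qed
  have small: "\<exists>N. \<forall>i\<ge>N. \<forall>j\<ge>N. (LBINT x. (u (s i) x - u (s j) x)\<^sup>2) \<le> \<tau>" if \<tau>: "0 < \<tau>" for \<tau>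
  proof -
    have t0: "t \<longlonglongrightarrow> 0" unfolding t_def by (rule LIMSEQ_inverse_real_of_nat)
    have "(\<lambda>k. K * t k powr \<sigma>) \<longlonglongrightarrow> K * 0 powr \<sigma>"
      using t \<sigma> by (intro tendsto_mult tendsto_const tendsto_powr' t0) (auto intro: always_eventually less_imp_le)
    then have "(\<lambda>k. K * t k powr \<sigma>) \<longlonglongrightarrow> 0" by simp
    \<comment> \<open>The scale \<open>k\<close> is fixed before \<open>N\<close>, which may depend
      on it. Each of four terms gets \<open>\<tau> / 16\<close> because \<open>sq_sum4\<close> has
      the factor \<open>4\<close>.\<close>
    from order_tendstoD(2)[OF this, of "\<tau> / 16"] \<tau>
    obtain k where k: "K * t k powr \<sigma> < \<tau> / 16"
      by (auto simp: eventually_sequentially)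
    from order_tendstoD(2)[OF fg[of k], of "\<tau> / 16"] \<tau>
    obtain N where N: "\<And>n. N \<le> n \<Longrightarrow> (LBINT x. (?f k n x - g k x)\<^sup>2) < \<tau> / 16"
      by (auto simp: eventually_sequentially)
    have "(LBINT x. (u (s i) x - u (s j) x)\<^sup>2) \<le> \<tau>" if "N \<le> i" "N \<le> j" for i j
    proof -
      note i1 = density_diff_sq_integrable[where a = 0 and b = 0, simplified]
      let ?h = "\<lambda>x. 4 * ((?f k j x - u (s j) x)\<^sup>2 + (?f k i x - g k x)\<^sup>2 + (?f k i x - u (s i) x)\<^sup>2 + (?f k j x - g k x)\<^sup>2)"
      have "(LBINT x. (u (s i) x - u (s j) x)\<^sup>2) \<le> (LBINT x. ?h x)"
      proof (rule integral_mono)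
        show "integrable lborel ?h"
          by (intro integrable_mult_right Bochner_Integration.integrable_add i1 fd gd u)
        show "(u (s i) x - u (s j) x)\<^sup>2 \<le> ?h x" for x
          using sq_sum4[of "?f k j x - u (s j) x" "?f k i x - g k x" "?f k i x - u (s i) x" "?f k j x - g k x"]
          by simp
      qed (intro i1 u)
      also have "\<dots> = 4 * ((LBINT x. (?f k j x - u (s j) x)\<^sup>2) + (LBINT x. (?f k i x - g k x)\<^sup>2)
          + (LBINT x. (?f k i x - u (s i) x)\<^sup>2) + (LBINT x. (?f k j x - g k x)\<^sup>2))"
        using i1[OF fd u] i1[OF fd gd] by simp
      also have "\<dots> \<le> 4 * (\<tau> / 16 + \<tau> / 16 + \<tau> / 16 + \<tau> / 16)"
        by (intro mult_left_mono add_mono order.trans[OF uf less_imp_le[OF k]] less_imp_le[OF N] that) simp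
      finally show ?thesis by simp
    qed
    then show ?thesis by blast
  qed
  show thesis by (rule that[OF s small])
qed

end

section \<open>Convergence of sets\<close>

text \<open>Along a subsequence with summable successive distances, a point outside all differences
  \<open>D\<close> from index \<open>j\<close> on never changes membership again. The limit consists
  of the points lying in infinitely many members.\<close>

lemma Cauchy_sets_converge:
  fixes X :: "nat \<Rightarrow> 'a set"
  assumes X: "\<And>n. X n \<in> sets M"
    and Cauchy: "\<And>\<tau>. 0 < \<tau> \<Longrightarrow> \<exists>N. \<forall>i\<ge>N. \<forall>j\<ge>N. emeasure M (sym_diff (X i) (X j)) \<le> ennreal \<tau>"
  obtains s E where "strict_mono (s :: nat \<Rightarrow> nat)" "E \<in> sets M"
    "(\<lambda>j. emeasure M (sym_diff (X (s j)) E)) \<longlonglongrightarrow> 0"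
proof -
  obtain N where N: "\<And>j i i'. N j \<le> i \<Longrightarrow> N j \<le> i' \<Longrightarrow> emeasure M (sym_diff (X i) (X i')) \<le> ennreal ((1/2) ^ j)"
    using Cauchy[of "(1/2) ^ j" for j] by (metis zero_less_power half_gt_zero zero_less_one)
  \<comment> \<open>Partial sums make \<open>s\<close> strictly increasing and at least
    \<open>N j\<close> from index \<open>j\<close> on.\<close>
  define s where "s j = (\<Sum>i\<le>j. Suc (N i))" for j
  have s: "strict_mono s"
    by (rule strict_mono_Suc_iff[THEN iffD2]) (simp add: s_def)
  have sN: "N j \<le> s j" "N j \<le> s (Suc j)" for j
    using member_le_sum[of j "{..j}" "\<lambda>i. Suc (N i)"] by (auto simp: s_def)
  define D where "D i = sym_diff (X (s i)) (X (s (Suc i)))" for i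
  have D: "D i \<in> sets M" for i using X by (simp add: D_def)
  have eD: "emeasure M (D i) \<le> ennreal ((1/2) ^ i)" for i
    unfolding D_def using N sN by blast
  define E where "E = (\<Inter>j. \<Union>i\<in>{j..}. X (s i))"
  have E: "E \<in> sets M" unfolding E_def using X by (intro sets.countable_INT sets.countable_UN) auto
  have sub: "sym_diff (X (s j)) E \<subseteq> (\<Union>i. D (i + j))" for j
  proof
    fix x assume x: "x \<in> sym_diff (X (s j)) E"
    show "x \<in> (\<Union>i. D (i + j))"
    proof (rule ccontr)
      assume "x \<notin> (\<Union>i. D (i + j))"
      then have step: "x \<in> X (s (i + j)) \<longleftrightarrow> x \<in> X (s (Suc (i + j)))" for i
        by (auto simp: D_def)
      have const: "x \<in> X (s (i + j)) \<longleftrightarrow> x \<in> X (s j)" for i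
      proof (induction i)
        case (Suc i)
        then show ?case using step[of i] by simp
      qed simp
      have "x \<in> X (s i) \<longleftrightarrow> x \<in> X (s j)" if "j \<le> i" for i
        using const[of "i - j"] that by simp
      note eq = this
      have "x \<in> E" if "x \<in> X (s j)"
        unfolding E_def
      proof (intro INT_I UN_I)
        show "max j i \<in> {i..}" "x \<in> X (s (max j i))" for i
          using that eq[of "max j i"] by auto
      qed
      moreover have "x \<in> X (s j)" if "x \<in> E"
        using that eq unfolding E_def by blast
      ultimately show False using x by blast
    qed
  qed
  have bound: "emeasure M (sym_diff (X (s j)) E) \<le> ennreal (2 * (1/2) ^ j)" for j
  proof -
    have "emeasure M (sym_diff (X (s j)) E) \<le> emeasure M (\<Union>i. D (i + j))"
      using sub D by (intro emeasure_mono) auto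
    also have "\<dots> \<le> (\<Sum>i. emeasure M (D (i + j)))"
      using D by (intro emeasure_subadditive_countably) auto
    also have "\<dots> \<le> (\<Sum>i. ennreal ((1/2) ^ (i + j)))"
      by (intro suminf_le eD) auto
    also have "\<dots> = ennreal (2 * (1/2) ^ j)"
    proof (rule suminf_ennreal_eq)
      have "(\<lambda>i. (1/2) ^ i * (1/2) ^ j) sums (1 / (1 - 1/2) * (1/2 :: real) ^ j)"
        by (intro sums_mult2 geometric_sums) simp
      then show "(\<lambda>i. (1/2) ^ (i + j)) sums (2 * (1/2 :: real) ^ j)"
        by (simp add: power_add)
    qed simp
    finally show ?thesis .
  qed
  have "(\<lambda>j. ennreal (2 * (1/2) ^ j)) \<longlonglongrightarrow> ennreal (2 * 0)"
    by (intro tendsto_ennrealI tendsto_intros LIMSEQ_realpow_zero) auto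
  then have lim: "(\<lambda>j. ennreal (2 * (1/2) ^ j)) \<longlonglongrightarrow> 0" by simp
  have "(\<lambda>j. emeasure M (sym_diff (X (s j)) E)) \<longlonglongrightarrow> 0"
    by (rule tendsto_sandwich[OF _ _ tendsto_const lim]) (use bound in auto)
  then show thesis using that[OF s E] by blast
qed

lemma set_conv_imp_local_set_conv:
  fixes X :: "nat \<Rightarrow> 'a::euclidean_space set"
  assumes X: "\<And>n. X n \<in> sets lebesgue" and E: "E \<in> sets lebesgue" and conv: "set_conv X E"
  shows "local_set_conv X E"
  unfolding local_set_conv_def
proof (intro allI impI)
  fix K :: "'a set" assume K: "compact K"
  have Ks: "K \<in> sets lebesgue" using K by (simp add: borel_compact)
  let ?S = "\<lambda>n. sym_diff (X n) E"
  have "(\<lambda>n. emeasure lebesgue (K \<inter> ?S n)) \<longlonglongrightarrow> 0"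
  proof (rule tendsto_sandwich[OF _ _ tendsto_const conv[unfolded set_conv_def]])
    show "\<forall>\<^sub>F n in sequentially. emeasure lebesgue (K \<inter> ?S n) \<le> emeasure lebesgue (?S n)"
      using X E by (intro always_eventually allI emeasure_mono) auto
  qed simp
  then have "(\<lambda>n. emeasure lebesgue (K \<inter> ?S n)) \<longlonglongrightarrow> ennreal 0"
    by simp
  then have "(\<lambda>n. enn2real (emeasure lebesgue (K \<inter> ?S n))) \<longlonglongrightarrow> 0"
    by (rule tendsto_enn2real) simp
  moreover have "(LINT x:K|lebesgue. \<bar>indicator (X n) x - indicator E x :: real\<bar>) = enn2real (emeasure lebesgue (K \<inter> ?S n))" for n
  proof -
    have "(LINT x:K|lebesgue. \<bar>indicator (X n) x - indicator E x :: real\<bar>) = (LINT x|lebesgue. indicator (K \<inter> ?S n) x)"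
      unfolding set_lebesgue_integral_def
      by (rule Bochner_Integration.integral_cong) (auto simp: indicator_def)
    then show ?thesis using Ks X E by (simp add: measure_def)
  qed
  ultimately show "(\<lambda>n. LINT x:K|lebesgue. \<bar>indicator (X n) x - indicator E x :: real\<bar>) \<longlonglongrightarrow> 0"
    by simp
qed

text \<open>\<open>E\<close> differs from suitable \<open>X n\<close> satisfying the constraint by
  arbitrarily small measure. Satisfying it infinitely often is the right assumption: otherwise the
  constrained functionals are eventually infinite.\<close>

lemma constraint_closed:
  fixes X :: "nat \<Rightarrow> 'a::euclidean_space set"
  assumes X: "\<And>n. X n \<in> sets lebesgue" and E: "E \<in> sets lebesgue" and conv: "set_conv X E"
    and \<Omega>: "\<Omega> \<in> sets lebesgue"
    and freq: "\<exists>\<^sub>F n in sequentially. X n - \<Omega> \<in> null_sets lebesgue \<and> emeasure lebesgue (X n) = ennreal m"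
  shows "E - \<Omega> \<in> null_sets lebesgue" "emeasure lebesgue E = ennreal m"
proof -
  let ?S = "\<lambda>n. sym_diff (X n) E"
  have ex: "\<exists>n. emeasure lebesgue (?S n) < ennreal e \<and> X n - \<Omega> \<in> null_sets lebesgue \<and> emeasure lebesgue (X n) = ennreal m"
    if "0 < e" for e
  proof -
    have "\<forall>\<^sub>F n in sequentially. emeasure lebesgue (?S n) < ennreal e"
      using conv that unfolding set_conv_def by (intro order_tendstoD(2)) auto
    from frequently_eventually_frequently[OF freq this] show ?thesis
      by (auto dest!: frequently_ex)
  qed
  have "emeasure lebesgue (E - \<Omega>) \<le> 0"
  proof (rule ennreal_le_epsilon)
    fix e :: real assume "0 < e"
    then obtain n where n: "emeasure lebesgue (?S n) < ennreal e" "X n - \<Omega> \<in> null_sets lebesgue"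
      using ex by blast
    have "emeasure lebesgue (E - \<Omega>) \<le> emeasure lebesgue ((X n - \<Omega>) \<union> ?S n)"
      using X E \<Omega> by (intro emeasure_mono) auto
    also have "\<dots> \<le> emeasure lebesgue (X n - \<Omega>) + emeasure lebesgue (?S n)"
      using X E \<Omega> by (intro emeasure_subadditive) auto
    also have "\<dots> \<le> 0 + ennreal e"
      using n by (intro add_mono) (auto dest: null_setsD1)
    finally show "emeasure lebesgue (E - \<Omega>) \<le> 0 + ennreal e" .
  qed
  then show "E - \<Omega> \<in> null_sets lebesgue" using E \<Omega> by (auto simp: null_sets_def)
  show "emeasure lebesgue E = ennreal m"
  proof (rule antisym; rule ennreal_le_epsilon)
    fix e :: real assume "0 < e"
    then obtain n where n: "emeasure lebesgue (?S n) < ennreal e" "emeasure lebesgue (X n) = ennreal m"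
      using ex by blast
    have "emeasure lebesgue E \<le> emeasure lebesgue (X n \<union> ?S n)"
      using X E by (intro emeasure_mono) auto
    also have "\<dots> \<le> emeasure lebesgue (X n) + emeasure lebesgue (?S n)"
      using X E by (intro emeasure_subadditive) auto
    also have "\<dots> \<le> emeasure lebesgue (X n) + ennreal e"
      using n(1) by (intro add_left_mono less_imp_le)
    finally show "emeasure lebesgue E \<le> ennreal m + ennreal e"
      by (simp add: n(2))
    have "emeasure lebesgue (X n) \<le> emeasure lebesgue (E \<union> ?S n)"
      using X E by (intro emeasure_mono) auto
    also have "\<dots> \<le> emeasure lebesgue E + emeasure lebesgue (?S n)"
      using X E by (intro emeasure_subadditive) auto
    also have "\<dots> \<le> emeasure lebesgue E + ennreal e"
      using n(1) by (intro add_left_mono less_imp_le)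
    finally show "ennreal m \<le> emeasure lebesgue E + ennreal e"
      by (simp add: n(2))
  qed
qed

text \<open>The estimates concern Borel functions of bounded support, while competitors are Lebesgue
  measurable and lie in \<open>\<Omega>\<close> up to a null set. Intersecting with
  \<open>\<Omega>\<close> and taking the Borel part of the completion removes both defects.\<close>

lemma borel_representative:
  fixes X \<Omega> :: "'a::euclidean_space set"
  assumes "X \<in> sets lebesgue" "X - \<Omega> \<in> null_sets lebesgue" "\<Omega> \<in> sets lebesgue"
  obtains Y where "Y \<in> sets borel" "Y \<subseteq> \<Omega>" "sym_diff X Y \<in> null_sets lebesgue"
proof -
  have "X \<inter> \<Omega> \<in> sets lebesgue" using assms by auto
  then obtain Y N N' where Y: "X \<inter> \<Omega> = Y \<union> N" "N \<subseteq> N'" "N' \<in> null_sets lborel" "Y \<in> sets lborel"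
    by (rule sets_completionE)
  have "sym_diff X Y \<subseteq> (X - \<Omega>) \<union> N'" using Y by blast
  moreover have "(X - \<Omega>) \<union> N' \<in> null_sets lebesgue"
    using assms(2) null_sets_completionI[OF Y(3)] by (rule null_sets.Un)
  moreover have "sym_diff X Y \<in> sets lebesgue" using assms sets_completionI_sets[OF Y(4)] by (auto simp del: sets_lborel)
  ultimately have "sym_diff X Y \<in> null_sets lebesgue" by (meson null_sets_subset)
  then show thesis using that[of Y] Y by auto
qed

section \<open>Gamma-convergence of the functionals\<close>

context radial_kernel
begin

lemma gamma_local:
  "gamma_converges (sets lebesgue) local_set_conv (\<lambda>\<epsilon>. nper \<epsilon>) perimeter"
  unfolding gamma_converges_def
proof (intro allI impI ballI conjI)
  fix \<epsilon> :: "nat \<Rightarrow> real" and E :: "'a set"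
  assume \<epsilon>: "(\<forall>n. 0 < \<epsilon> n) \<and> \<epsilon> \<longlonglongrightarrow> 0" and E: "E \<in> sets lebesgue"
  show "perimeter E \<le> liminf (\<lambda>n. nper (\<epsilon> n) (X n))"
    if "(\<forall>n. X n \<in> sets lebesgue) \<and> local_set_conv X E" for X
    using perimeter_le_liminf[of \<epsilon> X E] that \<epsilon> E by blast
  have "limsup (\<lambda>n. nper (\<epsilon> n) E) \<le> perimeter E"
    using \<epsilon> by (intro Limsup_bounded always_eventually allI nonlocal_perimeter_le) blast
  moreover have "local_set_conv (\<lambda>n. E) E" by (simp add: local_set_conv_def)
  ultimately show "\<exists>X. (\<forall>n. X n \<in> sets lebesgue) \<and> local_set_conv X E \<and>
      limsup (\<lambda>n. nper (\<epsilon> n) (X n)) \<le> perimeter E"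
    using E by (intro exI[of _ "\<lambda>n. E"]) auto
qed

text \<open>The constant sequence satisfies the constraint whenever its limit does, so it stays a
  recovery sequence without any volume correction. For the lower bound, the constraint either holds
  infinitely often and passes to the limit, or the functionals are eventually infinite.\<close>

lemma gamma_constrained:
  assumes \<Omega>: "\<Omega> \<in> sets lebesgue"
  shows "gamma_converges (sets lebesgue) set_conv
    (\<lambda>\<epsilon>. constrained (nper \<epsilon>) \<Omega> m) (constrained perimeter \<Omega> m)"
  unfolding gamma_converges_def
proof (intro allI impI ballI conjI)
  fix \<epsilon> :: "nat \<Rightarrow> real" and E :: "'a set"
  assume \<epsilon>: "(\<forall>n. 0 < \<epsilon> n) \<and> \<epsilon> \<longlonglongrightarrow> 0" and E: "E \<in> sets lebesgue"
  show "constrained perimeter \<Omega> m E \<le> liminf (\<lambda>n. constrained (nper (\<epsilon> n)) \<Omega> m (X n))"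
    if X: "(\<forall>n. X n \<in> sets lebesgue) \<and> set_conv X E" for X
  proof (cases "\<exists>\<^sub>F n in sequentially. X n - \<Omega> \<in> null_sets lebesgue \<and> emeasure lebesgue (X n) = ennreal m")
    case True
    have "constrained perimeter \<Omega> m E = perimeter E"
      using constraint_closed[OF _ E _ \<Omega> True] X unfolding constrained_def by auto
    also have "\<dots> \<le> liminf (\<lambda>n. nper (\<epsilon> n) (X n))"
      using perimeter_le_liminf[of \<epsilon> X E] set_conv_imp_local_set_conv[of X E] X \<epsilon> E by blast
    also have "\<dots> \<le> liminf (\<lambda>n. constrained (nper (\<epsilon> n)) \<Omega> m (X n))"
      by (intro Liminf_mono always_eventually) (auto simp: constrained_def)
    finally show ?thesis .
  next
    case False
    then have "\<forall>\<^sub>F n in sequentially. constrained (nper (\<epsilon> n)) \<Omega> m (X n) = \<infinity>"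
      unfolding not_frequently by eventually_elim (auto simp: constrained_def)
    then have "liminf (\<lambda>n. constrained (nper (\<epsilon> n)) \<Omega> m (X n)) = liminf (\<lambda>n. \<infinity>)"
      by (rule Liminf_eq)
    also have "\<dots> = (\<infinity> :: ereal)" by (simp add: Liminf_const)
    finally show ?thesis by simp
  qed
  have "limsup (\<lambda>n. constrained (nper (\<epsilon> n)) \<Omega> m E) \<le> constrained perimeter \<Omega> m E"
    using \<epsilon> nonlocal_perimeter_le
    by (intro Limsup_bounded always_eventually allI) (auto simp: constrained_def)
  moreover have "set_conv (\<lambda>n. E) E" by (simp add: set_conv_def)
  ultimately show "\<exists>X. (\<forall>n. X n \<in> sets lebesgue) \<and> set_conv X E \<and>
      limsup (\<lambda>n. constrained (nper (\<epsilon> n)) \<Omega> m (X n)) \<le> constrained perimeter \<Omega> m E"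
    using E by (intro exI[of _ "\<lambda>n. E"]) auto
qed

lemma controlled_indicator:
  assumes Y: "Y \<in> sets borel" and X: "X \<in> sets lebesgue" and null: "sym_diff X Y \<in> null_sets lebesgue"
    and eps: "0 < \<epsilon>" and le: "nper \<epsilon> X \<le> ereal C"
  shows "controlled \<epsilon> C (indicator Y)"
  unfolding controlled_def
proof
  fix p :: "'a \<Rightarrow> 'a" assume p: "p \<in> test_fields"
  let ?d = "ndiv \<epsilon> p"
  have [measurable]: "?d \<in> borel_measurable borel"
    using smooth_borel nonlocal_div_smooth(1)[OF eps] test_fieldsD(1,2)[OF p] by blast
  have "(LBINT x. indicator Y x * ?d x) = (LINT x|lebesgue. indicator Y x *\<^sub>R ?d x)"
    using Y by (subst integral_completion) auto
  also have "\<dots> = (LINT x|lebesgue. indicator X x *\<^sub>R ?d x)"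
  proof (rule integral_cong_AE)
    have "AE x in lebesgue. x \<notin> sym_diff X Y" by (rule AE_not_in[OF null])
    then show "AE x in lebesgue. indicator Y x *\<^sub>R ?d x = indicator X x *\<^sub>R ?d x"
      by eventually_elim (auto simp: indicator_def)
    have d: "?d \<in> borel_measurable lebesgue" by (rule measurable_completion) simp
    have "Y \<in> sets lebesgue" using Y by (intro sets_completionI_sets) simp
    then show "(\<lambda>x. indicator Y x *\<^sub>R ?d x) \<in> borel_measurable lebesgue"
      by (intro borel_measurable_scaleR borel_measurable_indicator d)
    show "(\<lambda>x. indicator X x *\<^sub>R ?d x) \<in> borel_measurable lebesgue"
      by (intro borel_measurable_scaleR borel_measurable_indicator d X)
  qed
  finally have "ereal (LBINT x. indicator Y x * ?d x) = ereal (LINT x:X|lebesgue. ?d x)"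
    by (simp add: set_lebesgue_integral_def)
  also have "\<dots> \<le> ereal C"
    using le p unfolding nonlocal_perimeter_def by (auto simp: SUP_le_iff)
  finally show "(LBINT x. indicator Y x * ?d x) \<le> C" by simp
qed

lemma nonlocal_perimeter_nonneg: "0 \<le> nper \<epsilon> E"
proof -
  have "(\<lambda>x::'a. 0::'a) \<in> test_fields"
    by (intro test_fieldsI smooth_const) (auto simp: bsupp_def)
  moreover have "ereal (LINT x:E|lebesgue. ndiv \<epsilon> (\<lambda>x. 0) x) = 0"
    by (simp add: nonlocal_div_def set_lebesgue_integral_def zero_ereal_def)
  ultimately show ?thesis
    unfolding nonlocal_perimeter_def by (metis (no_types, lifting) SUP_upper)
qed

end

lemma sqdiff_indicator_emeasure:
  assumes "A \<in> sets borel" "B \<in> sets borel" "bounded A" "bounded (B :: 'a::euclidean_space set)"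
  shows "emeasure lborel (sym_diff A B) = ennreal (LBINT x. (indicator A x - indicator B x :: real)\<^sup>2)"
proof -
  have "emeasure lborel (sym_diff A B) < \<infinity>"
    using assms by (intro emeasure_bounded_finite) auto
  then have "emeasure lborel (sym_diff A B) = ennreal (measure lborel (sym_diff A B))"
    by (simp add: emeasure_eq_ennreal_measure infinity_ennreal_def)
  also have "measure lborel (sym_diff A B) = (LBINT x. indicator (sym_diff A B) x)"
    using assms by simp
  also have "\<dots> = (LBINT x. (indicator A x - indicator B x :: real)\<^sup>2)"
    by (rule Bochner_Integration.integral_cong) (auto simp: indicator_def)
  finally show ?thesis .
qed

lemma (in coercive_bump) equi_coercive_constrained:
  assumes \<Omega>: "\<Omega> \<in> sets lebesgue" "bounded \<Omega>"
  shows "equi_coercive (sets lebesgue) set_conv (\<lambda>\<epsilon>. constrained (nper \<epsilon>) \<Omega> mm)"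
  unfolding equi_coercive_def
proof (intro allI impI, elim conjE)
  fix \<epsilon> :: "nat \<Rightarrow> real" and X :: "nat \<Rightarrow> 'a set"
  assume eps: "\<forall>n. 0 < \<epsilon> n" and lim: "\<epsilon> \<longlonglongrightarrow> 0" and X: "\<forall>n. X n \<in> sets lebesgue"
    and fin: "(SUP n. constrained (nper (\<epsilon> n)) \<Omega> mm (X n)) < \<infinity>"
  let ?F = "\<lambda>n. constrained (nper (\<epsilon> n)) \<Omega> mm (X n)"
  have Ffin: "?F n < \<infinity>" for n
    by (rule le_less_trans[OF SUP_upper fin]) simp
  then have con: "X n - \<Omega> \<in> null_sets lebesgue" and Feq: "?F n = nper (\<epsilon> n) (X n)" for n
    unfolding constrained_def by (metis less_irrefl)+
  define S where "S = (SUP n. ?F n)"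
  have "?F n \<le> S" for n unfolding S_def by (rule SUP_upper) simp
  then have S: "nper (\<epsilon> n) (X n) \<le> S" for n by (simp add: Feq)
  have "0 \<le> S" using order.trans[OF nonlocal_perimeter_nonneg S] .
  then obtain C where C: "S = ereal C" "0 \<le> C"
    using fin unfolding S_def[symmetric] by (cases S) auto
  have "\<exists>Y. Y \<in> sets borel \<and> Y \<subseteq> \<Omega> \<and> sym_diff (X n) Y \<in> null_sets lebesgue" for n
    using borel_representative[OF _ con \<Omega>(1)] X by metis
  then obtain Y where Y: "\<And>n. Y n \<in> sets borel" "\<And>n. Y n \<subseteq> \<Omega>" "\<And>n. sym_diff (X n) (Y n) \<in> null_sets lebesgue"
    by metis
  have Yb: "bounded (Y n)" for n using bounded_subset[OF \<Omega>(2) Y(2)] .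
  obtain R where R: "\<And>x. x \<in> \<Omega> \<Longrightarrow> norm x \<le> R"
    using \<Omega>(2) bounded_iff by blast
  have ctrl: "controlled (\<epsilon> n) C (indicator (Y n))" for n
    using controlled_indicator[OF Y(1) _ Y(3)] X eps S C(1) by blast
  \<comment> \<open>The translation modulus is available for \<open>\<epsilon> \<le> 1\<close>; the
    finitely many earlier members are skipped.\<close>
  obtain n0 where n0: "\<And>n. n0 \<le> n \<Longrightarrow> \<epsilon> n < 1"
    using order_tendstoD(2)[OF lim, of 1] by (auto simp: eventually_sequentially)
  obtain K where K: "0 \<le> K" "\<And>u \<epsilon> h. unit_density u \<Longrightarrow> 0 < \<epsilon> \<Longrightarrow> \<epsilon> \<le> 1 \<Longrightarrow> controlled \<epsilon> C u \<Longrightarrow>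
      (\<And>\<tau>. 0 < \<tau> \<Longrightarrow> \<exists>\<delta>>0. \<forall>a. norm a \<le> \<delta> \<longrightarrow> sqdiff u a \<le> \<tau>) \<Longrightarrow>
      norm h \<le> 1 \<Longrightarrow> sqdiff u h \<le> K * norm h powr \<sigma>"
    using translation_modulus[OF C(2)] by blast
  define u where "u n = (indicator (Y (n + n0)) :: 'a \<Rightarrow> real)" for n
  have u: "unit_density (u n)" for n unfolding u_def by (rule indicator_density[OF Y(1) Yb])
  have uR: "u n x = 0" if "norm x > R" for n x
    using Y(2) R that unfolding u_def by (metis indicator_simps(2) not_le subsetD)
  have mod: "sqdiff (u n) h \<le> K * norm h powr \<sigma>" if "norm h \<le> 1" for n h
  proof (rule K(2)[OF u _ _ _ _ that])
    show "0 < \<epsilon> (n + n0)" "\<epsilon> (n + n0) \<le> 1" using eps n0[of "n + n0"] by (auto intro: less_imp_le)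
    show "controlled (\<epsilon> (n + n0)) C (u n)" unfolding u_def by (rule ctrl)
    show "\<exists>\<delta>>0. \<forall>a. norm a \<le> \<delta> \<longrightarrow> sqdiff (u n) a \<le> \<tau>" if "0 < \<tau>" for \<tau>
      unfolding u_def by (rule indicator_translation_continuous[OF Y(1) Yb that])
  qed
  obtain s where s: "strict_mono (s :: nat \<Rightarrow> nat)"
    "\<And>\<tau>. 0 < \<tau> \<Longrightarrow> \<exists>N. \<forall>i\<ge>N. \<forall>j\<ge>N. (LBINT x. (u (s i) x - u (s j) x)\<^sup>2) \<le> \<tau>"
    by (rule equicontinuous_Cauchy_subsequence[where u = u, OF u uR pos(3) K(1) mod]) (auto intro: that)
  define Z where "Z n = Y (s n + n0)" for n
  have Zb: "Z n \<in> sets lborel" for n unfolding Z_def using Y(1) by simp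
  have ZC: "\<exists>N. \<forall>i\<ge>N. \<forall>j\<ge>N. emeasure lborel (sym_diff (Z i) (Z j)) \<le> ennreal \<tau>" if "0 < \<tau>" for \<tau>
  proof -
    have "emeasure lborel (sym_diff (Z i) (Z j)) = ennreal (LBINT x. (u (s i) x - u (s j) x)\<^sup>2)" for i j
      unfolding u_def Z_def by (rule sqdiff_indicator_emeasure[OF Y(1) Y(1) Yb Yb])
    then show ?thesis using s(2)[OF that] by (simp only:) (blast intro: ennreal_leI)
  qed
  obtain s' E where s': "strict_mono (s' :: nat \<Rightarrow> nat)" and E: "E \<in> sets lborel"
    and conv: "(\<lambda>j. emeasure lborel (sym_diff (Z (s' j)) E)) \<longlonglongrightarrow> 0"
    by (rule Cauchy_sets_converge[where X = Z, OF Zb ZC]) (auto intro: that)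
  have El: "E \<in> sets lebesgue" by (rule sets_completionI_sets[OF E])
  have Yl: "Y n \<in> sets lebesgue" for n by (rule sets_completionI_sets) (simp add: Y(1))
  \<comment> \<open>Two extractions, one for the Cauchy property and one for convergence to a set,
    composed with the shift by \<open>n0\<close>.\<close>
  define r where "r n = s (s' n) + n0" for n
  have r: "strict_mono r" using s(1) s' by (simp add: r_def strict_mono_def)
  have "set_conv (X \<circ> r) E"
    unfolding set_conv_def
  proof (rule tendsto_sandwich[OF _ _ tendsto_const conv])
    show "\<forall>\<^sub>F j in sequentially. emeasure lebesgue (sym_diff ((X \<circ> r) j) E) \<le> emeasure lborel (sym_diff (Z (s' j)) E)"
    proof (intro always_eventually allI)
      fix j
      let ?Z = "Z (s' j)"
      have Zr: "?Z = Y (r j)" by (simp add: Z_def r_def)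
      have Zb: "?Z \<in> sets borel" unfolding Zr by (rule Y(1))
      have "emeasure lebesgue (sym_diff ((X \<circ> r) j) E) \<le> emeasure lebesgue (sym_diff (X (r j)) (Y (r j)) \<union> sym_diff ?Z E)"
        using X El Yl unfolding Zr by (intro emeasure_mono) auto
      also have "\<dots> \<le> emeasure lebesgue (sym_diff (X (r j)) (Y (r j))) + emeasure lebesgue (sym_diff ?Z E)"
        using X El Yl unfolding Zr by (intro emeasure_subadditive) auto
      also have "\<dots> = emeasure lborel (sym_diff ?Z E)"
        using null_setsD1[OF Y(3)] E Zb by simp
      finally show "emeasure lebesgue (sym_diff ((X \<circ> r) j) E) \<le> emeasure lborel (sym_diff ?Z E)" .
    qed
  qed simp
  then show "\<exists>r x. strict_mono r \<and> x \<in> sets lebesgue \<and> set_conv (X \<circ> r) x"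
    using r El by auto
qed

section \<open>Admissible kernels\<close>

lemma admissible_coercive_bump:
  fixes \<rho> :: "'a::euclidean_space \<Rightarrow> real"
  assumes adm: "admissible_kernel \<rho>" and mass: "(LINT z|lebesgue. \<rho> z) = real DIM('a)"
    and supp: "kernel_support \<rho> = cball 0 1"
  obtains k \<nu> \<eta> \<sigma> c m where "coercive_bump \<rho> k \<nu> \<eta> \<sigma> c m"
proof -
  let ?d = "DIM('a)"
  obtain \<rho>b \<eta> \<nu> \<sigma> \<gamma> f where f_def: "f = (\<lambda>r. r powr (real ?d - 2) * \<rho>b r)"
    and radial: "\<And>z. z \<noteq> 0 \<Longrightarrow> \<rho> z = \<rho>b (norm z) \<and> 0 \<le> \<rho> z"
    and params: "0 < \<eta>" "0 < \<nu>" "0 < \<sigma>" "\<sigma> \<le> \<gamma>" "\<gamma> < 1"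
    and inf: "0 < (INF z\<in>cball 0 \<eta> - {0}. \<rho> z)"
    and f_anti: "antimono_on {0<..} f"
    and f_anti_near: "antimono_on {0<..<\<eta>} (\<lambda>r. r powr \<nu> * f r)"
    and f_smooth: "\<And>k r. r > 0 \<Longrightarrow> (deriv ^^ k) f field_differentiable (at r)"
    and lower: "almost_nonincreasing_on {0<..<\<eta>} (\<lambda>r. r powr (real ?d + \<sigma> - 1) * \<rho>b r)"
    using adm unfolding admissible_kernel_def Let_def by (elim exE conjE) (rule that[OF refl]; (assumption | blast))
  have sphere: "\<exists>z::'a. norm z = r" if "0 \<le> r" for r
    using that vector_choose_size by blast
  have \<rho>b_nonneg: "0 \<le> \<rho>b r" if r: "0 < r" for r
  proof -
    obtain z :: 'a where "norm z = r" using sphere[of r] r by auto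
    then show ?thesis using radial[of z] r by force
  qed
  have f_nonneg: "0 \<le> f r" if "0 < r" for r
    using \<rho>b_nonneg[OF that] by (simp add: f_def)
  have f_le: "f s \<le> f r" if "0 < r" "r \<le> s" for r s
    using monotone_onD[OF f_anti, of r s] that by auto
  have f_cont: "continuous_on {0<..} f"
    using f_smooth[of _ 0] by (intro continuous_at_imp_continuous_on ballI field_differentiable_imp_continuous_at) auto
  have f_gt1: "f r = 0" if r: "1 < r" for r
  proof -
    obtain z :: 'a where z: "norm z = r" using sphere[of r] r by auto
    have "z \<notin> kernel_support \<rho>" unfolding supp using z r by simp
    then have "z \<notin> {z. z \<noteq> 0 \<and> \<rho> z \<noteq> 0}"
      unfolding kernel_support_def by (rule contra_subsetD[OF closure_subset])
    moreover have "z \<noteq> 0" using z r by auto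
    ultimately have "\<rho>b r = 0" using radial[of z] z by simp
    then show ?thesis by (simp add: f_def)
  qed
  \<comment> \<open>The support forces \<open>f\<close> to vanish beyond \<open>1\<close>; the value
    at \<open>1\<close> follows by continuity.\<close>
  have f_ge1: "f r = 0" if "1 \<le> r" for r
  proof (cases "r = 1")
    case True
    have "(\<lambda>n. f (1 + inverse (real (Suc n)))) \<longlonglongrightarrow> f 1"
    proof (rule continuous_on_tendsto_compose[OF f_cont])
      show "(\<lambda>n. 1 + inverse (real (Suc n))) \<longlonglongrightarrow> 1"
        using tendsto_add[OF tendsto_const LIMSEQ_inverse_real_of_nat, of 1] by simp
    qed (auto intro!: always_eventually simp: add_pos_pos)
    moreover have "f (1 + inverse (real (Suc n))) = 0" for n
      by (rule f_gt1) simp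
    ultimately show ?thesis using True by (simp add: LIMSEQ_const_iff)
  qed (use that f_gt1 in auto)
  \<comment> \<open>A zero of the nonincreasing \<open>f\<close> below \<open>1\<close> would shrink
    the support to a smaller ball. Positivity makes the bump below nontrivial.\<close>
  have f_pos: "0 < f r" if r: "0 < r" "r < 1" for r
  proof (rule ccontr)
    assume "\<not> 0 < f r"
    then have "f s = 0" if "r \<le> s" for s
      using f_le[OF r(1) that] f_nonneg[of s] r(1) that by simp
    then have "\<rho>b s = 0" if "r \<le> s" for s
      using that r(1) by (force simp: f_def)
    then have "norm z \<le> r" if "z \<noteq> 0" "\<rho> z \<noteq> 0" for z
      using radial[of z] that by (metis linear)
    then have "{z. z \<noteq> 0 \<and> \<rho> z \<noteq> 0} \<subseteq> cball 0 r" by auto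
    then have sub: "kernel_support \<rho> \<subseteq> cball 0 r"
      unfolding kernel_support_def by (simp add: closure_minimal)
    obtain z :: 'a where z: "norm z = 1" using sphere[of 1] by auto
    then have "z \<in> cball 0 1" by simp
    with sub have "z \<in> cball 0 r" unfolding supp by (rule subsetD)
    then show False using z r(2) by simp
  qed
  \<comment> \<open>Dividing \<open>\<rho>\<close> by the squared radius leaves \<open>f\<close>
    over the power \<open>DIM('a)\<close> of the radius, since \<open>f\<close> already contains the
    power \<open>DIM('a) - 2\<close>.\<close>
  define k where "k s = (if 0 < s then f (sqrt s) / sqrt s ^ ?d else 0)" for s
  have k_sq: "k (r\<^sup>2) = f r / r ^ ?d" if "0 < r" for r
    using that by (simp add: k_def)
  have rho_eq: "\<rho> z = (z \<bullet> z) * k (z \<bullet> z)" if "z \<noteq> 0" for z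
  proof -
    have n: "0 < norm z" using that by simp
    have "(z \<bullet> z) * k (z \<bullet> z) = (norm z)\<^sup>2 * (norm z powr (real ?d - 2) * \<rho>b (norm z)) / norm z ^ ?d"
      using k_sq[OF n] by (simp add: dot_square_norm f_def)
    also have "\<dots> = (norm z powr 2 * norm z powr (real ?d - 2) / norm z powr real ?d) * \<rho>b (norm z)"
      using n by (simp add: powr_realpow)
    also have "\<dots> = \<rho>b (norm z)"
      using n by (simp add: powr_diff)
    finally show ?thesis using radial[OF that] by simp
  qed
  have k_cont: "continuous_on {0<..} k"
  proof (subst continuous_on_cong[OF refl])
    show "k s = f (sqrt s) / sqrt s ^ ?d" if "s \<in> {0<..}" for s
      using that by (simp add: k_def)
    show "continuous_on {0<..} (\<lambda>s. f (sqrt s) / sqrt s ^ ?d)"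
      by (intro continuous_intros continuous_on_compose2[OF f_cont]) auto
  qed
  have k_nonneg: "0 \<le> k s" for s using f_nonneg by (simp add: k_def)
  have k_borel [measurable]: "k \<in> borel_measurable borel"
  proof -
    have "(\<lambda>s. indicator {0<..} s *\<^sub>R k s) \<in> borel_measurable borel"
      by (rule borel_measurable_continuous_on_indicator[OF _ k_cont]) simp
    also have "(\<lambda>s. indicator {0<..} s *\<^sub>R k s) = k"
      by (auto simp: indicator_def fun_eq_iff k_def)
    finally show ?thesis .
  qed
  let ?w = "\<lambda>z::'a. (z \<bullet> z) * k (z \<bullet> z)"
  have w: "integrable lborel ?w" "(LBINT z. ?w z) = real ?d"
  proof -
    have wb: "?w \<in> borel_measurable lborel" by measurable
    \<comment> \<open>A non-integrable function has integral \<open>0\<close> by convention, so the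
      positive mass forces integrability.\<close>
    have \<rho>i: "integrable lebesgue \<rho>"
      using mass not_integrable_integral_eq[of lebesgue \<rho>] by auto
    have AE: "AE z in lebesgue. \<rho> z = ?w z"
      by (rule AE_mp[OF AE_completion[OF AE_lborel_singleton[of 0]]]) (use rho_eq in auto)
    have wl: "?w \<in> borel_measurable lebesgue" by (rule measurable_completion[OF wb])
    have "integrable lebesgue ?w"
      using integrable_cong_AE[OF _ wl AE] \<rho>i by auto
    then show "integrable lborel ?w" by (simp add: integrable_completion[OF wb])
    have "(LINT z|lebesgue. ?w z) = real ?d"
      using integral_cong_AE[OF _ wl AE] \<rho>i mass by auto
    then show "(LBINT z. ?w z) = real ?d" by (simp add: integral_completion[OF wb])
  qed
  have k_dilate: "k (s / l\<^sup>2) = l ^ ?d * (f (sqrt s / l) / sqrt s ^ ?d)" if "0 < s" "1 \<le> l" for s l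
    using that by (simp add: k_def real_sqrt_divide power_divide)
  have k_scale: "l ^ ?d * k s \<le> k (s / l\<^sup>2)" if s: "0 < s" "1 \<le> l" for s l
  proof -
    have "f (sqrt s) \<le> f (sqrt s / l)"
      using s by (intro f_le) (auto simp: divide_le_eq)
    then show ?thesis
      using s unfolding k_dilate[OF s] by (simp add: k_def mult_left_mono divide_right_mono)
  qed
  have k_scale_near: "l powr \<nu> * (l ^ ?d * k s) \<le> k (s / l\<^sup>2)" if s: "0 < s" "s < (\<eta> / 2)\<^sup>2" "1 \<le> l" for s l
  proof -
    have "sqrt s < \<eta>"
      using real_sqrt_less_mono[OF s(2)] params(1) by simp
    moreover have le: "sqrt s / l \<le> sqrt s" using s by (simp add: divide_le_eq)
    ultimately have "sqrt s powr \<nu> * f (sqrt s) \<le> (sqrt s / l) powr \<nu> * f (sqrt s / l)"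
      using s by (intro monotone_onD[OF f_anti_near _ _ le]) auto
    then have "l powr \<nu> * f (sqrt s) \<le> f (sqrt s / l)"
      using s by (simp add: powr_divide field_simps)
    then show ?thesis
      using s unfolding k_dilate[OF s(1,3)]
      by (simp add: k_def mult.left_commute[of "l powr \<nu>"] mult_left_mono divide_right_mono)
  qed
  obtain C where C: "C \<ge> 1" "\<And>r s. 0 < r \<Longrightarrow> r \<le> s \<Longrightarrow> s < \<eta> \<Longrightarrow>
      s powr (real ?d + \<sigma> - 1) * \<rho>b s \<le> C * (r powr (real ?d + \<sigma> - 1) * \<rho>b r)"
    using lower unfolding almost_nonincreasing_on_def by force
  \<comment> \<open>Almost monotonicity is compared with \<open>\<eta> / 2\<close>, since the
    interval is open at \<open>\<eta>\<close>; this is why the locale is instantiated with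
    \<open>\<eta> / 2\<close>. The positive infimum of \<open>\<rho>\<close> near the origin makes
    \<open>c\<close> positive.\<close>
  define c where "c = (\<eta> / 2) powr (real ?d + \<sigma> - 1) * \<rho>b (\<eta> / 2) / C"
  have \<rho>b_pos: "0 < \<rho>b (\<eta> / 2)"
  proof -
    obtain z :: 'a where z: "norm z = \<eta> / 2" using sphere[of "\<eta> / 2"] params(1) by auto
    then have "z \<in> cball 0 \<eta> - {0}" using params(1) by auto
    moreover have "bdd_below (\<rho> ` (cball 0 \<eta> - {0}))"
      by (rule bdd_belowI2[of _ 0]) (use radial in blast)
    ultimately have "(INF z\<in>cball 0 \<eta> - {0}. \<rho> z) \<le> \<rho> z"
      by (intro cINF_lower)
    then have "0 < \<rho> z" using inf by simp
    moreover have "z \<noteq> 0" using z params(1) by auto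
    ultimately show ?thesis using radial[of z] z by simp
  qed
  have c: "0 < c" using \<rho>b_pos C(1) params(1) by (simp add: c_def)
  have k_lower: "c * r powr (- (real ?d + 1 + \<sigma>)) \<le> k (r\<^sup>2)" if r: "0 < r" "r < \<eta> / 2" for r
  proof -
    have "c \<le> r powr (real ?d + \<sigma> - 1) * \<rho>b r"
      using C(2)[of r "\<eta> / 2"] C(1) r params(1) by (simp add: c_def divide_le_eq mult.commute)
    then have "c * r powr (- (real ?d + 1 + \<sigma>)) \<le> r powr (real ?d + \<sigma> - 1) * \<rho>b r * r powr (- (real ?d + 1 + \<sigma>))"
      by (rule mult_right_mono) simp
    also have "\<dots> = r powr (- 2) * \<rho>b r"
    proof -
      have "r powr (real ?d + \<sigma> - 1) * r powr (- (real ?d + 1 + \<sigma>)) = r powr (- 2)"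
        by (simp add: powr_add[symmetric])
      then show ?thesis by (simp add: mult.commute mult.left_commute)
    qed
    also have "\<dots> = k (r\<^sup>2)"
    proof -
      have "k (r\<^sup>2) = r powr (real ?d - 2) / r powr (real ?d) * \<rho>b r"
        using r by (simp add: k_sq f_def powr_realpow)
      also have "r powr (real ?d - 2) / r powr (real ?d) = r powr (- 2)"
        by (simp add: powr_diff[symmetric])
      finally show ?thesis by simp
    qed
    finally show ?thesis .
  qed
  have k_anti: "k t \<le> k s" if st: "0 < s" "s \<le> t" for s t
    using st f_le[of "sqrt s" "sqrt t"] f_nonneg[of "sqrt s"]
    by (simp add: k_def frac_le power_mono)
  \<comment> \<open>The shift by \<open>1 / 2\<close> stays away from the possible singularity of
    \<open>f\<close> at \<open>0\<close>; the argument reaches \<open>1\<close> before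
    \<open>norm x\<close> does, so \<open>b\<close> lives in the unit ball.\<close>
  define b where "b x = f (1/2 + x \<bullet> x)" for x :: 'a
  have b: "smooth b" unfolding b_def[abs_def] by (rule smooth_radial[OF f_smooth]) auto
  have b_nonneg: "0 \<le> b x" for x by (simp add: b_def f_nonneg add_pos_nonneg)
  have b_supp: "b x = 0" if "norm x > 1" for x
  proof -
    have "1 \<le> x \<bullet> x" using that by (simp add: dot_square_norm one_le_power)
    then show ?thesis unfolding b_def by (intro f_ge1) simp
  qed
  have bi: "integrable lborel b"
    using b_supp unfolding bsupp_def[symmetric]
    by (intro integrable_continuous_bsupp smooth_continuous_on[OF b]) (metis bsupp_def not_le)
  define I where "I = (LBINT x. b x)"
  \<comment> \<open>On the ball of radius \<open>1 / 2\<close> the argument of \<open>f\<close> is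
    at most \<open>3 / 4\<close>, where \<open>f\<close> is still positive.\<close>
  have "0 < I"
  proof -
    have "0 < f (3/4) * measure lborel (cball (0::'a) (1/2))"
      using f_pos[of "3/4"] by (simp add: content_cball)
    also have "\<dots> = (LBINT x. f (3/4) * indicator (cball (0::'a) (1/2)) x)"
      by simp
    also have "\<dots> \<le> I"
      unfolding I_def
    proof (rule integral_mono[OF _ bi])
      show "integrable lborel (\<lambda>x. f (3/4) * indicator (cball (0::'a) (1/2)) x)"
        by (intro integrable_mult_right integrable_indicator_bounded) auto
      show "f (3/4) * indicator (cball 0 (1/2)) x \<le> b x" for x
      proof (cases "norm x \<le> 1/2")
        case True
        then have "x \<bullet> x \<le> 1/4"
          using power_mono[OF True, of 2] by (simp add: dot_square_norm power_divide)
        then show ?thesis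
          unfolding b_def using True f_le[of "1/2 + x \<bullet> x" "3/4"] by (simp add: add_pos_nonneg)
      qed (use b_nonneg in simp)
    qed
    finally show ?thesis .
  qed
  define m where "m x = inverse I *\<^sub>R b x" for x
  have "coercive_bump \<rho> k \<nu> (\<eta> / 2) \<sigma> c m"
  proof unfold_locales
    show "\<rho> z = (z \<bullet> z) * k (z \<bullet> z)" if "z \<noteq> 0" for z by (rule rho_eq[OF that])
    show "k s = 0" if "s \<le> 0" for s using that by (simp add: k_def)
    show "k s = 0" if "1 \<le> s" for s using that f_ge1[of "sqrt s"] by (simp add: k_def)
    show "smooth m" unfolding m_def[abs_def] by (rule smooth_scaleR[OF b])
    show "0 \<le> m x" for x using b_nonneg \<open>0 < I\<close> by (simp add: m_def)
    show "m x = 0" if "norm x > 1" for x using b_supp[OF that] by (simp add: m_def)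
    show "(LBINT x. m x) = 1" using \<open>0 < I\<close> by (simp add: m_def I_def)
  qed (use k_cont k_nonneg k_anti w k_scale k_scale_near k_lower c params in auto)
  then show thesis by (rule that)
qed

theorem corollary5p3:
  fixes \<rho> :: "'a::euclidean_space \<Rightarrow> real" and \<Omega> :: "'a set" and m :: real
  assumes "admissible_kernel \<rho>"
    and "(LINT z|lebesgue. \<rho> z) = real DIM('a)"
    and "kernel_support \<rho> = cball 0 1"
    and "open \<Omega>" and "bounded \<Omega>"
    and "0 < m" and "m < measure lebesgue \<Omega>"
  shows "gamma_converges (sets lebesgue) local_set_conv
           (\<lambda>\<epsilon>. nonlocal_perimeter (rescale \<rho> \<epsilon>)) perimeter
    \<and> gamma_converges (sets lebesgue) set_conv
           (\<lambda>\<epsilon>. constrained (nonlocal_perimeter (rescale \<rho> \<epsilon>)) \<Omega> m)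
           (constrained perimeter \<Omega> m)
    \<and> equi_coercive (sets lebesgue) set_conv
           (\<lambda>\<epsilon>. constrained (nonlocal_perimeter (rescale \<rho> \<epsilon>)) \<Omega> m)"
proof -
  obtain k \<nu> \<eta> \<sigma> c b where "coercive_bump \<rho> k \<nu> \<eta> \<sigma> c b"
    using admissible_coercive_bump[OF assms(1-3)] .
  then interpret coercive_bump \<rho> k \<nu> \<eta> \<sigma> c b .
  have "\<Omega> \<in> sets lebesgue" using assms(4) by (intro sets_completionI_sets) simp
  then show ?thesis
    using gamma_local gamma_constrained equi_coercive_constrained assms(5) by blast
qed

end
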